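(* Let $0\le\alpha\le1$, $\theta\ge0$ and $(n_1,\ldots,n_k)\in\mathcal{C}$. Let $Q$ be a Q-matrix on $\mathbb{N}_0$ and $p,p^-$ probability distributions on $\mathbb{N}=\{1,2,\ldots\}$ such that: (i) $q_{0,0}=0$, i.e.\ $0$ is absorbing; (ii) $\mathbb{P}_n(\zeta<\infty)=1$ for all $n\ge1$, where $\mathbb{P}_n$ is the law of a $Q$-Markov chain started from $n$ and $\zeta$ its hitting time of $0$ (in particular $\sum_{n\ge1}p^-_n\mathbb{P}_n(\zeta<\infty)=1$); (iii) $\sum_{n\ge1}p_n\mathbb{E}_n(\zeta)\le1/\alpha$. For $n\ge1$ let $P_n$ be the law of the marked process $(X,Z)=((X_t)_{0\le t\le T},(Z^i)_{0\le i\le J_T})$, where $(Z^i)_{i\ge0}$ are independent $Q$-Markov chains with $Z^0(0)=n$ and $Z^i(0)\sim p$ for $i\ge1$, $\zeta_i=\inf\{s\colon Z^i(s)=0\}$, $(J_t)$ is an independent rate-$\alpha$ Poisson process, $X_t=-t+\sum_{i=0}^{J_t}\zeta_i$, $T=\inf\{t\ge0\colon X_t=0\}$, and $Z^i$ marks the $i$-th jump of $X$ (the $0$-th at time $0$ from level $X_{0-}:=0$). Let $P_{p^-}=\sum_{n\ge1}p^-_nP_n$. Let $(\mathcal{S}^y)_{y\ge0}=(\mathcal{S}^{1,y}\cdots\mathcal{S}^{k,y})_{y\ge0}$ be the concatenation of the skewer processes of $k$ independent marked processes with laws $P_{n_1},\ldots,P_{n_k}$. Independently, let $(A_{-j})_{j\ge1}$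 be the points of a rate-$\theta$ Poisson process on $(0,\infty)$ (none if $\theta=0$), and $((X^{-j}_r)_{0\le r\le\xi_{-j}},\text{marks})$, $j\ge1$, IID marked processes with law $P_{p^-}$, independent of $(A_{-j})$; build $(X_t)_{t<0}$ with $L_{-j}=-A_{-j}-\sum_{i=1}^j\xi_{-i}$, $R_{-j}=L_{-j}+\xi_{-j}$, $L_0=0$, $X_t=A_{-j}+X^{-j}_{t-L_{-j}}$ on $[L_{-j},R_{-j}]$ and $X_t=|t|-\sum_{i=1}^{j-1}\xi_{-i}$ on $(R_{-j},L_{-j+1})$, jumps inheriting the marks of the corresponding jumps of $X^{-j}$; and let $\mathcal{S}^y_-$ list, left to right in increasing order of jump time, the values $Z(y-B)$ over all jumps of $(X_t)_{t<0}$ with pre-jump height $B$, post-jump height $D$ and mark $Z$ such that $B\le y<D$. Then the concatenated skewer process $(\mathcal{S}^y_-\mathcal{S}^y)_{y\ge0}$ is Markovian.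
   Context: $\mathcal{C}$ is the set of integer compositions $(n_1,\ldots,n_k)$, $k\ge0$, $n_i\ge1$, and $uv$ denotes concatenation. Skewer process of a marked path $(X,Z)$ with jump times $U_0<\cdots<U_J$, pre-jump heights $B_i=X_{U_i-}$, post-jump heights $D_i=X_{U_i}$ and marks $Z^i$ (positive-integer-valued paths on $[0,D_i-B_i)$): for $y\ge0$, listing the indices $i$ with $B_i\le y<D_i$ in increasing order as $I^y_1<\cdots<I^y_{K^y}$, $\mathcal{S}^y=(Z^{I^y_l}(y-B_{I^y_l}))_{1\le l\le K^y}$. *)

theory Defs
  imports "HOL-Probability.Probability"
begin

definition qmatrix :: "(nat \<Rightarrow> nat \<Rightarrow> real) \<Rightarrow> bool" where
  "qmatrix Q \<longleftrightarrow> (\<forall>i j. i \<noteq> j \<longrightarrow> 0 \<le> Q i j) \<and>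
     (\<forall>i. (\<lambda>j. if j = i then 0 else Q i j) sums (- Q i i))"

definition rate :: "(nat \<Rightarrow> nat \<Rightarrow> real) \<Rightarrow> nat \<Rightarrow> real" where
  "rate Q i = - Q i i"

definition jump_prob :: "(nat \<Rightarrow> nat \<Rightarrow> real) \<Rightarrow> nat \<Rightarrow> nat \<Rightarrow> real" where
  "jump_prob Q y z =
     (if rate Q y \<noteq> 0 then (if z = y then 0 else Q y z / rate Q y)
      else (if z = y then 1 else 0))"

definition prob_dist :: "(nat \<Rightarrow> real) \<Rightarrow> bool" where
  "prob_dist p \<longleftrightarrow> (\<forall>n. 0 \<le> p n) \<and> p 0 = 0 \<and> p sums 1"

text \<open>Finite sequences of visited states (all nonzero) of the jump chain started at n,
  before it jumps to 0.\<close>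
definition hit_paths :: "nat \<Rightarrow> nat list set" where
  "hit_paths n = {ys. ys \<noteq> [] \<and> hd ys = n \<and> (\<forall>y\<in>set ys. y \<noteq> 0)}"

definition path_weight :: "(nat \<Rightarrow> nat \<Rightarrow> real) \<Rightarrow> nat list \<Rightarrow> real" where
  "path_weight Q ys = (\<Prod>i<length ys. jump_prob Q (ys ! i) ((ys @ [0]) ! Suc i))"

text \<open>P_n(zeta < infinity) for the (minimal) Q-chain started at n.\<close>
definition hit_prob :: "(nat \<Rightarrow> nat \<Rightarrow> real) \<Rightarrow> nat \<Rightarrow> ennreal" where
  "hit_prob Q n = (\<Sum>\<^sub>\<infinity> ys\<in>hit_paths n. ennreal (path_weight Q ys))"

text \<open>E_n(zeta): infinite unless zeta is a.s. finite; otherwise sum over paths of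
  path probability times expected total holding time.\<close>
definition exp_hit :: "(nat \<Rightarrow> nat \<Rightarrow> real) \<Rightarrow> nat \<Rightarrow> ennreal" where
  "exp_hit Q n =
     (if hit_prob Q n = 1
      then (\<Sum>\<^sub>\<infinity> ys\<in>hit_paths n. ennreal (path_weight Q ys) *
               ennreal (\<Sum>i<length ys. 1 / rate Q (ys ! i)))
      else \<infinity>)"

text \<open>Sources of marked processes: Pos c (c-th block of the composition, c < k),
  Neg j (the j-th excursion to the left, j >= 1).\<close>
datatype src = Pos nat | Neg nat

text \<open>PInit r i: initial state of i-th chain of source r;
  PStep r i m y: next state if the m-th visited state of that chain is y;
  PHold r i m y: unit exponential for the m-th holding time if the state is y;
  PGap r l: unit exponential gaps of the rate-alpha Poisson process of source r;
  PTh l: unit exponential gaps of the rate-theta Poisson process.\<close>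
datatype prim = PInit src nat | PStep src nat nat nat | PHold src nat nat nat
  | PGap src nat | PTh nat

definition natv :: "real \<Rightarrow> nat" where "natv x = nat \<lfloor>x\<rfloor>"

primrec cst :: "(prim \<Rightarrow> real) \<Rightarrow> src \<Rightarrow> nat \<Rightarrow> nat \<Rightarrow> nat" where
  "cst v r i 0 = natv (v (PInit r i))"
| "cst v r i (Suc m) = natv (v (PStep r i m (cst v r i m)))"

definition hold :: "(nat \<Rightarrow> nat \<Rightarrow> real) \<Rightarrow> (prim \<Rightarrow> real) \<Rightarrow> src \<Rightarrow> nat \<Rightarrow> nat \<Rightarrow> real" where
  "hold Q v r i m = v (PHold r i m (cst v r i m)) / rate Q (cst v r i m)"

definition nsteps :: "(prim \<Rightarrow> real) \<Rightarrow> src \<Rightarrow> nat \<Rightarrow> nat" where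
  "nsteps v r i = (LEAST m. cst v r i m = 0)"

definition life :: "(nat \<Rightarrow> nat \<Rightarrow> real) \<Rightarrow> (prim \<Rightarrow> real) \<Rightarrow> src \<Rightarrow> nat \<Rightarrow> real" where
  "life Q v r i = (\<Sum>m<nsteps v r i. hold Q v r i m)"

text \<open>Z^i(s) for 0 <= s < zeta_i.\<close>
definition mark :: "(nat \<Rightarrow> nat \<Rightarrow> real) \<Rightarrow> (prim \<Rightarrow> real) \<Rightarrow> src \<Rightarrow> nat \<Rightarrow> real \<Rightarrow> nat" where
  "mark Q v r i s = cst v r i (LEAST m. s < (\<Sum>l\<le>m. hold Q v r i l))"

text \<open>Time of the i-th jump (i >= 1) of the rate-alpha Poisson process; jump 0 at time 0.\<close>
definition jtime :: "real \<Rightarrow> (prim \<Rightarrow> real) \<Rightarrow> src \<Rightarrow> nat \<Rightarrow> real" where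
  "jtime \<alpha> v r i = (\<Sum>l<i. v (PGap r l)) / \<alpha>"

text \<open>J_T: index of the last jump before X hits 0.\<close>
definition njumps :: "(nat \<Rightarrow> nat \<Rightarrow> real) \<Rightarrow> real \<Rightarrow> (prim \<Rightarrow> real) \<Rightarrow> src \<Rightarrow> nat" where
  "njumps Q \<alpha> v r =
     (LEAST i. \<alpha> = 0 \<or> (\<Sum>l\<le>i. life Q v r l) < jtime \<alpha> v r (Suc i))"

text \<open>Pre-jump height B_i = X_{U_i-}; post-jump height is B_i + zeta_i.\<close>
definition pre_h :: "(nat \<Rightarrow> nat \<Rightarrow> real) \<Rightarrow> real \<Rightarrow> (prim \<Rightarrow> real) \<Rightarrow> src \<Rightarrow> nat \<Rightarrow> real" where
  "pre_h Q \<alpha> v r i = (\<Sum>l<i. life Q v r l) - jtime \<alpha> v r i"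

definition skewer :: "(nat \<Rightarrow> nat \<Rightarrow> real) \<Rightarrow> real \<Rightarrow> (prim \<Rightarrow> real) \<Rightarrow> src \<Rightarrow> real \<Rightarrow> nat list" where
  "skewer Q \<alpha> v r y =
     map (\<lambda>i. mark Q v r i (y - pre_h Q \<alpha> v r i))
       (filter (\<lambda>i. pre_h Q \<alpha> v r i \<le> y \<and> y < pre_h Q \<alpha> v r i + life Q v r i)
          [0..<Suc (njumps Q \<alpha> v r)])"

definition pos_skewer :: "(nat \<Rightarrow> nat \<Rightarrow> real) \<Rightarrow> real \<Rightarrow> nat list \<Rightarrow> (prim \<Rightarrow> real) \<Rightarrow> real \<Rightarrow> nat list" where
  "pos_skewer Q \<alpha> ns v y = concat (map (\<lambda>c. skewer Q \<alpha> v (Pos c) y) [0..<length ns])"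

definition negpt :: "real \<Rightarrow> (prim \<Rightarrow> real) \<Rightarrow> nat \<Rightarrow> real" where
  "negpt \<theta> v j = (\<Sum>l<j. v (PTh l)) / \<theta>"

definition neg_count :: "real \<Rightarrow> (prim \<Rightarrow> real) \<Rightarrow> real \<Rightarrow> nat" where
  "neg_count \<theta> v y = (if \<theta> = 0 then 0 else card {j. 1 \<le> j \<and> negpt \<theta> v j \<le> y})"

text \<open>Skewer of (X_t)_{t<0}: blocks j ordered by increasing time, i.e. decreasing j.\<close>
definition neg_skewer :: "(nat \<Rightarrow> nat \<Rightarrow> real) \<Rightarrow> real \<Rightarrow> real \<Rightarrow> (prim \<Rightarrow> real) \<Rightarrow> real \<Rightarrow> nat list" where
  "neg_skewer Q \<alpha> \<theta> v y =
     concat (map (\<lambda>j. skewer Q \<alpha> v (Neg j) (y - negpt \<theta> v j)) (rev [1..<Suc (neg_count \<theta> v y)]))"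

definition full_skewer :: "(nat \<Rightarrow> nat \<Rightarrow> real) \<Rightarrow> real \<Rightarrow> real \<Rightarrow> nat list \<Rightarrow> (prim \<Rightarrow> real) \<Rightarrow> real \<Rightarrow> nat list" where
  "full_skewer Q \<alpha> \<theta> ns v y = neg_skewer Q \<alpha> \<theta> v y @ pos_skewer Q \<alpha> ns v y"

definition past_alg :: "'w measure \<Rightarrow> (real \<Rightarrow> 'w \<Rightarrow> 'b) \<Rightarrow> real \<Rightarrow> 'w measure" where
  "past_alg M S s = sigma (space M) {S u -` A \<inter> space M | u A. 0 \<le> u \<and> u \<le> s}"

definition present_alg :: "'w measure \<Rightarrow> (real \<Rightarrow> 'w \<Rightarrow> 'b) \<Rightarrow> real \<Rightarrow> 'w measure" where
  "present_alg M S s = sigma (space M) {S s -` A \<inter> space M | A. True}"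

definition markov_process :: "'w measure \<Rightarrow> (real \<Rightarrow> 'w \<Rightarrow> 'b) \<Rightarrow> bool" where
  "markov_process M S \<longleftrightarrow>
     (\<forall>t\<ge>0. S t \<in> M \<rightarrow>\<^sub>M count_space UNIV) \<and>
     (\<forall>s t A. 0 \<le> s \<longrightarrow> s \<le> t \<longrightarrow>
        (AE w in M. real_cond_exp M (past_alg M S s) (indicator {w \<in> space M. S t w \<in> A}) w
                  = real_cond_exp M (present_alg M S s) (indicator {w \<in> space M. S t w \<in> A}) w))"

end

theory Submission
  imports Defs
begin

text \<open>
  The contour is explored step by step. Each step uses a fresh exponential variable, so the exploration
  restarts afresh when it crosses a fixed level \<open>s\<close>, upwards (within a holding time) or downwards
  (within a gap). Hence the part of a block above \<open>s\<close> is, given the list of states met at \<open>s\<close>, a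
  concatenation of independent blocks started from these states, independent of what is recorded below
  \<open>s\<close>; immigrants above \<open>s\<close> form an independent copy of the immigration. This bounds the joint law of
  the lists at levels \<open>us\<close>, \<open>s\<close> and \<open>t\<close> from below by the joint law at \<open>us\<close> and \<open>s\<close> times a kernel,
  and the two agree because the kernel has mass one.

  Mass one means that the contour returns to \<open>0\<close>. By the restart property the probability of returning
  from height \<open>h\<close> is at least \<open>exp (- \<lambda> h)\<close> with \<open>\<lambda> = \<alpha> (1 - c)\<close>, where \<open>c\<close> is the probability that the
  excursion started by a birth ends. Then \<open>1 - c\<close> is at most the mean of \<open>1 - \<Prod> \<rho> / (\<rho> + \<lambda>)\<close> over
  the path of a chain with rates \<open>\<rho>\<close>, which for \<open>\<lambda> > 0\<close> is strictly below \<open>\<lambda>\<close> times the mean lifetime,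
  hence below \<open>\<lambda> / \<alpha> = 1 - c\<close>; so \<open>\<lambda> = 0\<close>.
\<close>

subsection \<open>Discrete functionals\<close>

text \<open>In \<open>exploration\<close> nothing guarantees that a contour ends, so its laws are
  only known to have mass at most one. Truncation after \<open>N\<close> steps makes them definable
  by recursion and comparable by induction on \<open>N\<close>. Exact identities are lost by
  truncation: a cut at a level distributes \<open>N\<close> steps over the parts above and below it
  in ways that depend on the path. Inequalities survive, since a budget can be enlarged; this is why
  every decomposition is proved one-sidedly and equality is recovered from total mass. The same
  device links the recursion to the skewer: there \<open>LEAST\<close> returns arbitrary values
  along a path that never ends, and only finished runs are compared with it.

  Lists recorded at finitely many levels form a countable type, so a law is a family of weights,
  which is what \<open>dfun\<close> says. Composition, Tonelli and monotone convergence then hold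
  for arbitrary test functions, and independent parts of the contour can be interchanged freely.

  The moment condition admits equality, the critical case; there only the strict inequality in
  \<open>discount\<close> excludes a positive \<lambda>.\<close>

definition dfun :: "(('a::countable \<Rightarrow> ennreal) \<Rightarrow> ennreal) \<Rightarrow> bool" where
  "dfun F \<longleftrightarrow> (\<exists>u. \<forall>\<phi>. F \<phi> = (\<integral>\<^sup>+a. u a * \<phi> a \<partial>count_space UNIV))"

lemma nn_integral_count_space_swap:
  fixes f :: "'a \<Rightarrow> 'b::countable \<Rightarrow> ennreal"
  assumes "\<And>b. (\<lambda>x. f x b) \<in> borel_measurable M"
  shows "(\<integral>\<^sup>+x. (\<integral>\<^sup>+b. f x b \<partial>count_space UNIV) \<partial>M) = (\<integral>\<^sup>+b. (\<integral>\<^sup>+x. f x b \<partial>M) \<partial>count_space UNIV)"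
  by (rule nn_integral_count_space_nn_integral) (auto intro: assms)

lemma dfun_repr:
  assumes "dfun F"
  shows "F \<phi> = (\<integral>\<^sup>+a. F (indicator {a}) * \<phi> a \<partial>count_space UNIV)"
proof -
  obtain u where u: "\<And>\<phi>. F \<phi> = (\<integral>\<^sup>+a. u a * \<phi> a \<partial>count_space UNIV)"
    using assms unfolding dfun_def by blast
  have "F (indicator {a}) = u a" for a
  proof -
    have "F (indicator {a}) = (\<integral>\<^sup>+b. u b * indicator {a} b \<partial>count_space UNIV)"
      by (rule u)
    also have "\<dots> = u a"
      by (subst nn_integral_count_space'[where A = "{a}"]) auto
    finally show ?thesis .
  qed
  then show ?thesis by (simp add: u)
qed

lemma dfunI:
  assumes "\<And>\<phi>. F \<phi> = (\<integral>\<^sup>+a. u a * \<phi> a \<partial>count_space UNIV)"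
  shows "dfun F"
  using assms unfolding dfun_def by blast

text \<open>Measurability is asked for on singletons; countable sums extend it to all test
  functions.\<close>

lemma dfun_integral:
  assumes "\<And>x. dfun (F x)" and [measurable]: "\<And>a. (\<lambda>x. F x (indicator {a})) \<in> borel_measurable M"
  shows "dfun (\<lambda>\<phi>. \<integral>\<^sup>+x. F x \<phi> \<partial>M)"
proof (rule dfunI)
  fix \<phi>
  have "(\<integral>\<^sup>+x. F x \<phi> \<partial>M) = (\<integral>\<^sup>+x. (\<integral>\<^sup>+a. F x (indicator {a}) * \<phi> a \<partial>count_space UNIV) \<partial>M)"
    by (intro nn_integral_cong dfun_repr assms(1))
  also have "\<dots> = (\<integral>\<^sup>+a. (\<integral>\<^sup>+x. F x (indicator {a}) * \<phi> a \<partial>M) \<partial>count_space UNIV)"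
    by (intro nn_integral_count_space_swap) auto
  also have "\<dots> = (\<integral>\<^sup>+a. (\<integral>\<^sup>+x. F x (indicator {a}) \<partial>M) * \<phi> a \<partial>count_space UNIV)"
    by (intro nn_integral_cong nn_integral_multc) auto
  finally show "(\<integral>\<^sup>+x. F x \<phi> \<partial>M) = (\<integral>\<^sup>+a. (\<integral>\<^sup>+x. F x (indicator {a}) \<partial>M) * \<phi> a \<partial>count_space UNIV)" .
qed

lemma dfun_point: "dfun (\<lambda>\<phi>. \<phi> a)"
proof (rule dfunI)
  fix \<phi>
  show "\<phi> a = (\<integral>\<^sup>+b. indicator {a} b * \<phi> b \<partial>count_space UNIV)"
    by (subst nn_integral_count_space'[where A = "{a}"]) auto
qed

lemma dfun_zero: "dfun (\<lambda>\<phi>. 0)"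
  by (rule dfunI[of _ "\<lambda>_. 0"]) simp

lemma dfun_bind:
  assumes F: "dfun F" and G: "\<And>a. dfun (G a)"
  shows "dfun (\<lambda>\<phi>. F (\<lambda>a. G a \<phi>))"
proof (rule dfunI)
  fix \<phi>
  have "F (\<lambda>a. G a \<phi>) = (\<integral>\<^sup>+a. F (indicator {a}) * (\<integral>\<^sup>+b. G a (indicator {b}) * \<phi> b \<partial>count_space UNIV) \<partial>count_space UNIV)"
    by (subst dfun_repr[OF F], intro nn_integral_cong arg_cong2[where f="(*)"] refl dfun_repr G)
  also have "\<dots> = (\<integral>\<^sup>+a. (\<integral>\<^sup>+b. F (indicator {a}) * (G a (indicator {b}) * \<phi> b) \<partial>count_space UNIV) \<partial>count_space UNIV)"
    by (intro nn_integral_cong nn_integral_cmult[symmetric]) auto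
  also have "\<dots> = (\<integral>\<^sup>+b. (\<integral>\<^sup>+a. F (indicator {a}) * (G a (indicator {b}) * \<phi> b) \<partial>count_space UNIV) \<partial>count_space UNIV)"
    by (intro nn_integral_count_space_swap) auto
  also have "\<dots> = (\<integral>\<^sup>+b. (\<integral>\<^sup>+a. F (indicator {a}) * G a (indicator {b}) \<partial>count_space UNIV) * \<phi> b \<partial>count_space UNIV)"
    by (intro nn_integral_cong, subst nn_integral_multc[symmetric]) (auto simp: mult.assoc)
  finally show "F (\<lambda>a. G a \<phi>) = (\<integral>\<^sup>+b. (\<integral>\<^sup>+a. F (indicator {a}) * G a (indicator {b}) \<partial>count_space UNIV) * \<phi> b \<partial>count_space UNIV)" .
qed

lemma dfun_comp: "dfun F \<Longrightarrow> dfun (\<lambda>\<phi>. F (\<lambda>a. \<phi> (g a)))"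
  by (rule dfun_bind[where G = "\<lambda>a \<phi>. \<phi> (g a)"]) (auto intro: dfun_point)

lemma dfun_mono:
  assumes F: "dfun F" and "\<And>a. \<phi> a \<le> \<psi> a"
  shows "F \<phi> \<le> F \<psi>"
proof -
  obtain u where u: "\<And>\<phi>. F \<phi> = (\<integral>\<^sup>+a. u a * \<phi> a \<partial>count_space UNIV)"
    using F unfolding dfun_def by blast
  show ?thesis
    unfolding u by (intro nn_integral_mono mult_left_mono assms) simp
qed

lemma dfun_cmult:
  assumes F: "dfun F"
  shows "F (\<lambda>a. c * \<phi> a) = c * F \<phi>"
proof -
  obtain u where u: "\<And>\<phi>. F \<phi> = (\<integral>\<^sup>+a. u a * \<phi> a \<partial>count_space UNIV)"
    using F unfolding dfun_def by blast
  show ?thesis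
    unfolding u by (subst nn_integral_cmult[symmetric]) (auto simp: mult.left_commute)
qed

lemma dfun_const:
  assumes F: "dfun F"
  shows "F (\<lambda>a. c) = c * F (\<lambda>_. 1)"
  using dfun_cmult[OF F, of c "\<lambda>_. 1"] by simp

lemma dfun_add:
  assumes F: "dfun F"
  shows "F (\<lambda>a. \<phi> a + \<psi> a) = F \<phi> + F \<psi>"
proof -
  obtain u where u: "\<And>\<phi>. F \<phi> = (\<integral>\<^sup>+a. u a * \<phi> a \<partial>count_space UNIV)"
    using F unfolding dfun_def by blast
  show ?thesis
    unfolding u by (subst nn_integral_add[symmetric]) (auto simp: distrib_left)
qed

lemma dfun_SUP_arg:
  assumes F: "dfun F" and "incseq \<phi>"
  shows "F (\<lambda>a. SUP n. \<phi> n a) = (SUP n. F (\<phi> n))"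
proof -
  have "F (\<lambda>a. SUP n. \<phi> n a) = (\<integral>\<^sup>+a. (SUP n. F (indicator {a}) * \<phi> n a) \<partial>count_space UNIV)"
    by (subst dfun_repr[OF F]) (simp add: SUP_mult_left_ennreal)
  also have "\<dots> = (SUP n. (\<integral>\<^sup>+a. F (indicator {a}) * \<phi> n a \<partial>count_space UNIV))"
    using assms(2)
    by (intro nn_integral_monotone_convergence_SUP) (auto simp: incseq_def le_fun_def intro!: mult_left_mono)
  also have "\<dots> = (SUP n. F (\<phi> n))"
    by (simp flip: dfun_repr[OF F])
  finally show ?thesis .
qed

lemma dfun_SUP:
  assumes F: "\<And>n. dfun (F n)" and inc: "\<And>n \<phi>. F n \<phi> \<le> F (Suc n) \<phi>"
  shows "dfun (\<lambda>\<phi>. SUP n. F n \<phi>)"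
proof (rule dfunI)
  fix \<phi>
  have "(SUP n. F n \<phi>) = (SUP n. (\<integral>\<^sup>+a. F n (indicator {a}) * \<phi> a \<partial>count_space UNIV))"
    by (simp flip: dfun_repr[OF F])
  also have "\<dots> = (\<integral>\<^sup>+a. (SUP n. F n (indicator {a}) * \<phi> a) \<partial>count_space UNIV)"
    by (intro nn_integral_monotone_convergence_SUP[symmetric])
       (auto intro!: incseq_SucI mult_right_mono inc simp: le_fun_def)
  also have "\<dots> = (\<integral>\<^sup>+a. (SUP n. F n (indicator {a})) * \<phi> a \<partial>count_space UNIV)"
    by (simp add: SUP_mult_right_ennreal)
  finally show "(SUP n. F n \<phi>) = (\<integral>\<^sup>+a. (SUP n. F n (indicator {a})) * \<phi> a \<partial>count_space UNIV)" .
qed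

text \<open>Tonelli for two weight families. It expresses the independence of two parts of the
  contour and lets the average over one part be moved past the other, as in
  \<open>explore_branch_cross\<close> and \<open>blocks_branch\<close>.\<close>

lemma dfun_swap:
  assumes F: "dfun F" and G: "dfun G"
  shows "F (\<lambda>a. G (\<lambda>b. \<phi> a b)) = G (\<lambda>b. F (\<lambda>a. \<phi> a b))"
proof -
  have "F (\<lambda>a. G (\<lambda>b. \<phi> a b)) = (\<integral>\<^sup>+a. F (indicator {a}) * (\<integral>\<^sup>+b. G (indicator {b}) * \<phi> a b \<partial>count_space UNIV) \<partial>count_space UNIV)"
    by (subst dfun_repr[OF F], intro nn_integral_cong arg_cong2[where f="(*)"] refl dfun_repr G)
  also have "\<dots> = (\<integral>\<^sup>+a. (\<integral>\<^sup>+b. F (indicator {a}) * (G (indicator {b}) * \<phi> a b) \<partial>count_space UNIV) \<partial>count_space UNIV)"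
    by (intro nn_integral_cong nn_integral_cmult[symmetric]) auto
  also have "\<dots> = (\<integral>\<^sup>+b. (\<integral>\<^sup>+a. F (indicator {a}) * (G (indicator {b}) * \<phi> a b) \<partial>count_space UNIV) \<partial>count_space UNIV)"
    by (intro nn_integral_count_space_swap) auto
  also have "\<dots> = (\<integral>\<^sup>+b. G (indicator {b}) * (\<integral>\<^sup>+a. F (indicator {a}) * \<phi> a b \<partial>count_space UNIV) \<partial>count_space UNIV)"
    by (intro nn_integral_cong, subst nn_integral_cmult[symmetric]) (auto simp: ac_simps)
  also have "\<dots> = (\<integral>\<^sup>+b. G (indicator {b}) * F (\<lambda>a. \<phi> a b) \<partial>count_space UNIV)"
    by (simp flip: dfun_repr[OF F])
  also have "\<dots> = G (\<lambda>b. F (\<lambda>a. \<phi> a b))"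
    by (simp flip: dfun_repr[OF G])
  finally show ?thesis .
qed

lemma measurable_nn_integral_count_space:
  fixes f :: "'a \<Rightarrow> 'b::countable \<Rightarrow> ennreal"
  assumes [measurable]: "\<And>b. (\<lambda>x. f x b) \<in> borel_measurable M"
  shows "(\<lambda>x. \<integral>\<^sup>+b. f x b \<partial>count_space UNIV) \<in> borel_measurable M"
proof -
  have "(\<lambda>x. f (fst x) (snd x)) \<in> borel_measurable (M \<Otimes>\<^sub>M count_space (UNIV::'b set))"
    by (rule measurable_compose_countable[where f="\<lambda>b x. f (fst x) b" and g=snd]) auto
  then show ?thesis
    by (intro sigma_finite_measure.borel_measurable_nn_integral sigma_finite_measure_count_space)
       (simp add: case_prod_beta)
qed

lemma measurable_dfun:
  assumes F: "\<And>x. dfun (F x)"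
    and [measurable]: "\<And>a. (\<lambda>x. F x (indicator {a})) \<in> borel_measurable M" "\<And>a. (\<lambda>x. \<phi> x a) \<in> borel_measurable M"
  shows "(\<lambda>x. F x (\<phi> x)) \<in> borel_measurable M"
proof -
  have "(\<lambda>x. F x (\<phi> x)) = (\<lambda>x. \<integral>\<^sup>+a. F x (indicator {a}) * \<phi> x a \<partial>count_space UNIV)"
    by (intro ext dfun_repr F)
  also have "\<dots> \<in> borel_measurable M"
    by (intro measurable_nn_integral_count_space) auto
  finally show ?thesis .
qed

text \<open>The differences of the weights are nonnegative and sum to \<open>1 - 1\<close>. Finished
  explorations give the domination, and the equality of the masses shows that nothing was
  missed.\<close>

lemma dfun_eqI:
  assumes F: "dfun F" and G: "dfun G" and le: "\<And>a. F (indicator {a}) \<le> G (indicator {a})"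
    and mass: "F (\<lambda>_. 1) = 1" "G (\<lambda>_. 1) = 1"
  shows "F = G"
proof -
  let ?u = "\<lambda>a. F (indicator {a})" and ?v = "\<lambda>a. G (indicator {a})"
  have s: "(\<integral>\<^sup>+a. ?u a \<partial>count_space UNIV) = 1" "(\<integral>\<^sup>+a. ?v a \<partial>count_space UNIV) = 1"
    using dfun_repr[OF F, of "\<lambda>_. 1"] dfun_repr[OF G, of "\<lambda>_. 1"] mass by auto
  have "(\<integral>\<^sup>+a. ?v a - ?u a \<partial>count_space UNIV) = 0"
    using s le by (subst nn_integral_diff) (auto simp: AE_count_space)
  then have "?v a - ?u a = 0" for a
    by (subst (asm) nn_integral_0_iff_AE) (auto simp: AE_count_space)
  then have "?v a = ?u a" for a
    using le[of a] by (metis diff_eq_0_iff_ennreal diff_eq_0_ennreal antisym ennreal_minus_eq_0)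
  then show ?thesis
    by (intro ext) (subst dfun_repr[OF F], subst dfun_repr[OF G], simp)
qed

lemma measurable_nn_integral_pmf:
  fixes p :: "nat pmf"
  assumes [measurable]: "\<And>z. (\<lambda>x. f x z) \<in> borel_measurable M"
  shows "(\<lambda>x. \<integral>\<^sup>+z. f x z \<partial>measure_pmf p) \<in> borel_measurable M"
  unfolding nn_integral_measure_pmf by (intro measurable_nn_integral_count_space) auto

subsection \<open>The unit exponential law\<close>

definition expo :: "real measure" where
  "expo = density lborel (exponential_density 1)"

interpretation expo: prob_space expo
  unfolding expo_def by (intro prob_space_exponential_density) simp

lemma sets_expo [simp, measurable_cong]: "sets expo = sets borel"
  and space_expo [simp]: "space expo = UNIV"
  by (simp_all add: expo_def)

lemma nn_integral_expo:
  "f \<in> borel_measurable borel \<Longrightarrow>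
    (\<integral>\<^sup>+x. f x \<partial>expo) = (\<integral>\<^sup>+x. ennreal (exponential_density 1 x) * f x \<partial>lborel)"
  unfolding expo_def by (subst nn_integral_density) auto

lemma AE_expo_pos: "AE x in expo. 0 < x"
proof -
  have "AE x in lborel. x \<noteq> (0::real)"
    by (rule AE_lborel_singleton)
  then show ?thesis
    unfolding expo_def by (subst AE_density) (auto simp: exponential_density_def)
qed

lemma AE_expo_neq: "AE x in expo. x \<noteq> c"
proof -
  have "AE x in lborel. x \<noteq> c"
    by (rule AE_lborel_singleton)
  then show ?thesis
    unfolding expo_def by (subst AE_density) auto
qed

lemma expo_memoryless:
  assumes [measurable]: "f \<in> borel_measurable borel" and c: "0 \<le> c"
  shows "(\<integral>\<^sup>+x. indicator {c<..} x * f x \<partial>expo) = ennreal (exp (- c)) * (\<integral>\<^sup>+x. f (c + x) \<partial>expo)"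
proof -
  have "(\<integral>\<^sup>+x. indicator {c<..} x * f x \<partial>expo)
      = (\<integral>\<^sup>+x. ennreal (exponential_density 1 x) * (indicator {c<..} x * f x) \<partial>lborel)"
    by (rule nn_integral_expo) auto
  also have "\<dots> = (\<integral>\<^sup>+x. ennreal (exponential_density 1 (c + x)) * (indicator {c<..} (c + x) * f (c + x)) \<partial>lborel)"
    by (subst nn_integral_real_affine[where c=1 and t=c]) auto
  also have "\<dots> = (\<integral>\<^sup>+x. ennreal (exp (- c)) * (ennreal (exponential_density 1 x) * f (c + x)) \<partial>lborel)"
  proof (rule nn_integral_cong_AE)
    show "AE x in lborel. ennreal (exponential_density 1 (c + x)) * (indicator {c<..} (c + x) * f (c + x)) =
          ennreal (exp (- c)) * (ennreal (exponential_density 1 x) * f (c + x))"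
      using AE_lborel_singleton[of "0::real"]
    proof eventually_elim
      case (elim x)
      then show ?case using c
        by (cases "x < 0")
           (auto simp: exponential_density_def exp_add exp_diff exp_minus ennreal_mult[symmetric] field_simps mult.assoc[symmetric])
    qed
  qed
  also have "\<dots> = ennreal (exp (- c)) * (\<integral>\<^sup>+x. f (c + x) \<partial>expo)"
    by (subst nn_integral_cmult) (auto simp: nn_integral_expo)
  finally show ?thesis .
qed

text \<open>The form in which memorylessness is used: either the clock rings by \<open>c\<close>, or
  the factor \<open>exp (- c)\<close> is paid and a fresh clock is started.\<close>

lemma expo_split:
  assumes [measurable]: "f \<in> borel_measurable borel" and c: "0 \<le> c"
  shows "(\<integral>\<^sup>+x. f x \<partial>expo) = (\<integral>\<^sup>+x. indicator {..c} x * f x \<partial>expo) + ennreal (exp (- c)) * (\<integral>\<^sup>+x. f (c + x) \<partial>expo)"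
proof -
  have "(\<integral>\<^sup>+x. f x \<partial>expo) = (\<integral>\<^sup>+x. indicator {..c} x * f x + indicator {c<..} x * f x \<partial>expo)"
    by (intro nn_integral_cong) (auto split: split_indicator)
  also have "\<dots> = (\<integral>\<^sup>+x. indicator {..c} x * f x \<partial>expo) + (\<integral>\<^sup>+x. indicator {c<..} x * f x \<partial>expo)"
    by (rule nn_integral_add) auto
  finally show ?thesis by (simp add: expo_memoryless c)
qed

subsection \<open>Lists recorded along finitely many levels\<close>

definition blank :: "real list \<Rightarrow> nat list list" where
  "blank ls = map (\<lambda>_. []) ls"

definition app :: "nat list list \<Rightarrow> nat list list \<Rightarrow> nat list list" where
  "app = map2 (@)"

text \<open>The interval is half open, as in \<open>B \<le> y < D\<close>, so consecutive holding
  intervals share no level and a cut at any \<open>s\<close> loses none.\<close>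

definition piece :: "real list \<Rightarrow> real \<Rightarrow> real \<Rightarrow> nat \<Rightarrow> nat list list" where
  "piece ls h h' y = map (\<lambda>u. if h \<le> u \<and> u < h' then [y] else []) ls"

lemma length_blank [simp]: "length (blank ls) = length ls"
  and length_piece [simp]: "length (piece ls h h' y) = length ls"
  and length_app [simp]: "length (app a b) = min (length a) (length b)"
  by (simp_all add: blank_def piece_def app_def)

lemma app_Nil [simp]: "app [] b = []" "app a [] = []"
  and app_Cons [simp]: "app (x # a) (y # b) = (x @ y) # app a b"
  by (simp_all add: app_def)

lemma piece_Nil [simp]: "piece [] h h' y = []"
  and piece_Cons [simp]: "piece (u # ls) h h' y = (if h \<le> u \<and> u < h' then [y] else []) # piece ls h h' y"
  and blank_Nil [simp]: "blank [] = []"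
  and blank_Cons [simp]: "blank (u # ls) = [] # blank ls"
  by (simp_all add: piece_def blank_def)

lemma app_assoc: "app (app a b) c = app a (app b c)"
proof (induction a arbitrary: b c)
  case (Cons x a)
  show ?case by (cases b; cases c) (auto simp: Cons)
qed simp

lemma app_blank: "length w = length ls \<Longrightarrow> app (blank ls) w = w"
  by (induction ls w rule: list_induct2') auto

lemma app_blank_right: "length w = length ls \<Longrightarrow> app w (blank ls) = w"
  by (induction ls w rule: list_induct2') auto

lemma app_append: "length a = length c \<Longrightarrow> app (a @ b) (c @ d) = app a c @ app b d"
  by (induction a c rule: list_induct2) auto

lemma blank_append [simp]: "blank (hs @ ls) = blank hs @ blank ls"
  and piece_append [simp]: "piece (hs @ ls) h h' y = piece hs h h' y @ piece ls h h' y"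
  by (simp_all add: blank_def piece_def)

lemma piece_shift: "piece (map (\<lambda>u. u - s) ls) h h' y = piece ls (h + s) (h' + s) y"
  by (auto simp: piece_def)

lemma piece_blank: "(\<And>u. u \<in> set ls \<Longrightarrow> u < h \<or> h' \<le> u) \<Longrightarrow> piece ls h h' y = blank ls"
  unfolding piece_def blank_def by (intro map_cong) force+

lemma piece_split:
  "h \<le> s \<Longrightarrow> s \<le> h' \<Longrightarrow> piece ls h h' y = app (piece ls h s y) (piece ls s h' y)"
  by (induction ls) auto

lemma measurable_piece:
  assumes [measurable]: "f \<in> borel_measurable M" "g \<in> borel_measurable M"
  shows "(\<lambda>x. piece ls (f x) (g x) y) \<in> M \<rightarrow>\<^sub>M count_space UNIV"
proof (induction ls)
  case (Cons u ls)
  have *: "(\<lambda>x. if f x \<le> u \<and> u < g x then [y] else []) \<in> M \<rightarrow>\<^sub>M count_space UNIV"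
    by measurable
  show ?case
    unfolding piece_Cons
  proof (rule measurable_compose_countable[OF _ *])
    show "(\<lambda>x. i # piece ls (f x) (g x) y) \<in> M \<rightarrow>\<^sub>M count_space UNIV" for i
      by (rule measurable_compose[OF Cons]) simp
  qed
qed simp

subsection \<open>The exploration functionals\<close>

text \<open>\<open>J y\<close> is the jump law from a state \<open>y \<noteq> 0\<close>,
  \<open>\<rho> y\<close> its holding rate, \<open>P\<close> the law of the first state of a chain
  begun at a birth, and \<alpha> the birth rate.\<close>

locale exploration =
  fixes J :: "nat \<Rightarrow> nat pmf" and P :: "nat pmf" and \<rho> :: "nat \<Rightarrow> real" and \<alpha> :: real
  assumes rate_pos: "y \<noteq> 0 \<Longrightarrow> 0 < \<rho> y" and birth_nonneg: "0 \<le> \<alpha>"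
begin

text \<open>State \<open>0\<close> is the descending phase: the next birth is an exponential distance below \<open>h\<close>,
  unless the exploration ends first. State \<open>y > 0\<close> is an individual born or jumping to \<open>y\<close> at height \<open>h\<close>.
  If \<open>\<alpha> = 0\<close> the junk value \<open>x / \<alpha>\<close> is only used on a null set.\<close>

definition step :: "(nat \<Rightarrow> real \<Rightarrow> (nat list list \<Rightarrow> ennreal) \<Rightarrow> ennreal) \<Rightarrow> real list \<Rightarrow>
    nat \<Rightarrow> real \<Rightarrow> (nat list list \<Rightarrow> ennreal) \<Rightarrow> ennreal" where
  "step F ls y h \<phi> =
     (if y = 0
      then \<integral>\<^sup>+x. (if \<alpha> * h < x then \<phi> (blank ls) else \<integral>\<^sup>+z. F z (h - x / \<alpha>) \<phi> \<partial>P) \<partial>expo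
      else \<integral>\<^sup>+x. (\<integral>\<^sup>+z. F z (h + x / \<rho> y) (\<lambda>w. \<phi> (app (piece ls h (h + x / \<rho> y) y) w)) \<partial>J y) \<partial>expo)"

text \<open>The contribution of the explorations that end within \<open>N\<close> steps.\<close>

primrec expl :: "nat \<Rightarrow> real list \<Rightarrow> nat \<Rightarrow> real \<Rightarrow> (nat list list \<Rightarrow> ennreal) \<Rightarrow> ennreal" where
  "expl 0 = (\<lambda>ls y h \<phi>. 0)"
| "expl (Suc N) = (\<lambda>ls. step (expl N ls) ls)"

definition explore :: "real list \<Rightarrow> nat \<Rightarrow> real \<Rightarrow> (nat list list \<Rightarrow> ennreal) \<Rightarrow> ennreal" where
  "explore ls y h \<phi> = (SUP N. expl N ls y h \<phi>)"

text \<open>What the integrals in \<open>step\<close> demand of their integrand: weights for each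
  start, and measurability in the starting height.\<close>

definition regular :: "(nat \<Rightarrow> real \<Rightarrow> (nat list list \<Rightarrow> ennreal) \<Rightarrow> ennreal) \<Rightarrow> bool" where
  "regular F \<longleftrightarrow> (\<forall>y h. dfun (F y h)) \<and> (\<forall>y \<phi>. (\<lambda>h. F y h \<phi>) \<in> borel_measurable borel)"

lemma measurable_regular:
  assumes F: "regular F" and [measurable]: "f \<in> borel_measurable M"
  shows "(\<lambda>x. F z (f x) \<phi>) \<in> borel_measurable M"
  using F unfolding regular_def by (intro measurable_compose[of f M borel "\<lambda>h. F z h \<phi>"]) auto

lemma measurable_regular_app:
  assumes F: "regular F" and [measurable]: "f \<in> borel_measurable M" "c \<in> M \<rightarrow>\<^sub>M count_space UNIV"
  shows "(\<lambda>x. F z (f x) (\<lambda>w. \<phi> (app (c x) w))) \<in> borel_measurable M"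
  by (rule measurable_compose_countable[where f="\<lambda>c x. F z (f x) (\<lambda>w. \<phi> (app c w))" and g=c])
     (auto intro: measurable_regular[OF F])

lemma measurable_down:
  assumes F: "regular F" and [measurable]: "f \<in> borel_measurable M" "e \<in> borel_measurable M"
  shows "(\<lambda>x. if \<alpha> * f x < e x then c else \<integral>\<^sup>+z. F z (f x - e x / \<alpha>) \<phi> \<partial>P) \<in> borel_measurable M"
    "(\<lambda>x. \<integral>\<^sup>+z. F z (f x - e x / \<alpha>) \<phi> \<partial>P) \<in> borel_measurable M"
proof -
  show [measurable]: "(\<lambda>x. \<integral>\<^sup>+z. F z (f x - e x / \<alpha>) \<phi> \<partial>P) \<in> borel_measurable M"
    by (intro measurable_nn_integral_pmf measurable_regular[OF F]) auto
  show "(\<lambda>x. if \<alpha> * f x < e x then c else \<integral>\<^sup>+z. F z (f x - e x / \<alpha>) \<phi> \<partial>P) \<in> borel_measurable M"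
    by measurable
qed

lemma measurable_up:
  assumes F: "regular F" and [measurable]: "f \<in> borel_measurable M" "e \<in> borel_measurable M"
  shows "(\<lambda>x. \<integral>\<^sup>+z. F z (f x + e x / \<rho> y) (\<lambda>w. \<phi> (app (piece ls (f x) (f x + e x / \<rho> y) y) w)) \<partial>J y) \<in> borel_measurable M"
  by (intro measurable_nn_integral_pmf measurable_regular_app[OF F] measurable_piece) auto

lemma regular_step:
  assumes F: "regular F"
  shows "regular (step F ls)"
  unfolding regular_def
proof safe
  have dF: "dfun (F y h)" for y h using F by (auto simp: regular_def)
  fix y h
  have 1: "dfun (\<lambda>\<phi>. if \<alpha> * h < x then \<phi> (blank ls) else \<integral>\<^sup>+z. F z (h - x / \<alpha>) \<phi> \<partial>P)" for x
    by (cases "\<alpha> * h < x") (auto intro: dfun_point intro!: dfun_integral dF)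
  have 2: "dfun (\<lambda>\<phi>. \<integral>\<^sup>+z. F z (h + x / \<rho> y) (\<lambda>w. \<phi> (app (piece ls h (h + x / \<rho> y) y) w)) \<partial>J y)" for x
    by (rule dfun_integral, rule dfun_comp[OF dF]) auto
  show "dfun (step F ls y h)"
    unfolding step_def
    by (cases "y = 0"; simp; intro dfun_integral 1 2 measurable_down(1)[OF F] measurable_up[OF F]) auto
next
  fix y \<phi>
  have m1: "(\<lambda>(h, x). if \<alpha> * h < x then \<phi> (blank ls) else \<integral>\<^sup>+z. F z (h - x / \<alpha>) \<phi> \<partial>P)
      \<in> borel_measurable (borel \<Otimes>\<^sub>M expo)"
    unfolding case_prod_beta by (intro measurable_down[OF F]) auto
  have m2: "(\<lambda>(h, x). \<integral>\<^sup>+z. F z (h + x / \<rho> y) (\<lambda>w. \<phi> (app (piece ls h (h + x / \<rho> y) y) w)) \<partial>J y)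
      \<in> borel_measurable (borel \<Otimes>\<^sub>M expo)"
    unfolding case_prod_beta by (intro measurable_up[OF F]) auto
  show "(\<lambda>h. step F ls y h \<phi>) \<in> borel_measurable borel"
    unfolding step_def using expo.borel_measurable_nn_integral[OF m1] expo.borel_measurable_nn_integral[OF m2]
    by (cases "y = 0") auto
qed

lemma regular_expl: "regular (expl N ls)"
proof (induction N)
  case 0
  then show ?case by (auto simp: regular_def dfun_zero)
qed (simp add: regular_step)

lemma dfun_expl: "dfun (expl N ls y h)"
  using regular_expl by (auto simp: regular_def)

lemma step_mono:
  assumes "\<And>y h \<phi>. F y h \<phi> \<le> F' y h \<phi>"
  shows "step F ls y h \<phi> \<le> step F' ls y h \<phi>"
  unfolding step_def by (auto intro!: nn_integral_mono assms)

lemma expl_Suc_mono: "expl N ls y h \<phi> \<le> expl (Suc N) ls y h \<phi>"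
proof (induction N arbitrary: y h \<phi>)
  case (Suc N)
  show ?case unfolding expl.simps(2) by (rule step_mono) (use Suc in simp)
qed simp

lemma expl_mono: "N \<le> N' \<Longrightarrow> expl N ls y h \<phi> \<le> expl N' ls y h \<phi>"
  by (rule lift_Suc_mono_le[of "\<lambda>N. expl N ls y h \<phi>"]) (rule expl_Suc_mono)

lemma expl_le_explore: "expl N ls y h \<phi> \<le> explore ls y h \<phi>"
  unfolding explore_def by (rule SUP_upper) simp

text \<open>Only lists with one entry per level reach the test function. The length condition
  matters because \<open>app\<close> truncates to the shorter argument, so identities such as
  \<open>app_blank\<close> hold for matching lengths.\<close>

lemma expl_mono_arg:
  assumes "\<And>w. length w = length ls \<Longrightarrow> \<phi> w \<le> \<psi> w"
  shows "expl N ls y h \<phi> \<le> expl N ls y h \<psi>"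
  using assms
proof (induction N arbitrary: y h \<phi> \<psi>)
  case (Suc N)
  have "(\<integral>\<^sup>+z. expl N ls z h \<phi> \<partial>P) \<le> (\<integral>\<^sup>+z. expl N ls z h \<psi> \<partial>P)" for h
    by (intro nn_integral_mono Suc.IH Suc.prems)
  moreover have "expl N ls z h (\<lambda>w. \<phi> (app (piece ls h' h'' y) w)) \<le> expl N ls z h (\<lambda>w. \<psi> (app (piece ls h' h'' y) w))" for z h h' h''
    by (intro Suc.IH Suc.prems) simp
  moreover have "\<phi> (blank ls) \<le> \<psi> (blank ls)"
    by (intro Suc.prems) simp
  ultimately show ?case
    unfolding expl.simps(2) step_def by (auto intro!: nn_integral_mono)
qed simp

lemma expl_cong:
  assumes "\<And>w. length w = length ls \<Longrightarrow> \<phi> w = \<psi> w"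
  shows "expl N ls y h \<phi> = expl N ls y h \<psi>"
  by (intro antisym expl_mono_arg) (simp_all add: assms)

lemma explore_mono_arg:
  assumes "\<And>w. length w = length ls \<Longrightarrow> \<phi> w \<le> \<psi> w"
  shows "explore ls y h \<phi> \<le> explore ls y h \<psi>"
  unfolding explore_def by (intro SUP_mono') (rule expl_mono_arg[OF assms])

lemma explore_cong:
  assumes "\<And>w. length w = length ls \<Longrightarrow> \<phi> w = \<psi> w"
  shows "explore ls y h \<phi> = explore ls y h \<psi>"
  by (intro antisym explore_mono_arg) (simp_all add: assms)

lemma regular_explore: "regular (explore ls)"
  unfolding regular_def
proof (intro conjI allI)
  show "dfun (explore ls y h)" for y h
    unfolding explore_def[abs_def] by (intro dfun_SUP dfun_expl expl_Suc_mono)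
  show "(\<lambda>h. explore ls y h \<phi>) \<in> borel_measurable borel" for y \<phi>
    unfolding explore_def by (intro borel_measurable_SUP measurable_regular[OF regular_expl]) auto
qed

lemma dfun_explore: "dfun (explore ls y h)"
  using regular_explore by (auto simp: regular_def)

text \<open>Monotone convergence passes the supremum over the number of steps through both integrals
  of \<open>step\<close>.\<close>

lemma explore_step: "explore ls y h \<phi> = step (explore ls) ls y h \<phi>"
proof -
  have "explore ls y h \<phi> = (SUP N. expl (Suc N) ls y h \<phi>)"
    unfolding explore_def
  proof (rule antisym)
    show "(SUP N. expl N ls y h \<phi>) \<le> (SUP N. expl (Suc N) ls y h \<phi>)"
      by (intro SUP_mono' expl_Suc_mono)
    show "(SUP N. expl (Suc N) ls y h \<phi>) \<le> (SUP N. expl N ls y h \<phi>)"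
      by (rule SUP_least) (rule expl_le_explore[unfolded explore_def])
  qed
  also have "\<dots> = step (explore ls) ls y h \<phi>"
  proof (cases "y = 0")
    case True
    have *: "(\<integral>\<^sup>+z. (SUP N. expl N ls z h \<phi>) \<partial>P) = (SUP N. \<integral>\<^sup>+z. expl N ls z h \<phi> \<partial>P)" for h
      by (intro nn_integral_monotone_convergence_SUP)
         (auto intro!: incseq_SucI expl_Suc_mono simp: le_fun_def simp del: expl.simps)
    have "step (explore ls) ls y h \<phi> = (\<integral>\<^sup>+x. (SUP N. if \<alpha> * h < x then \<phi> (blank ls) else \<integral>\<^sup>+z. expl N ls z (h - x / \<alpha>) \<phi> \<partial>P) \<partial>expo)"
      using True unfolding step_def explore_def * by (auto intro!: nn_integral_cong)
    also have "\<dots> = (SUP N. \<integral>\<^sup>+x. (if \<alpha> * h < x then \<phi> (blank ls) else \<integral>\<^sup>+z. expl N ls z (h - x / \<alpha>) \<phi> \<partial>P) \<partial>expo)"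
      by (intro nn_integral_monotone_convergence_SUP measurable_down[OF regular_expl])
         (auto intro!: incseq_SucI nn_integral_mono expl_Suc_mono simp: le_fun_def simp del: expl.simps)
    finally show ?thesis using True by (simp add: step_def)
  next
    case False
    have *: "(\<integral>\<^sup>+z. (SUP N. expl N ls z h \<phi>) \<partial>J y) = (SUP N. \<integral>\<^sup>+z. expl N ls z h \<phi> \<partial>J y)" for h \<phi>
      by (intro nn_integral_monotone_convergence_SUP)
         (auto intro!: incseq_SucI expl_Suc_mono simp: le_fun_def simp del: expl.simps)
    have "step (explore ls) ls y h \<phi> = (\<integral>\<^sup>+x. (SUP N. \<integral>\<^sup>+z. expl N ls z (h + x / \<rho> y) (\<lambda>w. \<phi> (app (piece ls h (h + x / \<rho> y) y) w)) \<partial>J y) \<partial>expo)"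
      using False unfolding step_def explore_def * by (auto intro!: nn_integral_cong)
    also have "\<dots> = (SUP N. \<integral>\<^sup>+x. (\<integral>\<^sup>+z. expl N ls z (h + x / \<rho> y) (\<lambda>w. \<phi> (app (piece ls h (h + x / \<rho> y) y) w)) \<partial>J y) \<partial>expo)"
      by (intro nn_integral_monotone_convergence_SUP measurable_up[OF regular_expl])
         (auto intro!: incseq_SucI nn_integral_mono expl_Suc_mono simp: le_fun_def simp del: expl.simps)
    finally show ?thesis using False by (simp add: step_def)
  qed
  finally show ?thesis .
qed

lemma expl_const: "expl N ls y h (\<lambda>_. c) = expl N [] y h (\<lambda>_. c)"
proof (induction N arbitrary: y h)
  case (Suc N)
  show ?case unfolding expl.simps step_def Suc.IH by simp
qed simp

lemma explore_const: "explore ls y h (\<lambda>_. c) = explore [] y h (\<lambda>_. c)"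
  unfolding explore_def by (subst expl_const) simp

lemma expl_const_le: "expl N ls y h (\<lambda>_. c) \<le> c"
proof (induction N arbitrary: y h)
  case (Suc N)
  have p: "(\<integral>\<^sup>+z. expl N ls z h (\<lambda>_. c) \<partial>measure_pmf p) \<le> c" for h p
    using nn_integral_mono[of "measure_pmf p" "\<lambda>z. expl N ls z h (\<lambda>_. c)" "\<lambda>_. c"] Suc by simp
  have e: "(\<integral>\<^sup>+x. f x \<partial>expo) \<le> c" if "\<And>x. f x \<le> c" for f
    using nn_integral_mono[of expo f "\<lambda>_. c"] that expo.emeasure_space_1 by simp
  show ?case
    unfolding expl.simps(2) step_def using p by (auto intro!: e)
qed simp

text \<open>A gap is almost surely positive, so a descent from height \<open>0\<close> ends before
  any birth. This closes the descending recursions.\<close>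

lemma step_down_0: "step F ls 0 0 \<phi> = \<phi> (blank ls)"
proof -
  have "step F ls 0 0 \<phi> = (\<integral>\<^sup>+x. \<phi> (blank ls) \<partial>expo)"
    unfolding step_def simp_thms if_True
    by (rule nn_integral_cong_AE, use AE_expo_pos in eventually_elim) simp
  then show ?thesis using expo.emeasure_space_1 by simp
qed

text \<open>A gap variable of at most \<open>\<alpha> * (h - s)\<close> puts the next birth at
  height \<open>s\<close> or above; otherwise its remainder is again a unit exponential and the
  descent starts afresh from \<open>s\<close>.\<close>

lemma restart_down:
  assumes F: "regular F" and s: "0 \<le> s" "s \<le> h"
  shows "step F ls 0 h \<phi> =
    (\<integral>\<^sup>+x. indicator {..\<alpha> * (h - s)} x * (\<integral>\<^sup>+z. F z (h - x / \<alpha>) \<phi> \<partial>P) \<partial>expo) +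
    ennreal (exp (- (\<alpha> * (h - s)))) * step F ls 0 s \<phi>"
proof -
  let ?c = "\<alpha> * (h - s)"
  let ?f = "\<lambda>x. if \<alpha> * h < x then \<phi> (blank ls) else \<integral>\<^sup>+z. F z (h - x / \<alpha>) \<phi> \<partial>P"
  have [measurable]: "?f \<in> borel_measurable borel"
    by (intro measurable_down[OF F]) auto
  have c: "0 \<le> ?c" using s birth_nonneg by simp
  have c': "?c \<le> \<alpha> * h" using s birth_nonneg by (simp add: mult_left_mono)
  have "(\<integral>\<^sup>+x. indicator {..?c} x * ?f x \<partial>expo)
      = (\<integral>\<^sup>+x. indicator {..?c} x * (\<integral>\<^sup>+z. F z (h - x / \<alpha>) \<phi> \<partial>P) \<partial>expo)"
    using c' by (intro nn_integral_cong) (auto split: split_indicator)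
  moreover have "(\<integral>\<^sup>+x. ?f (?c + x) \<partial>expo) = step F ls 0 s \<phi>"
    unfolding step_def simp_thms if_True
  proof (rule nn_integral_cong_AE)
    show "AE x in expo. ?f (?c + x) = (if \<alpha> * s < x then \<phi> (blank ls) else \<integral>\<^sup>+z. F z (s - x / \<alpha>) \<phi> \<partial>P)"
      using AE_expo_pos
    proof eventually_elim
      case (elim x)
      show ?case
      \<comment> \<open>For \<alpha> = 0 both tests read \<open>0 < x\<close>, so the quotients are
        never reached.\<close>
      proof (cases "\<alpha> = 0")
        case False
        then have "h - (?c + x) / \<alpha> = s - x / \<alpha>" by (simp add: field_simps)
        moreover have "\<alpha> * h < ?c + x \<longleftrightarrow> \<alpha> * s < x" by (simp add: algebra_simps)
        ultimately show ?thesis by (simp only:)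
      qed (use elim in simp)
    qed
  qed
  ultimately show ?thesis
    using expo_split[of ?f ?c] c by (simp add: step_def)
qed

text \<open>The upward counterpart: a holding interval that passes \<open>s\<close> is cut there.
  Its part below \<open>s\<close> is already recorded on the left, and its part above
  \<open>s\<close> is a fresh holding time in the same state.\<close>

lemma restart_up:
  assumes F: "regular F" and y: "y \<noteq> 0" and s: "h \<le> s"
  shows "step F ls y h \<phi> =
    (\<integral>\<^sup>+x. indicator {..\<rho> y * (s - h)} x *
       (\<integral>\<^sup>+z. F z (h + x / \<rho> y) (\<lambda>w. \<phi> (app (piece ls h (h + x / \<rho> y) y) w)) \<partial>J y) \<partial>expo) +
    ennreal (exp (- (\<rho> y * (s - h)))) * step F ls y s (\<lambda>w. \<phi> (app (piece ls h s y) w))"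
proof -
  let ?c = "\<rho> y * (s - h)"
  let ?f = "\<lambda>x. \<integral>\<^sup>+z. F z (h + x / \<rho> y) (\<lambda>w. \<phi> (app (piece ls h (h + x / \<rho> y) y) w)) \<partial>J y"
  have [measurable]: "?f \<in> borel_measurable borel"
    by (intro measurable_up[OF F]) auto
  have r: "0 < \<rho> y" using rate_pos y by simp
  then have c: "0 \<le> ?c" using s by simp
  have "(\<integral>\<^sup>+x. ?f (?c + x) \<partial>expo) = step F ls y s (\<lambda>w. \<phi> (app (piece ls h s y) w))"
    unfolding step_def using y
  proof (simp, intro nn_integral_cong_AE)
    show "AE x in expo. ?f (?c + x) = (\<integral>\<^sup>+z. F z (s + x / \<rho> y)
       (\<lambda>w. \<phi> (app (piece ls h s y) (app (piece ls s (s + x / \<rho> y) y) w))) \<partial>J y)"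
      using AE_expo_pos
    proof eventually_elim
      case (elim x)
      have "h + (?c + x) / \<rho> y = s + x / \<rho> y" using r by (simp add: field_simps)
      moreover have "piece ls h (s + x / \<rho> y) y = app (piece ls h s y) (piece ls s (s + x / \<rho> y) y)"
        using s r elim by (intro piece_split) auto
      ultimately show ?case by (simp add: app_assoc)
    qed
  qed
  then show ?thesis
    using expo_split[of ?f ?c] c y by (simp add: step_def)
qed

subsection \<open>First passage below a level\<close>

text \<open>The gap running when the exploration first descends to \<open>s\<close> has no memory, so what follows is a
  fresh descent from \<open>s\<close>, and no level in \<open>ls\<close> is met before.\<close>

lemma expl_upper:
  assumes s: "0 \<le> s" "s \<le> h" and ls: "\<And>u. u \<in> set ls \<Longrightarrow> u \<le> s"
    and lsh: "\<And>u. y \<noteq> 0 \<Longrightarrow> u \<in> set ls \<Longrightarrow> u < h"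
  shows "expl N ls y h \<phi> \<le> expl N [] y (h - s) (\<lambda>_. expl N ls 0 s \<phi>)"
  using assms(2,4)
proof (induction N arbitrary: y h \<phi>)
  case (Suc N)
  \<comment> \<open>The step whose gap crosses \<open>s\<close> is also the first step of the
    descent from \<open>s\<close>. The budget of that descent must therefore not drop, and the
    \<open>N\<close> of the induction hypothesis is enlarged to \<open>Suc N\<close>.\<close>
  let ?m = "expl N ls 0 s \<phi>" and ?m' = "expl (Suc N) ls 0 s \<phi>"
  have IH: "expl N ls z h' \<psi> \<le> expl N [] z (h' - s) (\<lambda>_. ?m')"
    if "s \<le> h'" "\<And>u. u \<in> set ls \<Longrightarrow> u < h'" "expl N ls 0 s \<psi> = expl N ls 0 s \<phi>" for z h' \<psi>
  proof -
    have "expl N ls z h' \<psi> \<le> expl N [] z (h' - s) (\<lambda>_. expl N ls 0 s \<psi>)"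
      using that by (intro Suc.IH) auto
    also have "\<dots> \<le> expl N [] z (h' - s) (\<lambda>_. ?m')"
      using that(3) expl_Suc_mono[of N ls 0 s \<phi>] by (intro expl_mono_arg) (simp del: expl.simps)
    finally show ?thesis .
  qed
  show ?case
  proof (cases "y = 0")
    case False
    then have r: "0 < \<rho> y" by (rule rate_pos)
    have "expl (Suc N) ls y h \<phi> =
        (\<integral>\<^sup>+x. (\<integral>\<^sup>+z. expl N ls z (h + x / \<rho> y) (\<lambda>w. \<phi> (app (piece ls h (h + x / \<rho> y) y) w)) \<partial>J y) \<partial>expo)"
      using False by (simp add: step_def)
    also have "\<dots> \<le> (\<integral>\<^sup>+x. (\<integral>\<^sup>+z. expl N [] z (h - s + x / \<rho> y) (\<lambda>_. ?m') \<partial>J y) \<partial>expo)"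
    proof (intro nn_integral_mono_AE)
      show "AE x in expo. (\<integral>\<^sup>+z. expl N ls z (h + x / \<rho> y) (\<lambda>w. \<phi> (app (piece ls h (h + x / \<rho> y) y) w)) \<partial>J y)
          \<le> (\<integral>\<^sup>+z. expl N [] z (h - s + x / \<rho> y) (\<lambda>_. ?m') \<partial>J y)"
        using AE_expo_pos
      proof eventually_elim
        case (elim x)
        then have e: "0 < x / \<rho> y" using r by simp
        have b: "piece ls h (h + x / \<rho> y) y = blank ls"
          using Suc.prems(2)[OF False] by (intro piece_blank) auto
        have "expl N ls 0 s (\<lambda>w. \<phi> (app (piece ls h (h + x / \<rho> y) y) w)) = ?m"
          unfolding b by (intro expl_cong) (simp add: app_blank)
        then have "expl N ls z (h + x / \<rho> y) (\<lambda>w. \<phi> (app (piece ls h (h + x / \<rho> y) y) w)) \<le>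
            expl N [] z (h + x / \<rho> y - s) (\<lambda>_. ?m')" for z
          using e Suc.prems(1) Suc.prems(2)[OF False] by (intro IH) force+
        then show ?case
          by (intro nn_integral_mono) (simp add: algebra_simps del: expl.simps)
      qed
    qed
    also have "\<dots> = expl (Suc N) [] y (h - s) (\<lambda>_. ?m')"
      using False by (simp add: step_def)
    finally show ?thesis .
  next
    case True
    have "expl (Suc N) ls y h \<phi> =
       (\<integral>\<^sup>+x. indicator {..\<alpha> * (h - s)} x * (\<integral>\<^sup>+z. expl N ls z (h - x / \<alpha>) \<phi> \<partial>P) \<partial>expo) +
       ennreal (exp (- (\<alpha> * (h - s)))) * ?m'"
      unfolding True expl.simps(2) by (rule restart_down[OF regular_expl s(1) Suc.prems(1)])
    also have "\<dots> \<le> (\<integral>\<^sup>+x. indicator {..\<alpha> * (h - s)} x * (\<integral>\<^sup>+z. expl N [] z (h - s - x / \<alpha>) (\<lambda>_. ?m') \<partial>P) \<partial>expo) +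
       ennreal (exp (- (\<alpha> * (h - s)))) * ?m'"
    proof (intro add_right_mono nn_integral_mono_AE)
      \<comment> \<open>A birth exactly at \<open>s\<close> is a null event. It has to be excluded
        because a level may equal \<open>s\<close>, while a birth must start strictly above every
        level.\<close>
      show "AE x in expo. indicator {..\<alpha> * (h - s)} x * (\<integral>\<^sup>+z. expl N ls z (h - x / \<alpha>) \<phi> \<partial>P) \<le>
          indicator {..\<alpha> * (h - s)} x * (\<integral>\<^sup>+z. expl N [] z (h - s - x / \<alpha>) (\<lambda>_. ?m') \<partial>P)"
        using AE_expo_pos AE_expo_neq[of "\<alpha> * (h - s)"]
      proof eventually_elim
        case (elim x)
        show ?case
        proof (cases "x \<le> \<alpha> * (h - s)")
          case xl: True
          then have "\<alpha> \<noteq> 0" using elim by auto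
          then have "0 < \<alpha>" using birth_nonneg by simp
          then have *: "s < h - x / \<alpha>" using xl elim by (simp add: field_simps)
          have "expl N ls z (h - x / \<alpha>) \<phi> \<le> expl N [] z (h - x / \<alpha> - s) (\<lambda>_. ?m')" for z
            using * ls by (intro IH) force+
          then show ?thesis
            by (intro mult_left_mono nn_integral_mono) (simp_all add: algebra_simps del: expl.simps)
        qed simp
      qed
    qed
    \<comment> \<open>The right-hand side is cut at height \<open>0\<close>, where
      \<open>step_down_0\<close> evaluates the remaining descent as the constant.\<close>
    also have "\<dots> = step (expl N []) [] 0 (h - s) (\<lambda>_. ?m')"
      using restart_down[OF regular_expl, of 0 "h - s" N "[]" "[]" "\<lambda>_. ?m'"] Suc.prems(1) 
      by (simp only: step_down_0 diff_zero order_refl diff_ge_0_iff_ge)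
    also have "\<dots> = expl (Suc N) [] y (h - s) (\<lambda>_. ?m')"
      using True by simp
    finally show ?thesis .
  qed
qed simp

text \<open>Forgetting the part above \<open>s\<close> costs only its mass, which is at most
  one.\<close>

lemma expl_upper':
  assumes s: "0 \<le> s" "s \<le> h" and ls: "\<And>u. u \<in> set ls \<Longrightarrow> u \<le> s"
    and lsh: "\<And>u. y \<noteq> 0 \<Longrightarrow> u \<in> set ls \<Longrightarrow> u < h"
  shows "expl N ls y h \<phi> \<le> expl N ls 0 s \<phi>"
  using expl_upper[OF assms] expl_const_le order_trans by blast

text \<open>The reverse of \<open>expl_upper\<close>, which also records further levels
  \<open>hs\<close>, seen from \<open>s\<close>. The budgets are separate because \<open>N\<close>
  steps before the first passage and \<open>K\<close> after it fit into \<open>N + K\<close>; the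
  two suprema are taken in \<open>explore_lower\<close>. At the passage the levels in
  \<open>ls\<close> are still blank, and all levels stay open for the descent from
  \<open>s\<close>.\<close>

lemma expl_lower:
  assumes s: "0 \<le> s" "s \<le> h" and ls: "\<And>u. u \<in> set ls \<Longrightarrow> u \<le> s"
    and lsh: "\<And>u. y \<noteq> 0 \<Longrightarrow> u \<in> set ls \<Longrightarrow> u < h"
  shows "expl N (map (\<lambda>u. u - s) hs) y (h - s) (\<lambda>w. expl K (hs @ ls) 0 s (\<lambda>w'. \<phi> (app (w @ blank ls) w')))
    \<le> expl (N + K) (hs @ ls) y h \<phi>"
  using assms(2,4)
proof (induction N arbitrary: y h \<phi>)
  case (Suc N)
  let ?hs = "map (\<lambda>u. u - s) hs"
  let ?T = "\<lambda>\<phi> w. expl K (hs @ ls) 0 s (\<lambda>w'. \<phi> (app (w @ blank ls) w'))"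
  have IH: "expl N ?hs z (h' - s) (?T \<psi>) \<le> expl (N + K) (hs @ ls) z h' \<psi>"
    if "s \<le> h'" "\<And>u. u \<in> set ls \<Longrightarrow> u < h'" for z h' \<psi>
    using that by (intro Suc.IH) auto
  show ?case
  proof (cases "y = 0")
    case False
    then have r: "0 < \<rho> y" by (rule rate_pos)
    have "expl (Suc N) ?hs y (h - s) (?T \<phi>) =
        (\<integral>\<^sup>+x. (\<integral>\<^sup>+z. expl N ?hs z (h - s + x / \<rho> y) (\<lambda>w. ?T \<phi> (app (piece ?hs (h - s) (h - s + x / \<rho> y) y) w)) \<partial>J y) \<partial>expo)"
      using False by (simp add: step_def)
    also have "\<dots> \<le> (\<integral>\<^sup>+x. (\<integral>\<^sup>+z. expl (N + K) (hs @ ls) z (h + x / \<rho> y) (\<lambda>w. \<phi> (app (piece (hs @ ls) h (h + x / \<rho> y) y) w)) \<partial>J y) \<partial>expo)"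
    proof (intro nn_integral_mono_AE)
      show "AE x in expo. (\<integral>\<^sup>+z. expl N ?hs z (h - s + x / \<rho> y) (\<lambda>w. ?T \<phi> (app (piece ?hs (h - s) (h - s + x / \<rho> y) y) w)) \<partial>J y)
          \<le> (\<integral>\<^sup>+z. expl (N + K) (hs @ ls) z (h + x / \<rho> y) (\<lambda>w. \<phi> (app (piece (hs @ ls) h (h + x / \<rho> y) y) w)) \<partial>J y)"
        using AE_expo_pos
      proof eventually_elim
        case (elim x)
        then have e: "0 < x / \<rho> y" using r by simp
        let ?h = "h + x / \<rho> y"
        let ?\<psi> = "\<lambda>w. \<phi> (app (piece (hs @ ls) h ?h y) w)"
        have b: "piece ls h ?h y = blank ls"
          using Suc.prems(2)[OF False] by (intro piece_blank) auto
        have p: "piece ?hs (h - s) (h - s + x / \<rho> y) y = piece hs h ?h y"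
          by (simp add: piece_shift)
        have eq: "expl N ?hs z (?h - s) (\<lambda>w. ?T \<phi> (app (piece hs h ?h y) w)) = expl N ?hs z (?h - s) (?T ?\<psi>)" for z
        proof (rule expl_cong)
          fix w :: "nat list list" assume w: "length w = length ?hs"
          show "?T \<phi> (app (piece hs h ?h y) w) = ?T ?\<psi> w"
          proof (rule expl_cong)
            fix w' :: "nat list list" assume "length w' = length (hs @ ls)"
            have "app (app (piece hs h ?h y) w @ blank ls) w' = app (piece (hs @ ls) h ?h y) (app (w @ blank ls) w')"
              using w by (simp add: app_assoc[symmetric] app_append b app_blank)
            then show "\<phi> (app (app (piece hs h ?h y) w @ blank ls) w') = ?\<psi> (app (w @ blank ls) w')"
              by simp
          qed
        qed
        have "expl N ?hs z (?h - s) (?T ?\<psi>) \<le> expl (N + K) (hs @ ls) z ?h ?\<psi>" for z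
          using e Suc.prems(1) Suc.prems(2)[OF False] by (intro IH) force+
        then have "expl N ?hs z (?h - s) (\<lambda>w. ?T \<phi> (app (piece hs h ?h y) w)) \<le> expl (N + K) (hs @ ls) z ?h ?\<psi>" for z
          unfolding eq .
        moreover have "h - s + x / \<rho> y = ?h - s" by simp
        ultimately show ?case
          unfolding p by (intro nn_integral_mono) (simp only:)
      qed
    qed
    also have "\<dots> = expl (Suc N + K) (hs @ ls) y h \<phi>"
      using False by (simp add: step_def)
    finally show ?thesis .
  next
    case True
    let ?c = "\<alpha> * (h - s)"
    have "expl (Suc N) ?hs y (h - s) (?T \<phi>) =
       (\<integral>\<^sup>+x. indicator {..?c} x * (\<integral>\<^sup>+z. expl N ?hs z (h - s - x / \<alpha>) (?T \<phi>) \<partial>P) \<partial>expo) +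
       ennreal (exp (- ?c)) * ?T \<phi> (blank ?hs)"
      using restart_down[OF regular_expl, of 0 "h - s" N ?hs ?hs "?T \<phi>"] Suc.prems(1) True
      by (simp only: step_down_0 diff_zero order_refl diff_ge_0_iff_ge expl.simps)
    also have "?T \<phi> (blank ?hs) = expl K (hs @ ls) 0 s \<phi>"
    proof (intro expl_cong arg_cong[where f=\<phi>])
      fix w :: "nat list list" assume w: "length w = length (hs @ ls)"
      have "blank ?hs @ blank ls = blank (hs @ ls)" by (simp add: blank_def comp_def)
      then show "app (blank ?hs @ blank ls) w = w" using app_blank[OF w] by (simp only:)
    qed
    also have "(\<integral>\<^sup>+x. indicator {..?c} x * (\<integral>\<^sup>+z. expl N ?hs z (h - s - x / \<alpha>) (?T \<phi>) \<partial>P) \<partial>expo) +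
       ennreal (exp (- ?c)) * expl K (hs @ ls) 0 s \<phi>
      \<le> (\<integral>\<^sup>+x. indicator {..?c} x * (\<integral>\<^sup>+z. expl (N + K) (hs @ ls) z (h - x / \<alpha>) \<phi> \<partial>P) \<partial>expo) +
       ennreal (exp (- ?c)) * expl (Suc (N + K)) (hs @ ls) 0 s \<phi>"
    proof (intro add_mono nn_integral_mono_AE mult_left_mono expl_mono)
      show "AE x in expo. indicator {..?c} x * (\<integral>\<^sup>+z. expl N ?hs z (h - s - x / \<alpha>) (?T \<phi>) \<partial>P) \<le>
          indicator {..?c} x * (\<integral>\<^sup>+z. expl (N + K) (hs @ ls) z (h - x / \<alpha>) \<phi> \<partial>P)"
        using AE_expo_pos AE_expo_neq[of ?c]
      proof eventually_elim
        case (elim x)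
        show ?case
        proof (cases "x \<le> ?c")
          case xl: True
          then have "\<alpha> \<noteq> 0" using elim by auto
          then have "0 < \<alpha>" using birth_nonneg by simp
          then have *: "s < h - x / \<alpha>" using xl elim by (simp add: field_simps)
          have "expl N ?hs z (h - x / \<alpha> - s) (?T \<phi>) \<le> expl (N + K) (hs @ ls) z (h - x / \<alpha>) \<phi>" for z
            using * ls by (intro IH) force+
          then show ?thesis
            by (intro mult_left_mono nn_integral_mono) (simp_all add: algebra_simps del: expl.simps)
        qed simp
      qed
    qed auto
    also have "\<dots> = expl (Suc N + K) (hs @ ls) y h \<phi>"
      using restart_down[OF regular_expl s(1) Suc.prems(1), of "N + K" "hs @ ls"] True by simp
    finally show ?thesis .
  qed
qed simp

lemma explore_lower:
  assumes s: "0 \<le> s" "s \<le> h" and ls: "\<And>u. u \<in> set ls \<Longrightarrow> u \<le> s"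
    and lsh: "\<And>u. y \<noteq> 0 \<Longrightarrow> u \<in> set ls \<Longrightarrow> u < h"
  shows "explore (map (\<lambda>u. u - s) hs) y (h - s) (\<lambda>w. explore (hs @ ls) 0 s (\<lambda>w'. \<phi> (app (w @ blank ls) w')))
    \<le> explore (hs @ ls) y h \<phi>"
proof -
  have "explore (map (\<lambda>u. u - s) hs) y (h - s) (\<lambda>w. explore (hs @ ls) 0 s (\<lambda>w'. \<phi> (app (w @ blank ls) w')))
    = (SUP N. SUP K. expl N (map (\<lambda>u. u - s) hs) y (h - s) (\<lambda>w. expl K (hs @ ls) 0 s (\<lambda>w'. \<phi> (app (w @ blank ls) w'))))"
    unfolding explore_def
    by (intro SUP_cong refl dfun_SUP_arg dfun_expl) (auto intro!: incseq_SucI le_funI expl_Suc_mono simp del: expl.simps)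
  also have "\<dots> \<le> explore (hs @ ls) y h \<phi>"
    by (intro SUP_least) (rule order_trans[OF expl_lower[OF assms] expl_le_explore])
  finally show ?thesis .
qed

subsection \<open>The branching property\<close>

text \<open>The law at level \<open>r\<close> of the concatenation of independent blocks started from the entries of the
  list: the transition kernel without immigration.\<close>

primrec branch :: "real \<Rightarrow> nat list \<Rightarrow> (nat list \<Rightarrow> ennreal) \<Rightarrow> ennreal" where
  "branch r [] = (\<lambda>\<psi>. \<psi> [])"
| "branch r (n # c) = (\<lambda>\<psi>. explore [r] n 0 (\<lambda>w. branch r c (\<lambda>b. \<psi> (hd w @ b))))"

lemma dfun_branch: "dfun (branch r c)"
proof (induction c)
  case (Cons n c)
  show ?case
    unfolding branch.simps(2)
    by (rule dfun_bind[OF dfun_explore], rule dfun_comp[OF Cons.IH])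
qed (simp add: dfun_point)

lemma branch_append: "branch r (c @ d) \<psi> = branch r c (\<lambda>b. branch r d (\<lambda>b'. \<psi> (b @ b')))"
  by (induction c arbitrary: \<psi>) auto

text \<open>Averages \<phi> over a list for a level higher by \<open>r\<close>, put in front of the
  record \<open>a\<close>, whose head is the list at the current level.\<close>

definition lift :: "real \<Rightarrow> (nat list list \<Rightarrow> ennreal) \<Rightarrow> nat list list \<Rightarrow> ennreal" where
  "lift r \<phi> a = branch r (hd a) (\<lambda>b. \<phi> (b # a))"

lemma lift_blank: "lift r \<phi> (blank (s # us)) = \<phi> (blank (t # s # us))"
  by (simp add: lift_def)

lemma lift_app:
  assumes "length w = Suc (length us)" "p = [] # q" 
  shows "lift r \<phi> (app p w) = lift r (\<lambda>v. \<phi> (app ([] # p) v)) w"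
  using assms by (cases w) (auto simp: lift_def)

text \<open>The case of an individual alive at \<open>s\<close> in state \<open>y\<close>. The
  remainder of its holding interval, together with what is explored before the return to
  \<open>s\<close>, is the block \<open>explore [t - s] y 0\<close> that \<open>branch\<close>
  assigns to the entry \<open>y\<close>; the descent from \<open>s\<close> that follows obeys the
  hypothesis \<open>IH\<close>.\<close>

lemma explore_branch_cross:
  assumes s: "0 \<le> s" "s \<le> t" and us: "\<And>u. u \<in> set us \<Longrightarrow> u \<le> s" and y: "y \<noteq> 0"
    and IH: "\<And>\<phi>. expl N (s # us) 0 s (lift (t - s) \<phi>) \<le> explore (t # s # us) 0 s \<phi>"
  shows "expl (Suc N) (s # us) y s (lift (t - s) \<phi>) \<le> explore (t # s # us) y s \<phi>"
proof -
  let ?r = "t - s" and ?L = "t # s # us"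
  \<comment> \<open>The levels do not exceed \<open>s\<close>, so every interval from
    \<open>s\<close> to \<open>s + e\<close> with \<open>e > 0\<close> leaves the same record; the
    length \<open>1\<close> is arbitrary.\<close>
  define c where "c = piece (s # us) s (s + 1) y"
  have c: "piece (s # us) s (s + e) y = c" if "0 < e" for e
    using us that unfolding c_def by (force simp: piece_def)
  have lc: "length c = Suc (length us)" by (simp add: c_def)
  have hc: "c = [y] # tl c" by (simp add: c_def)
  have r: "0 < \<rho> y" using y by (rule rate_pos)
  let ?X = "expl N (s # us) 0 s (\<lambda>w. lift ?r \<phi> (app c w))"
  define Y where "Y w = explore ?L 0 s (\<lambda>v. \<phi> (app (hd w # c) v))" for w
  have "expl (Suc N) (s # us) y s (lift ?r \<phi>) =
      (\<integral>\<^sup>+x. (\<integral>\<^sup>+z. expl N (s # us) z (s + x / \<rho> y) (\<lambda>w. lift ?r \<phi> (app (piece (s # us) s (s + x / \<rho> y) y) w)) \<partial>J y) \<partial>expo)"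
    using y by (simp add: step_def)
  \<comment> \<open>No level of \<open>s # us\<close> lies strictly above \<open>s\<close>, so on
    this side everything before the return to \<open>s\<close> is dropped at the cost of its
    mass.\<close>
  also have "\<dots> \<le> (\<integral>\<^sup>+x. (\<integral>\<^sup>+z. ?X \<partial>J y) \<partial>expo)"
  proof (intro nn_integral_mono_AE)
    show "AE x in expo. (\<integral>\<^sup>+z. expl N (s # us) z (s + x / \<rho> y) (\<lambda>w. lift ?r \<phi> (app (piece (s # us) s (s + x / \<rho> y) y) w)) \<partial>J y)
        \<le> (\<integral>\<^sup>+z. ?X \<partial>J y)"
      using AE_expo_pos
    proof eventually_elim
      case (elim x)
      then have e: "0 < x / \<rho> y" using r by simp
      show ?case
        unfolding c[OF e] using e us s(1) by (intro nn_integral_mono expl_upper') force+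
    qed
  qed
  also have "\<dots> = ?X"
    using expo.emeasure_space_1 by simp
  \<comment> \<open>The list at \<open>s\<close> now begins with \<open>y\<close>; unfolding
    \<open>branch\<close> on this entry produces the block started from \<open>y\<close>.\<close>
  also have "?X = expl N (s # us) 0 s (\<lambda>a. explore [?r] y 0 (\<lambda>w. lift ?r (\<lambda>v. \<phi> (app (hd w # c) v)) a))"
  proof (rule expl_cong)
    fix a :: "nat list list" assume a: "length a = length (s # us)"
    then obtain a1 a2 where a': "a = a1 # a2" by (cases a) auto
    have "app c a = (y # a1) # app (tl c) a2" unfolding a' by (subst hc) simp
    moreover have "app (hd w # c) (b # a) = (hd w @ b) # app c a" for w b by simp
    ultimately show "lift ?r \<phi> (app c a) = explore [?r] y 0 (\<lambda>w. lift ?r (\<lambda>v. \<phi> (app (hd w # c) v)) a)"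
      unfolding lift_def by (simp add: a')
  qed
  also have "\<dots> = explore [?r] y 0 (\<lambda>w. expl N (s # us) 0 s (lift ?r (\<lambda>v. \<phi> (app (hd w # c) v))))"
    by (rule dfun_swap[OF dfun_expl dfun_explore])
  also have "\<dots> \<le> explore [?r] y 0 Y"
    unfolding Y_def by (intro explore_mono_arg IH)
  also have "\<dots> = (\<integral>\<^sup>+x. (\<integral>\<^sup>+z. explore [?r] z (x / \<rho> y) (\<lambda>w. Y (app (piece [?r] 0 (x / \<rho> y) y) w)) \<partial>J y) \<partial>expo)"
    using y by (subst explore_step) (simp add: step_def)
  also have "\<dots> \<le> (\<integral>\<^sup>+x. (\<integral>\<^sup>+z. explore ?L z (s + x / \<rho> y) (\<lambda>w. \<phi> (app (piece ?L s (s + x / \<rho> y) y) w)) \<partial>J y) \<partial>expo)"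
  proof (intro nn_integral_mono_AE)
    show "AE x in expo. (\<integral>\<^sup>+z. explore [?r] z (x / \<rho> y) (\<lambda>w. Y (app (piece [?r] 0 (x / \<rho> y) y) w)) \<partial>J y)
       \<le> (\<integral>\<^sup>+z. explore ?L z (s + x / \<rho> y) (\<lambda>w. \<phi> (app (piece ?L s (s + x / \<rho> y) y) w)) \<partial>J y)"
      using AE_expo_pos
    proof eventually_elim
      case (elim x)
      then have e: "0 < x / \<rho> y" using r by simp
      let ?h = "s + x / \<rho> y"
      have "explore [?r] z (x / \<rho> y) (\<lambda>w. Y (app (piece [?r] 0 (x / \<rho> y) y) w)) =
          explore (map (\<lambda>u. u - s) [t]) z (?h - s)
           (\<lambda>w. explore ([t] @ s # us) 0 s (\<lambda>w'. \<phi> (app (piece ?L s ?h y) (app (w @ blank (s # us)) w'))))" for z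
        unfolding list.map add_diff_cancel_left'
      proof (rule explore_cong)
        fix w :: "nat list list" assume "length w = length [?r]"
        then obtain w1 where w: "w = [w1]" by (cases w) auto
        have "piece [?r] 0 (x / \<rho> y) y = piece [t] s ?h y" by auto
        moreover have "piece ?L s ?h y = piece [t] s ?h y @ c" using c[OF e] by simp
        ultimately have "app (piece ?L s ?h y) (app (w @ blank (s # us)) w') = app (hd (app (piece [?r] 0 (x / \<rho> y) y) w) # c) w'" for w'
          using lc unfolding app_assoc[symmetric]
          by (simp add: w app_append app_blank_right flip: blank_Cons)
        then show "Y (app (piece [?r] 0 (x / \<rho> y) y) w) =
          explore ([t] @ s # us) 0 s (\<lambda>w'. \<phi> (app (piece ?L s ?h y) (app (w @ blank (s # us)) w')))"
          unfolding Y_def by simp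
      qed
      also have "\<And>z. \<dots> z \<le> explore ([t] @ s # us) z ?h (\<lambda>w. \<phi> (app (piece ?L s ?h y) w))"
        using s us e by (intro explore_lower) force+
      finally show ?case
        by (intro nn_integral_mono) simp
    qed
  qed
  also have "\<dots> = explore ?L y s \<phi>"
    using y by (subst (2) explore_step) (simp add: step_def)
  finally show ?thesis .
qed

text \<open>Induction on the steps made at heights up to \<open>s\<close>. Descents, births and
  holding intervals ending by \<open>s\<close> leave the level \<open>t\<close> blank and are
  matched step by step; an interval that passes \<open>s\<close> is cut there and handed to
  \<open>explore_branch_cross\<close>.\<close>

lemma expl_branch:
  assumes s: "0 \<le> s" "s \<le> t" and us: "\<And>u. u \<in> set us \<Longrightarrow> u \<le> s" and h: "0 \<le> h" "h \<le> s"
  shows "expl N (s # us) y h (lift (t - s) \<phi>) \<le> explore (t # s # us) y h \<phi>"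
  using h
proof (induction N arbitrary: y h \<phi>)
  case (Suc N)
  let ?r = "t - s" and ?L = "t # s # us" and ?l = "s # us"
  show ?case
  proof (cases "y = 0")
    case True
    have "expl (Suc N) ?l y h (lift ?r \<phi>) = 
        (\<integral>\<^sup>+x. (if \<alpha> * h < x then \<phi> (blank ?L) else \<integral>\<^sup>+z. expl N ?l z (h - x / \<alpha>) (lift ?r \<phi>) \<partial>P) \<partial>expo)"
      unfolding True expl.simps(2) step_def lift_blank[of ?r \<phi> s us t] by simp
    also have "\<dots> \<le> (\<integral>\<^sup>+x. (if \<alpha> * h < x then \<phi> (blank ?L) else \<integral>\<^sup>+z. explore ?L z (h - x / \<alpha>) \<phi> \<partial>P) \<partial>expo)"
    proof (rule nn_integral_mono_AE, use AE_expo_pos in eventually_elim)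
      case (elim x)
      have "expl N ?l z (h - x / \<alpha>) (lift ?r \<phi>) \<le> explore ?L z (h - x / \<alpha>) \<phi>" if "\<not> \<alpha> * h < x" for z
      proof -
        have "0 < \<alpha>" using that elim birth_nonneg by (cases "\<alpha> = 0") auto
        then show ?thesis
          using that elim Suc.prems by (intro Suc.IH) (auto simp: field_simps add_increasing)
      qed
      then show ?case by (auto intro!: nn_integral_mono)
    qed
    also have "\<dots> = explore ?L y h \<phi>"
      using True by (subst (2) explore_step) (simp add: step_def)
    finally show ?thesis .
  next
    case False
    let ?c = "\<rho> y * (s - h)"
    have r: "0 < \<rho> y" using False by (rule rate_pos)
    \<comment> \<open>By half-openness an interval ending at \<open>h' \<le> s\<close> covers
      neither \<open>s\<close> nor \<open>t\<close>, so recording it commutes with drawing the new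
      entry.\<close>
    have l: "lift ?r \<phi> (app (piece ?l h h' y) w) = lift ?r (\<lambda>v. \<phi> (app (piece ?L h h' y) v)) w"
      if "h' \<le> s" "length w = length ?l" for h' w
      using that s lift_app[of w us "piece ?l h h' y" "piece us h h' y" ?r \<phi>] by simp
    have "expl (Suc N) ?l y h (lift ?r \<phi>) =
      (\<integral>\<^sup>+x. indicator {..?c} x * (\<integral>\<^sup>+z. expl N ?l z (h + x / \<rho> y) (\<lambda>w. lift ?r \<phi> (app (piece ?l h (h + x / \<rho> y) y) w)) \<partial>J y) \<partial>expo) +
      ennreal (exp (- ?c)) * expl (Suc N) ?l y s (\<lambda>w. lift ?r \<phi> (app (piece ?l h s y) w))"
      unfolding expl.simps(2) by (rule restart_up[OF regular_expl False Suc.prems(2)])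
    also have "expl (Suc N) ?l y s (\<lambda>w. lift ?r \<phi> (app (piece ?l h s y) w)) =
        expl (Suc N) ?l y s (lift ?r (\<lambda>v. \<phi> (app (piece ?L h s y) v)))"
      by (rule expl_cong) (rule l, auto)
    also have "(\<integral>\<^sup>+x. indicator {..?c} x * (\<integral>\<^sup>+z. expl N ?l z (h + x / \<rho> y) (\<lambda>w. lift ?r \<phi> (app (piece ?l h (h + x / \<rho> y) y) w)) \<partial>J y) \<partial>expo) +
        ennreal (exp (- ?c)) * \<dots>
      \<le> (\<integral>\<^sup>+x. indicator {..?c} x * (\<integral>\<^sup>+z. explore ?L z (h + x / \<rho> y) (\<lambda>w. \<phi> (app (piece ?L h (h + x / \<rho> y) y) w)) \<partial>J y) \<partial>expo) +
        ennreal (exp (- ?c)) * explore ?L y s (\<lambda>v. \<phi> (app (piece ?L h s y) v))"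
    proof (intro add_mono mult_left_mono explore_branch_cross[OF s us False] Suc.IH)
      show "(\<integral>\<^sup>+x. indicator {..?c} x * (\<integral>\<^sup>+z. expl N ?l z (h + x / \<rho> y) (\<lambda>w. lift ?r \<phi> (app (piece ?l h (h + x / \<rho> y) y) w)) \<partial>J y) \<partial>expo)
        \<le> (\<integral>\<^sup>+x. indicator {..?c} x * (\<integral>\<^sup>+z. explore ?L z (h + x / \<rho> y) (\<lambda>w. \<phi> (app (piece ?L h (h + x / \<rho> y) y) w)) \<partial>J y) \<partial>expo)"
      proof (rule nn_integral_mono_AE, use AE_expo_pos in eventually_elim)
        case (elim x)
        show ?case
        proof (cases "x \<le> ?c")
          case True
          then have h': "h + x / \<rho> y \<le> s" "0 \<le> h + x / \<rho> y" using r elim Suc.prems by (auto simp: field_simps)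
          have "expl N ?l z (h + x / \<rho> y) (\<lambda>w. lift ?r \<phi> (app (piece ?l h (h + x / \<rho> y) y) w)) =
            expl N ?l z (h + x / \<rho> y) (lift ?r (\<lambda>v. \<phi> (app (piece ?L h (h + x / \<rho> y) y) v)))" for z
            by (rule expl_cong, rule l[OF h'(1)])
          then show ?thesis
            using h' by (auto intro!: mult_left_mono nn_integral_mono Suc.IH)
        qed simp
      qed
    qed (use s in auto)
    also have "\<dots> = step (explore ?L) ?L y h \<phi>"
      unfolding explore_step[of ?L y s] by (rule restart_up[OF regular_explore False Suc.prems(2), symmetric])
    also have "\<dots> = explore ?L y h \<phi>"
      by (rule explore_step[symmetric])
    finally show ?thesis .
  qed
qed simp

lemma explore_branch:
  assumes "0 \<le> s" "s \<le> t" and "\<And>u. u \<in> set us \<Longrightarrow> u \<le> s" and "0 \<le> h" "h \<le> s"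
  shows "explore (s # us) y h (lift (t - s) \<phi>) \<le> explore (t # s # us) y h \<phi>"
  unfolding explore_def[of "s # us"] by (intro SUP_least expl_branch assms)

end

subsection \<open>Recurrence\<close>

lemma nn_integral_count_space_list:
  fixes F :: "'a::countable list \<Rightarrow> ennreal"
  shows "(\<integral>\<^sup>+zs. F zs \<partial>count_space UNIV) =
    F [] + (\<integral>\<^sup>+z. (\<integral>\<^sup>+zs. F (z # zs) \<partial>count_space UNIV) \<partial>count_space UNIV)"
proof -
  have bij: "bij_betw (\<lambda>(z, zs). z # zs) UNIV {zs :: 'a list. zs \<noteq> []}"
  proof (rule bij_betw_imageI)
    show "(\<lambda>(z, zs). z # zs) ` UNIV = {zs :: 'a list. zs \<noteq> []}"
      by (auto simp: image_iff neq_Nil_conv)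
  qed (auto simp: inj_on_def)
  have "(\<integral>\<^sup>+zs. F zs \<partial>count_space UNIV) =
      (\<integral>\<^sup>+zs. F zs * indicator {[]} zs + F zs * indicator {zs. zs \<noteq> []} zs \<partial>count_space UNIV)"
    by (intro nn_integral_cong) (auto split: split_indicator)
  also have "\<dots> = (\<integral>\<^sup>+zs. F zs * indicator {[]} zs \<partial>count_space UNIV) +
      (\<integral>\<^sup>+zs. F zs * indicator {zs. zs \<noteq> []} zs \<partial>count_space UNIV)"
    by (rule nn_integral_add) auto
  also have "(\<integral>\<^sup>+zs. F zs * indicator {[]} zs \<partial>count_space UNIV) = F []"
    by (subst nn_integral_count_space'[where A = "{[]}"]) auto
  also have "(\<integral>\<^sup>+zs. F zs * indicator {zs. zs \<noteq> []} zs \<partial>count_space UNIV) =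
      (\<integral>\<^sup>+zs. F zs \<partial>count_space {zs. zs \<noteq> []})"
    by (simp add: nn_integral_count_space_indicator)
  also have "\<dots> = (\<integral>\<^sup>+p. F (case p of (z, zs) \<Rightarrow> z # zs) \<partial>count_space UNIV)"
    by (rule nn_integral_bij_count_space[OF bij, symmetric])
  also have "\<dots> = (\<integral>\<^sup>+z. (\<integral>\<^sup>+zs. F (z # zs) \<partial>count_space UNIV) \<partial>count_space UNIV)"
    by (subst nn_integral_fst_count_space[symmetric]) simp
  finally show ?thesis .
qed

lemma expo_laplace:
  assumes "0 \<le> b"
  shows "(\<integral>\<^sup>+x. ennreal (exp (- (b * x))) \<partial>expo) = ennreal (1 / (1 + b))"
proof -
  have "(\<integral>\<^sup>+x. ennreal (exp (- (b * x))) \<partial>expo) =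
      (\<integral>\<^sup>+x. ennreal (exponential_density 1 x) * ennreal (exp (- (b * x))) \<partial>lborel)"
    by (rule nn_integral_expo) auto
  also have "\<dots> = (\<integral>\<^sup>+x. ennreal (1 / (1 + b)) * ennreal (exponential_density (1 + b) x) \<partial>lborel)"
  proof (intro nn_integral_cong)
    fix x :: real
    have "exp (- x) * exp (- (b * x)) = exp (- x * (1 + b))"
      by (simp add: exp_add[symmetric] algebra_simps)
    then have "exponential_density 1 x * exp (- (b * x)) = 1 / (1 + b) * exponential_density (1 + b) x"
      using assms by (simp add: exponential_density_def)
    then show "ennreal (exponential_density 1 x) * ennreal (exp (- (b * x))) =
        ennreal (1 / (1 + b)) * ennreal (exponential_density (1 + b) x)"
      using assms by (simp add: ennreal_mult[symmetric] exponential_density_nonneg)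
  qed
  also have "\<dots> = ennreal (1 / (1 + b)) * (\<integral>\<^sup>+x. ennreal (exponential_density (1 + b) x) \<partial>lborel)"
    by (rule nn_integral_cmult) auto
  also have "(\<integral>\<^sup>+x. ennreal (exponential_density (1 + b) x) \<partial>lborel) = 1"
    using prob_space.emeasure_space_1[OF prob_space_exponential_density[of "1 + b"]] assms
    by (simp add: emeasure_density)
  finally show ?thesis by simp
qed

text \<open>Against the density of \<open>expo\<close> the integrand becomes
  \<open>c * exp (- (c * x))\<close>. The identity makes \<open>exp (- \<lambda> h)\<close> a
  solution of the renewal equation below.\<close>

lemma expo_truncated:
  assumes c: "0 \<le> c" and t: "0 \<le> t"
  shows "(\<integral>\<^sup>+x. indicator {..t} x * ennreal (c * exp ((1 - c) * x)) \<partial>expo) = ennreal (1 - exp (- (c * t)))"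
proof -
  have "(\<integral>\<^sup>+x. indicator {..t} x * ennreal (c * exp ((1 - c) * x)) \<partial>expo) =
      (\<integral>\<^sup>+x. ennreal (exponential_density 1 x) * (indicator {..t} x * ennreal (c * exp ((1 - c) * x))) \<partial>lborel)"
    by (rule nn_integral_expo) auto
  also have "\<dots> = (\<integral>\<^sup>+x. ennreal (c * exp (- (c * x))) * indicator {0..t} x \<partial>lborel)"
    using c by (intro nn_integral_cong)
      (auto simp: exponential_density_def ennreal_mult[symmetric] exp_add[symmetric] algebra_simps split: split_indicator)
  also have "\<dots> = ennreal (- exp (- (c * t)) - (- exp (- (c * 0))))"
    using c t by (intro nn_integral_FTC_Icc) (auto intro!: derivative_eq_intros)
  finally show ?thesis by simp
qed

context exploration
begin

section \<open>Return probabilities and their renewal equation\<close>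

lemma explore_le_1: "explore ls y h (\<lambda>_. 1) \<le> 1"
  unfolding explore_def by (intro SUP_least expl_const_le)

text \<open>First passage at \<open>s = h\<close>: the excursion above \<open>h\<close> ends, and
  then \<open>h\<close> is descended independently. With no levels to record,
  \<open>expl_upper\<close> and \<open>explore_lower\<close> give the two inequalities.\<close>

lemma explore_mult:
  assumes "0 \<le> h"
  shows "explore [] y h (\<lambda>_. 1) = explore [] y 0 (\<lambda>_. 1) * explore [] 0 h (\<lambda>_. 1)"
proof (rule antisym)
  have "expl N [] y h (\<lambda>_. 1) \<le> explore [] y 0 (\<lambda>_. 1) * explore [] 0 h (\<lambda>_. 1)" for N
  proof -
    have "expl N [] y h (\<lambda>_. 1) \<le> expl N [] y (h - h) (\<lambda>_. expl N [] 0 h (\<lambda>_. 1))"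
      using assms by (intro expl_upper) auto
    also have "\<dots> = expl N [] 0 h (\<lambda>_. 1) * expl N [] y 0 (\<lambda>_. 1)"
      by (simp add: dfun_const[OF dfun_expl, of _ _ _ _ "expl N [] 0 h (\<lambda>_. 1)"])
    also have "\<dots> \<le> explore [] y 0 (\<lambda>_. 1) * explore [] 0 h (\<lambda>_. 1)"
      by (subst mult.commute) (intro mult_mono expl_le_explore, auto)
    finally show ?thesis .
  qed
  then show "explore [] y h (\<lambda>_. 1) \<le> explore [] y 0 (\<lambda>_. 1) * explore [] 0 h (\<lambda>_. 1)"
    unfolding explore_def[of _ y h] by (intro SUP_least)
  have "explore [] y 0 (\<lambda>w. explore [] 0 h (\<lambda>_. 1)) \<le> explore [] y h (\<lambda>_. 1)"
    using explore_lower[of h h "[]" y "[]" "\<lambda>_. 1"] assms by simp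
  then show "explore [] y 0 (\<lambda>_. 1) * explore [] 0 h (\<lambda>_. 1) \<le> explore [] y h (\<lambda>_. 1)"
    by (simp add: dfun_const[OF dfun_explore, of _ _ _ "explore [] 0 h (\<lambda>_. 1)"] mult.commute)
qed

lemma explore_down_0: "explore ls 0 0 \<phi> = \<phi> (blank ls)"
  by (subst explore_step) (rule step_down_0)

text \<open>The probability that the excursion started by a birth ends.\<close>

definition offspring :: real where
  "offspring = enn2real (\<integral>\<^sup>+z. explore [] z 0 (\<lambda>_. 1) \<partial>P)"

lemma offspring: "0 \<le> offspring" "offspring \<le> 1"
  "(\<integral>\<^sup>+z. explore [] z 0 (\<lambda>_. 1) \<partial>P) = ennreal offspring"
proof -
  have le: "(\<integral>\<^sup>+z. explore [] z 0 (\<lambda>_. 1) \<partial>P) \<le> 1"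
    using nn_integral_mono[of "measure_pmf P" "\<lambda>z. explore [] z 0 (\<lambda>_. 1)" "\<lambda>_. 1"] explore_le_1 by simp
  show "0 \<le> offspring" "offspring \<le> 1"
    unfolding offspring_def using le by (auto intro: enn2real_leI)
  show "(\<integral>\<^sup>+z. explore [] z 0 (\<lambda>_. 1) \<partial>P) = ennreal offspring"
    unfolding offspring_def using le by (metis ennreal_enn2real ennreal_one_less_top le_less_trans)
qed

text \<open>Conditioning on the first gap: either \<open>0\<close> is reached without a birth, or a
  birth at \<open>h - x / \<alpha>\<close> opens an excursion that ends with probability
  \<open>offspring\<close>, after which the descent starts afresh.\<close>

lemma explore_down_renewal:
  assumes h: "0 \<le> h"
  shows "explore [] 0 h (\<lambda>_. 1) = ennreal (exp (- (\<alpha> * h))) +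
    (\<integral>\<^sup>+x. indicator {..\<alpha> * h} x * (ennreal offspring * explore [] 0 (h - x / \<alpha>) (\<lambda>_. 1)) \<partial>expo)"
proof -
  have "explore [] 0 h (\<lambda>_. 1) =
    (\<integral>\<^sup>+x. indicator {..\<alpha> * h} x * (\<integral>\<^sup>+z. explore [] z (h - x / \<alpha>) (\<lambda>_. 1) \<partial>P) \<partial>expo) + ennreal (exp (- (\<alpha> * h)))"
    using restart_down[OF regular_explore, of 0 h "[]" "[]" "\<lambda>_. 1"] h
    by (subst explore_step) (simp add: step_down_0)
  also have "(\<integral>\<^sup>+x. indicator {..\<alpha> * h} x * (\<integral>\<^sup>+z. explore [] z (h - x / \<alpha>) (\<lambda>_. 1) \<partial>P) \<partial>expo) =
    (\<integral>\<^sup>+x. indicator {..\<alpha> * h} x * (ennreal offspring * explore [] 0 (h - x / \<alpha>) (\<lambda>_. 1)) \<partial>expo)"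
  proof (rule nn_integral_cong_AE, use AE_expo_pos in eventually_elim)
    case (elim x)
    have "(\<integral>\<^sup>+z. explore [] z (h - x / \<alpha>) (\<lambda>_. 1) \<partial>P) = ennreal offspring * explore [] 0 (h - x / \<alpha>) (\<lambda>_. 1)"
      if "x \<le> \<alpha> * h"
    proof -
      have "0 < \<alpha>" using that elim birth_nonneg by (cases "\<alpha> = 0") auto
      then have "0 \<le> h - x / \<alpha>" using that by (simp add: field_simps)
      then show ?thesis
        unfolding offspring(3)[symmetric] by (subst explore_mult) (simp_all add: nn_integral_multc)
    qed
    then show ?case by (auto split: split_indicator)
  qed
  finally show ?thesis by (simp add: add.commute)
qed

text \<open>The left-hand side solves the same renewal equation. The two solutions are compared by
  iterating the equation, since a deficit can only be inherited through a further birth.\<close>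

lemma explore_down_ge:
  assumes h: "0 \<le> h"
  shows "ennreal (exp (- (\<alpha> * (1 - offspring) * h))) \<le> explore [] 0 h (\<lambda>_. 1)"
proof -
  let ?c = offspring and ?f = "\<lambda>h. explore [] 0 h (\<lambda>_. 1)"
  \<comment> \<open>The probability of a birth during a descent from \<open>h\<close>. It bounds the
    one for all smaller heights, so \<open>n\<close> iterations leave an error of at most
    \<open>k ^ n\<close>.\<close>
  define k where "k = 1 - exp (- (\<alpha> * h))"
  define g where "g h = exp (- (\<alpha> * (1 - offspring) * h))" for h
  have k: "0 \<le> k" "k < 1" using h birth_nonneg by (auto simp: k_def)
  have gn: "0 \<le> g h" for h by (simp add: g_def)
  have [measurable]: "?f \<in> borel_measurable borel"
    by (rule measurable_regular[OF regular_explore]) simp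
  have geq: "ennreal (g h') = ennreal (exp (- (\<alpha> * h'))) +
     (\<integral>\<^sup>+x. indicator {..\<alpha> * h'} x * (ennreal ?c * ennreal (g (h' - x / \<alpha>))) \<partial>expo)" if h': "0 \<le> h'" for h'
  proof -
    have "(\<integral>\<^sup>+x. indicator {..\<alpha> * h'} x * (ennreal ?c * ennreal (g (h' - x / \<alpha>))) \<partial>expo) =
      (\<integral>\<^sup>+x. ennreal (g h') * (indicator {..\<alpha> * h'} x * ennreal (?c * exp ((1 - ?c) * x))) \<partial>expo)"
    proof (rule nn_integral_cong_AE, use AE_expo_pos in eventually_elim)
      case (elim x)
      have "?c * g (h' - x / \<alpha>) = g h' * (?c * exp ((1 - ?c) * x))" if "x \<le> \<alpha> * h'"
      proof -
        have "\<alpha> \<noteq> 0" using that elim by auto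
        then have "- (\<alpha> * (1 - ?c) * (h' - x / \<alpha>)) = - (\<alpha> * (1 - ?c) * h') + (1 - ?c) * x"
          by (simp add: field_simps)
        then have "g (h' - x / \<alpha>) = g h' * exp ((1 - ?c) * x)"
          unfolding g_def by (simp only: exp_add)
        then show ?thesis by simp
      qed
      then show ?case
        using offspring gn by (auto simp: ennreal_mult[symmetric] split: split_indicator)
    qed
    also have "\<dots> = ennreal (g h') * ennreal (1 - exp (- (?c * (\<alpha> * h'))))"
      using offspring birth_nonneg h' by (subst nn_integral_cmult) (auto simp: expo_truncated)
    also have "\<dots> = ennreal (g h' * (1 - exp (- (?c * (\<alpha> * h')))))"
      using offspring birth_nonneg h' gn by (simp add: ennreal_mult)
    also have "g h' * (1 - exp (- (?c * (\<alpha> * h')))) = g h' - exp (- (\<alpha> * h'))"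
      unfolding g_def right_diff_distrib by (simp add: exp_add[symmetric] algebra_simps)
    finally have I: "(\<integral>\<^sup>+x. indicator {..\<alpha> * h'} x * (ennreal ?c * ennreal (g (h' - x / \<alpha>))) \<partial>expo) =
      ennreal (g h' - exp (- (\<alpha> * h')))" .
    have "exp (- (\<alpha> * h')) \<le> g h'"
      unfolding g_def using offspring birth_nonneg h' by (simp add: mult_left_le mult_right_mono)
    then show ?thesis
      unfolding I by (subst ennreal_plus[symmetric]) auto
  qed
  have *: "ennreal (g h') \<le> ?f h' + ennreal (k ^ n)" if "0 \<le> h'" "h' \<le> h" for h' n
    using that
  proof (induction n arbitrary: h')
    case 0
    have "g h' \<le> 1" using 0 offspring birth_nonneg by (simp add: g_def)
    then have "ennreal (g h') \<le> 1" by simp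
    then show ?case by (simp add: add_increasing)
  next
    case (Suc n)
    have "ennreal (g h') \<le> ennreal (exp (- (\<alpha> * h'))) +
     (\<integral>\<^sup>+x. indicator {..\<alpha> * h'} x * (ennreal ?c * ?f (h' - x / \<alpha>)) + indicator {..\<alpha> * h'} x * ennreal (k ^ n) \<partial>expo)"
      unfolding geq[OF Suc.prems(1)]
    proof (intro add_left_mono nn_integral_mono_AE, use AE_expo_pos in eventually_elim)
      case (elim x)
      have "ennreal ?c * ennreal (g (h' - x / \<alpha>)) \<le> ennreal ?c * ?f (h' - x / \<alpha>) + ennreal (k ^ n)" if "x \<le> \<alpha> * h'"
      proof -
        have "0 < \<alpha>" using that elim birth_nonneg by (cases "\<alpha> = 0") auto
        then have "0 \<le> h' - x / \<alpha>" "h' - x / \<alpha> \<le> h" using that Suc.prems elim by (auto simp: field_simps add_increasing)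
        then have "ennreal ?c * ennreal (g (h' - x / \<alpha>)) \<le> ennreal ?c * (?f (h' - x / \<alpha>) + ennreal (k ^ n))"
          by (intro mult_left_mono Suc.IH) auto
        also have "\<dots> \<le> ennreal ?c * ?f (h' - x / \<alpha>) + 1 * ennreal (k ^ n)"
          unfolding distrib_left using offspring by (intro add_left_mono mult_right_mono) auto
        finally show ?thesis by simp
      qed
      then show ?case by (auto split: split_indicator)
    qed
    also have "\<dots> = ?f h' + (\<integral>\<^sup>+x. indicator {..\<alpha> * h'} x * ennreal (k ^ n) \<partial>expo)"
      by (subst nn_integral_add) (auto simp: explore_down_renewal[OF Suc.prems(1)] add.assoc)
    also have "(\<integral>\<^sup>+x. indicator {..\<alpha> * h'} x * ennreal (k ^ n) \<partial>expo) \<le> ennreal (k ^ Suc n)"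
    proof -
      have a: "0 \<le> \<alpha> * h'" "\<alpha> * h' \<le> \<alpha> * h" using Suc.prems birth_nonneg by (auto intro: mult_left_mono)
      have "1 = (\<integral>\<^sup>+x. indicator {..\<alpha> * h'} x \<partial>expo) + ennreal (exp (- (\<alpha> * h')))"
        using expo_split[of "\<lambda>_. 1" "\<alpha> * h'"] a expo.emeasure_space_1 by simp
      then have "(\<integral>\<^sup>+x. indicator {..\<alpha> * h'} x \<partial>expo) = 1 - ennreal (exp (- (\<alpha> * h')))"
        by (metis ennreal_add_diff_cancel_right ennreal_neq_top)
      also have "\<dots> = ennreal (1 - exp (- (\<alpha> * h')))"
        by (simp add: ennreal_minus flip: ennreal_1)
      also have "\<dots> \<le> ennreal k" unfolding k_def using a by (intro ennreal_leI) simp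
      finally have "(\<integral>\<^sup>+x. indicator {..\<alpha> * h'} x \<partial>expo) * ennreal (k ^ n) \<le> ennreal k * ennreal (k ^ n)"
        by (rule mult_right_mono) simp
      then show ?thesis using k by (simp add: nn_integral_multc ennreal_mult[symmetric])
    qed
    finally show ?case by (simp add: add_left_mono)
  qed
  have "(\<lambda>n. ?f h + ennreal (k ^ n)) \<longlonglongrightarrow> ?f h + ennreal 0"
    using k by (intro tendsto_add tendsto_const tendsto_ennrealI LIMSEQ_power_zero) auto
  then have "ennreal (g h) \<le> ?f h + ennreal 0"
    by (rule LIMSEQ_le_const) (use *[OF h order_refl] in auto)
  then show ?thesis by (simp add: g_def)
qed

section \<open>Path sums of the jump chain, discounted by the holding times\<close>

primrec pathw :: "nat \<Rightarrow> nat list \<Rightarrow> real" where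
  "pathw y [] = pmf (J y) 0"
| "pathw y (z # zs) = pmf (J y) z * pathw z zs"

lemma pathw_nonneg: "0 \<le> pathw y zs"
  by (induction zs arbitrary: y) auto

text \<open>The Laplace transform at \<open>l\<close> of the time spent along the states \<open>ys\<close>.\<close>

definition discount :: "real \<Rightarrow> nat list \<Rightarrow> real" where
  "discount l ys = (\<Prod>y\<leftarrow>ys. \<rho> y / (\<rho> y + l))"

text \<open>With \<open>x = l / \<rho> y\<close> a factor is \<open>1 / (1 + x)\<close>, which is at
  least \<open>1 - x\<close> and strictly larger once \<open>x > 0\<close>; the product is built up
  one state at a time.\<close>

lemma discount:
  assumes "0 \<le> l" "0 \<notin> set ys"
  shows "0 < discount l ys" "discount l ys \<le> 1" "1 - discount l ys \<le> (\<Sum>y\<leftarrow>ys. l / \<rho> y)"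
    "0 < l \<Longrightarrow> ys \<noteq> [] \<Longrightarrow> 1 - discount l ys < (\<Sum>y\<leftarrow>ys. l / \<rho> y)"
proof -
  have "0 < discount l ys \<and> discount l ys \<le> 1 \<and> 1 - discount l ys \<le> (\<Sum>y\<leftarrow>ys. l / \<rho> y) \<and>
    (0 < l \<longrightarrow> ys \<noteq> [] \<longrightarrow> 1 - discount l ys < (\<Sum>y\<leftarrow>ys. l / \<rho> y))"
    using assms(2)
  proof (induction ys)
    case (Cons y ys)
    define x q where "x = l / \<rho> y" and "q = discount l ys"
    have r: "0 < \<rho> y" using Cons.prems by (intro rate_pos) auto
    then have x: "0 \<le> x" "0 < l \<Longrightarrow> 0 < x" using assms(1) by (auto simp: x_def)
    have q: "0 < q" "q \<le> 1" "1 - q \<le> (\<Sum>y\<leftarrow>ys. l / \<rho> y)" using Cons by (auto simp: q_def)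
    have d: "discount l (y # ys) = q / (1 + x)"
      using r assms(1) by (simp add: discount_def q_def x_def field_simps)
    have m: "0 \<le> x * x" "q * x \<le> x" using x q by (auto simp: mult_left_le_one_le)
    have "q * x \<le> x + x * x" using m by linarith
    then have "q - x \<le> q / (1 + x)"
      using x q by (simp add: field_simps)
    moreover have "q - x < q / (1 + x)" if "0 < l"
    proof -
      have "0 < x * x" using x that by simp
      then have "q * x < x + x * x" using m by linarith
      then show ?thesis using x(1) q by (simp add: field_simps)
    qed
    moreover have "q / (1 + x) \<le> 1" using x q by (simp add: field_simps)
    ultimately show ?case
      unfolding d using q x by (auto simp: x_def[symmetric])
  qed (simp add: discount_def)
  then show "0 < discount l ys" "discount l ys \<le> 1" "1 - discount l ys \<le> (\<Sum>y\<leftarrow>ys. l / \<rho> y)"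
    "0 < l \<Longrightarrow> ys \<noteq> [] \<Longrightarrow> 1 - discount l ys < (\<Sum>y\<leftarrow>ys. l / \<rho> y)" by auto
qed

text \<open>For \<open>zs\<close> in \<open>nz\<close> and \<open>y \<noteq> 0\<close>,
  \<open>pathw y zs\<close> is the probability that the jump chain from \<open>y\<close> passes
  exactly through \<open>zs\<close> and is then absorbed. A list containing \<open>0\<close> would
  continue a chain already absorbed.\<close>

definition nz :: "nat list set" where "nz = {zs. 0 \<notin> set zs}"

text \<open>After a holding time \<open>x / \<rho> y\<close> the excursion from the next state must
  end and the height gained must be descended, the latter with probability at least
  \<open>exp (- \<lambda> x / \<rho> y)\<close>. Averaging over the exponential \<open>x\<close>
  gives the factor \<open>\<rho> y / (\<rho> y + \<lambda>)\<close>, and iterating along the chain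
  gives the discounted path sum.\<close>

lemma explore_up_ge:
  assumes y: "y \<noteq> 0"
  shows "(\<integral>\<^sup>+zs. indicator nz zs * ennreal (pathw y zs * discount (\<alpha> * (1 - offspring)) (y # zs)) \<partial>count_space UNIV)
    \<le> explore [] y 0 (\<lambda>_. 1)"
proof -
  define l where "l = \<alpha> * (1 - offspring)"
  let ?\<psi> = "\<lambda>y. explore [] y 0 (\<lambda>_. 1)"
  let ?g = "\<lambda>y. \<rho> y / (\<rho> y + l)"
  have l: "0 \<le> l" using offspring birth_nonneg by (simp add: l_def)
  have up: "ennreal (?g y) * (\<integral>\<^sup>+z. ?\<psi> z \<partial>J y) \<le> ?\<psi> y" if y: "y \<noteq> 0" for y
  proof -
    have r: "0 < \<rho> y" using y by (rule rate_pos)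
    have "ennreal (?g y) = (\<integral>\<^sup>+x. ennreal (exp (- (l / \<rho> y * x))) \<partial>expo)"
      using r l by (subst expo_laplace) (auto simp: field_simps)
    then have "ennreal (?g y) * (\<integral>\<^sup>+z. ?\<psi> z \<partial>J y) = (\<integral>\<^sup>+x. ennreal (exp (- (l / \<rho> y * x))) * (\<integral>\<^sup>+z. ?\<psi> z \<partial>J y) \<partial>expo)"
      by (simp add: nn_integral_multc)
    also have "\<dots> \<le> (\<integral>\<^sup>+x. (\<integral>\<^sup>+z. explore [] z (x / \<rho> y) (\<lambda>_. 1) \<partial>J y) \<partial>expo)"
    proof (rule nn_integral_mono_AE, use AE_expo_pos in eventually_elim)
      case (elim x)
      then have e: "0 \<le> x / \<rho> y" using r by simp
      have "ennreal (exp (- (l / \<rho> y * x))) \<le> explore [] 0 (x / \<rho> y) (\<lambda>_. 1)"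
        using explore_down_ge[OF e] by (simp add: l_def)
      then have "ennreal (exp (- (l / \<rho> y * x))) * (\<integral>\<^sup>+z. ?\<psi> z \<partial>J y) \<le> explore [] 0 (x / \<rho> y) (\<lambda>_. 1) * (\<integral>\<^sup>+z. ?\<psi> z \<partial>J y)"
        by (rule mult_right_mono) simp
      also have "\<dots> = (\<integral>\<^sup>+z. explore [] z (x / \<rho> y) (\<lambda>_. 1) \<partial>J y)"
        by (subst explore_mult[OF e]) (simp add: nn_integral_multc mult.commute)
      finally show ?case .
    qed
    also have "\<dots> = ?\<psi> y"
      using y by (subst (2) explore_step) (simp add: step_def)
    finally show ?thesis .
  qed
  let ?F = "\<lambda>y zs. indicator nz zs * ennreal (pathw y zs * discount l (y # zs))"
  \<comment> \<open>Truncation by path length makes the iteration an induction; the supremum over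
    \<open>n\<close> is taken at the end.\<close>
  have fin: "(\<integral>\<^sup>+zs. (if length zs < n then ?F y zs else 0) \<partial>count_space UNIV) \<le> ?\<psi> y" if "y \<noteq> 0" for n y
    using that
  proof (induction n arbitrary: y)
    case (Suc n)
    have r: "0 < \<rho> y" using Suc.prems by (rule rate_pos)
    then have g: "0 \<le> ?g y" using l by simp
    have "(\<integral>\<^sup>+zs. (if length zs < Suc n then ?F y zs else 0) \<partial>count_space UNIV) =
      ?F y [] + (\<integral>\<^sup>+z. (\<integral>\<^sup>+zs. (if length zs < n then ?F y (z # zs) else 0) \<partial>count_space UNIV) \<partial>count_space UNIV)"
      by (subst nn_integral_count_space_list) simp
    also have "\<dots> \<le> ennreal (?g y) * (ennreal (pmf (J y) 0) * ?\<psi> 0) + (\<integral>\<^sup>+z. ennreal (?g y) * (ennreal (pmf (J y) z) * (?\<psi> z * indicator (- {0}) z)) \<partial>count_space UNIV)"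
    proof (intro add_mono nn_integral_mono)
      show "?F y [] \<le> ennreal (?g y) * (ennreal (pmf (J y) 0) * ?\<psi> 0)"
        using g by (simp add: explore_down_0 discount_def nz_def ennreal_mult[symmetric] mult.commute)
      fix z
      have "(if length zs < n then ?F y (z # zs) else 0) = ennreal (?g y * pmf (J y) z) * indicator (- {0}) z * (if length zs < n then ?F z zs else 0)" for zs
      proof -
        have "indicator nz (z # zs) = (indicator (- {0}) z * indicator nz zs :: ennreal)"
          by (auto simp: nz_def split: split_indicator)
        moreover have "indicator nz zs * ennreal (pathw y (z # zs) * discount l (y # z # zs)) = ennreal (?g y * pmf (J y) z) * (indicator nz zs * ennreal (pathw z zs * discount l (z # zs)))" if "z \<noteq> 0"
        proof (cases "zs \<in> nz")
          case True
          then have "0 < discount l (z # zs)" using that l by (intro discount) (auto simp: nz_def)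
          moreover have "pathw y (z # zs) * discount l (y # z # zs) = (?g y * pmf (J y) z) * (pathw z zs * discount l (z # zs))"
            by (simp add: discount_def)
          moreover have "0 \<le> ?g y * pmf (J y) z" using g by (intro mult_nonneg_nonneg) auto
          ultimately show ?thesis
            using pathw_nonneg[of z zs] True
            by (simp only: indicator_simps mult_1, subst ennreal_mult[symmetric]) auto
        qed simp
        ultimately show ?thesis
          by (cases "z = 0") (auto simp: mult_ac)
      qed
      then have "(\<integral>\<^sup>+zs. (if length zs < n then ?F y (z # zs) else 0) \<partial>count_space UNIV) =
         ennreal (?g y * pmf (J y) z) * indicator (- {0}) z * (\<integral>\<^sup>+zs. (if length zs < n then ?F z zs else 0) \<partial>count_space UNIV)"
        by (simp add: nn_integral_cmult)
      also have "\<dots> \<le> ennreal (?g y * pmf (J y) z) * indicator (- {0}) z * ?\<psi> z"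
        using Suc.IH[of z] by (cases "z = 0") (auto intro!: mult_left_mono)
      also have "\<dots> = ennreal (?g y) * (ennreal (pmf (J y) z) * (?\<psi> z * indicator (- {0}) z))"
        unfolding ennreal_mult[OF g pmf_nonneg] by (simp only: mult_ac)
      finally show "(\<integral>\<^sup>+zs. (if length zs < n then ?F y (z # zs) else 0) \<partial>count_space UNIV) \<le> \<dots>" .
    qed
    also have "\<dots> = ennreal (?g y) * (ennreal (pmf (J y) 0) * ?\<psi> 0 + (\<integral>\<^sup>+z. ennreal (pmf (J y) z) * (?\<psi> z * indicator (- {0}) z) \<partial>count_space UNIV))"
      by (subst nn_integral_cmult) (auto simp: distrib_left)
    also have "ennreal (pmf (J y) 0) * ?\<psi> 0 = (\<integral>\<^sup>+z. ennreal (pmf (J y) z) * (?\<psi> z * indicator {0} z) \<partial>count_space UNIV)"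
      by (subst nn_integral_count_space'[where A = "{0}"]) auto
    also have "(\<integral>\<^sup>+z. ennreal (pmf (J y) z) * (?\<psi> z * indicator {0} z) \<partial>count_space UNIV) + (\<integral>\<^sup>+z. ennreal (pmf (J y) z) * (?\<psi> z * indicator (- {0}) z) \<partial>count_space UNIV)
      = (\<integral>\<^sup>+z. ennreal (pmf (J y) z) * ?\<psi> z \<partial>count_space UNIV)"
      by (subst nn_integral_add[symmetric]) (auto intro!: nn_integral_cong split: split_indicator)
    also have "\<dots> = (\<integral>\<^sup>+z. ?\<psi> z \<partial>J y)"
      by (simp add: nn_integral_measure_pmf)
    also have "ennreal (?g y) * (\<integral>\<^sup>+z. ?\<psi> z \<partial>J y) \<le> ?\<psi> y"
      by (rule up[OF Suc.prems])
    finally show ?case .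
  qed simp
  have "(\<integral>\<^sup>+zs. ?F y zs \<partial>count_space UNIV) = (\<integral>\<^sup>+zs. (SUP n. (if length zs < n then ?F y zs else 0)) \<partial>count_space UNIV)"
  proof (intro nn_integral_cong antisym)
    show "?F y zs \<le> (SUP n. (if length zs < n then ?F y zs else 0))" for zs
      by (rule SUP_upper2[of "Suc (length zs)"]) auto
    show "(SUP n. (if length zs < n then ?F y zs else 0)) \<le> ?F y zs" for zs
      by (rule SUP_least) auto
  qed
  also have "\<dots> = (SUP n. (\<integral>\<^sup>+zs. (if length zs < n then ?F y zs else 0) \<partial>count_space UNIV))"
    by (rule nn_integral_monotone_convergence_SUP) (auto simp: incseq_def le_fun_def)
  also have "\<dots> \<le> ?\<psi> y"
    by (intro SUP_least fin y)
  finally show ?thesis unfolding l_def .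
qed

lemma explore_mass:
  assumes hit: "\<And>y. y \<noteq> 0 \<Longrightarrow> (\<integral>\<^sup>+zs. indicator nz zs * ennreal (pathw y zs) \<partial>count_space UNIV) = 1"
    and P0: "pmf P 0 = 0"
    and mean: "ennreal \<alpha> * (\<integral>\<^sup>+z. (\<integral>\<^sup>+zs. indicator nz zs * ennreal (pathw z zs) *
        ennreal (\<Sum>y\<leftarrow>z # zs. 1 / \<rho> y) \<partial>count_space UNIV) \<partial>P) \<le> 1"
    and h: "0 \<le> h"
  shows "explore ls y h (\<lambda>_. 1) = 1"
proof -
  define l where "l = \<alpha> * (1 - offspring)"
  have l: "0 \<le> l" using offspring birth_nonneg by (simp add: l_def)
  let ?d = "\<lambda>z zs. discount l (z # zs)"
  let ?X = "\<lambda>z. \<integral>\<^sup>+zs. indicator nz zs * ennreal (pathw z zs) * ennreal (1 - ?d z zs) \<partial>count_space UNIV"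
  let ?Y = "\<lambda>z. \<integral>\<^sup>+zs. indicator nz zs * ennreal (pathw z zs) * ennreal (\<Sum>y\<leftarrow>z # zs. l / \<rho> y) \<partial>count_space UNIV"
  have supp: "AE z in P. z \<noteq> 0"
    unfolding AE_measure_pmf_iff using P0 by (metis set_pmf_iff)
  \<comment> \<open>The absorption probability one is split into its discounted part, which
    \<open>explore_up_ge\<close> controls, and the defect \<open>?X z\<close>.\<close>
  have one: "1 \<le> explore [] z 0 (\<lambda>_. 1) + ?X z" if z: "z \<noteq> 0" for z
  proof -
    have "1 = (\<integral>\<^sup>+zs. indicator nz zs * ennreal (pathw z zs * ?d z zs) + indicator nz zs * ennreal (pathw z zs) * ennreal (1 - ?d z zs) \<partial>count_space UNIV)"
      unfolding hit[OF z, symmetric]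
    proof (intro nn_integral_cong)
      fix zs
      have "ennreal (pathw z zs) = ennreal (pathw z zs * ?d z zs) + ennreal (pathw z zs) * ennreal (1 - ?d z zs)" if "zs \<in> nz"
      proof -
        have d: "0 < ?d z zs" "?d z zs \<le> 1" using that z l by (auto intro!: discount simp: nz_def)
        then have "ennreal (pathw z zs * ?d z zs) + ennreal (pathw z zs) * ennreal (1 - ?d z zs) = ennreal (pathw z zs * ?d z zs + pathw z zs * (1 - ?d z zs))"
          using pathw_nonneg[of z zs] by (simp add: ennreal_mult[symmetric] ennreal_plus[symmetric] del: ennreal_plus)
        then show ?thesis by (simp add: algebra_simps)
      qed
      then show "indicator nz zs * ennreal (pathw z zs) = indicator nz zs * ennreal (pathw z zs * ?d z zs) + indicator nz zs * ennreal (pathw z zs) * ennreal (1 - ?d z zs)"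
        by (auto split: split_indicator)
    qed
    also have "\<dots> = (\<integral>\<^sup>+zs. indicator nz zs * ennreal (pathw z zs * ?d z zs) \<partial>count_space UNIV) + ?X z"
      by (rule nn_integral_add) auto
    also have "\<dots> \<le> explore [] z 0 (\<lambda>_. 1) + ?X z"
      using explore_up_ge[OF z] by (intro add_right_mono) (simp add: l_def)
    finally show ?thesis .
  qed
  \<comment> \<open>The defect is finite, as required for a strict pointwise inequality to integrate
    to a strict one.\<close>
  have X1: "?X z \<le> 1" if z: "z \<noteq> 0" for z
    unfolding hit[OF z, symmetric]
  proof (intro nn_integral_mono)
    fix zs
    have "1 - ?d z zs \<le> 1" if "zs \<in> nz"
      using discount(1)[of l "z # zs"] that z l by (auto simp: nz_def)
    then show "indicator nz zs * ennreal (pathw z zs) * ennreal (1 - ?d z zs) \<le> indicator nz zs * ennreal (pathw z zs)"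
      using mult_left_mono[of "ennreal (1 - ?d z zs)" 1 "indicator nz zs * ennreal (pathw z zs)"]
      by (cases "zs \<in> nz") auto
  qed
  have l0: "l = 0"
  proof (rule ccontr)
    assume "l \<noteq> 0"
    then have lp: "0 < l" using l by simp
    then have ap: "0 < \<alpha>" using birth_nonneg by (cases "\<alpha> = 0") (auto simp: l_def)
    have XY: "?X z < ?Y z" if z: "z \<noteq> 0" for z
    proof (rule nn_integral_less)
      show "?X z \<noteq> \<infinity>" using X1[OF z] by (auto simp: top_unique)
      have less: "ennreal (1 - ?d z zs) < ennreal (\<Sum>y\<leftarrow>z # zs. l / \<rho> y)" if "zs \<in> nz" for zs
        using discount[of l "z # zs"] lp that z by (intro ennreal_lessI) (auto simp: nz_def intro: le_less_trans)
      show "AE zs in count_space UNIV. indicator nz zs * ennreal (pathw z zs) * ennreal (1 - ?d z zs) \<le> indicator nz zs * ennreal (pathw z zs) * ennreal (\<Sum>y\<leftarrow>z # zs. l / \<rho> y)"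
        by (rule AE_I2) (use less in \<open>force intro!: mult_left_mono split: split_indicator\<close>)
      show "\<not> (AE zs in count_space UNIV. indicator nz zs * ennreal (pathw z zs) * ennreal (\<Sum>y\<leftarrow>z # zs. l / \<rho> y) \<le> indicator nz zs * ennreal (pathw z zs) * ennreal (1 - ?d z zs))"
      proof
        assume A: "AE zs in count_space UNIV. indicator nz zs * ennreal (pathw z zs) * ennreal (\<Sum>y\<leftarrow>z # zs. l / \<rho> y) \<le> indicator nz zs * ennreal (pathw z zs) * ennreal (1 - ?d z zs)"
        have "indicator nz zs * ennreal (pathw z zs) = 0" for zs
        proof (rule ccontr)
          assume n: "indicator nz zs * ennreal (pathw z zs) \<noteq> 0"
          then have nz: "zs \<in> nz" "0 < pathw z zs" by (auto simp: ennreal_eq_0_iff not_le split: split_indicator_asm)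
          have "indicator nz zs * ennreal (pathw z zs) * ennreal (1 - ?d z zs) < indicator nz zs * ennreal (pathw z zs) * ennreal (\<Sum>y\<leftarrow>z # zs. l / \<rho> y)"
            using less[OF nz(1)] nz by (intro ennreal_mult_strict_left_mono) auto
          then show False using A by (simp add: AE_count_space not_le[symmetric])
        qed
        then have "(\<integral>\<^sup>+zs. indicator nz zs * ennreal (pathw z zs) \<partial>count_space UNIV) = 0"
          by (simp only: nn_integral_const mult_zero_left)
        then show False using hit[OF z] by simp
      qed
    qed auto
    have "(\<integral>\<^sup>+z. ?X z \<partial>P) < (\<integral>\<^sup>+z. ?Y z \<partial>P)"
    proof (rule nn_integral_less)
      have "(\<integral>\<^sup>+z. ?X z \<partial>P) \<le> (\<integral>\<^sup>+z. 1 \<partial>P)"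
        by (rule nn_integral_mono_AE) (use supp X1 in auto)
      then show "(\<integral>\<^sup>+z. ?X z \<partial>P) \<noteq> \<infinity>" by (auto simp: top_unique)
      show "AE z in P. ?X z \<le> ?Y z"
        using supp by eventually_elim (rule less_imp_le[OF XY])
      show "\<not> (AE z in P. ?Y z \<le> ?X z)"
      proof
        assume "AE z in P. ?Y z \<le> ?X z"
        with supp have "AE z in P. False"
        proof eventually_elim
          case (elim z)
          show ?case using leD[OF elim(2)] XY[OF elim(1)] by (rule notE)
        qed
        then show False by (simp add: AE_measure_pmf_iff set_pmf_not_empty)
      qed
    qed auto
    also have "(\<integral>\<^sup>+z. ?Y z \<partial>P) = ennreal l * (\<integral>\<^sup>+z. (\<integral>\<^sup>+zs. indicator nz zs * ennreal (pathw z zs) *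
        ennreal (\<Sum>y\<leftarrow>z # zs. 1 / \<rho> y) \<partial>count_space UNIV) \<partial>P)"
    proof -
      have "ennreal (\<Sum>y\<leftarrow>ys. l / \<rho> y) = ennreal l * ennreal (\<Sum>y\<leftarrow>ys. 1 / \<rho> y)" for ys
        using l by (subst ennreal_mult'[symmetric]) (simp_all add: sum_list_const_mult[symmetric] )
      then have "?Y z = (\<integral>\<^sup>+zs. ennreal l * (indicator nz zs * ennreal (pathw z zs) * ennreal (\<Sum>y\<leftarrow>z # zs. 1 / \<rho> y)) \<partial>count_space UNIV)" for z
        by (intro nn_integral_cong) (simp only: mult_ac)
      then show ?thesis by (simp add: nn_integral_cmult del: list.map sum_list.Cons)
    qed
    \<comment> \<open>Factoring \<open>l\<close> in this way exposes the quantity bounded by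
      \<open>mean\<close>, so that exactly \<open>1 - offspring\<close> remains.\<close>
    also have "\<dots> = ennreal (1 - offspring) * (ennreal \<alpha> * (\<integral>\<^sup>+z. (\<integral>\<^sup>+zs. indicator nz zs * ennreal (pathw z zs) *
        ennreal (\<Sum>y\<leftarrow>z # zs. 1 / \<rho> y) \<partial>count_space UNIV) \<partial>P))"
      using offspring birth_nonneg by (simp add: l_def ennreal_mult mult_ac del: list.map sum_list.Cons)
    also have "\<dots> \<le> ennreal (1 - offspring)"
      using mult_left_mono[OF mean, of "ennreal (1 - offspring)"] by simp
    finally have X: "(\<integral>\<^sup>+z. ?X z \<partial>P) < ennreal (1 - offspring)" .
    have "1 = (\<integral>\<^sup>+z. 1 \<partial>P)" by simp
    also have "\<dots> \<le> (\<integral>\<^sup>+z. explore [] z 0 (\<lambda>_. 1) + ?X z \<partial>P)"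
      by (rule nn_integral_mono_AE) (use supp one in auto)
    also have "\<dots> = ennreal offspring + (\<integral>\<^sup>+z. ?X z \<partial>P)"
      by (subst nn_integral_add) (auto simp: offspring(3))
    also have "\<dots> < ennreal offspring + ennreal (1 - offspring)"
      using X by (simp add: ennreal_add_left_cancel_less)
    also have "\<dots> = 1"
      using offspring by (subst ennreal_plus[symmetric]) auto
    finally show False by simp
  qed
  \<comment> \<open>With \<open>l = 0\<close> the lower bounds become one: descents end almost
    surely, and excursions end at least with the absorption probability of the chain.\<close>
  have f: "explore [] 0 h (\<lambda>_. 1) = 1"
    using explore_down_ge[OF h] l0 explore_le_1[of "[]" 0 h] by (intro antisym) (auto simp: l_def)
  have "explore [] y 0 (\<lambda>_. 1) = 1"
  proof (cases "y = 0")
    case False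
    have "discount 0 ys = 1" if "0 \<notin> set ys" for ys
      using discount(2,3)[of 0 ys] that by (auto simp: sum_list_0)
    then have "indicator nz zs * ennreal (pathw y zs * ?d y zs) = indicator nz zs * ennreal (pathw y zs)" for zs
      using False l0 by (auto simp: nz_def split: split_indicator)
    then have "1 \<le> explore [] y 0 (\<lambda>_. 1)"
      using explore_up_ge[OF False] hit[OF False] by (simp add: l_def)
    then show ?thesis using explore_le_1[of "[]" y 0] by (rule antisym[rotated])
  qed (simp add: explore_down_0)
  then show ?thesis
    unfolding explore_const[of ls] by (subst explore_mult[OF h]) (simp add: f)
qed

subsection \<open>Several blocks\<close>

text \<open>Immigrants start at random heights, so their levels are shifted by a random amount. The
  starting height is a second variable because it moves along the recursion.\<close>

lemma measurable_expl_shift: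
  "(\<lambda>p. expl N (map (\<lambda>u. u - fst p) ls) y (snd p) \<phi>) \<in> borel_measurable (borel \<Otimes>\<^sub>M borel)"
proof (induction N arbitrary: y \<phi>)
  case (Suc N)
  have IH: "(\<lambda>q. expl N (map (\<lambda>u. u - f q) ls) z (g q) \<psi>) \<in> borel_measurable M"
    if [measurable]: "f \<in> borel_measurable M" "g \<in> borel_measurable M" for f g z \<psi> and M :: "((real \<times> real) \<times> real) measure"
    using measurable_compose[OF _ Suc.IH, of "\<lambda>q. (f q, g q)" M z \<psi>] that by simp
  have b: "blank (map (\<lambda>u. u - x) ls) = blank ls" for x
    by (simp add: blank_def comp_def)
  have m1: "(\<lambda>(p, x). if \<alpha> * snd p < x then \<phi> (blank ls) else
      \<integral>\<^sup>+z. expl N (map (\<lambda>u. u - fst p) ls) z (snd p - x / \<alpha>) \<phi> \<partial>P)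
    \<in> borel_measurable ((borel \<Otimes>\<^sub>M borel) \<Otimes>\<^sub>M expo)"
  proof -
    have [measurable]: "(\<lambda>q. \<integral>\<^sup>+z. expl N (map (\<lambda>u. u - fst (fst q)) ls) z (snd (fst q) - snd q / \<alpha>) \<phi> \<partial>P)
      \<in> borel_measurable ((borel \<Otimes>\<^sub>M borel) \<Otimes>\<^sub>M expo)"
      by (intro measurable_nn_integral_pmf IH) auto
    show ?thesis unfolding case_prod_beta by measurable
  qed
  have m2: "(\<lambda>(p, x). \<integral>\<^sup>+z. expl N (map (\<lambda>u. u - fst p) ls) z (snd p + x / \<rho> y)
      (\<lambda>w. \<phi> (app (piece ls (snd p + fst p) (snd p + x / \<rho> y + fst p) y) w)) \<partial>J y)
    \<in> borel_measurable ((borel \<Otimes>\<^sub>M borel) \<Otimes>\<^sub>M expo)"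
    unfolding case_prod_beta
    by (intro measurable_nn_integral_pmf,
        rule measurable_compose_countable[where f="\<lambda>c q. expl N (map (\<lambda>u. u - fst (fst q)) ls) _ (snd (fst q) + snd q / \<rho> y) (\<lambda>w. \<phi> (app c w))"])
       (auto intro!: IH measurable_piece)
  show ?case
    unfolding expl.simps step_def b piece_shift
    using expo.borel_measurable_nn_integral[OF m1] expo.borel_measurable_nn_integral[OF m2]
    by (cases "y = 0") auto
qed simp

lemma measurable_explore_shift [measurable]:
  "(\<lambda>x. explore (map (\<lambda>u. u - x) ls) y 0 \<phi>) \<in> borel_measurable borel"
  unfolding explore_def
  by (intro borel_measurable_SUP measurable_compose[OF _ measurable_expl_shift, of "\<lambda>x. (x, 0)", simplified]) auto

text \<open>Negative levels are never met: \<open>explore_lower\<close> at \<open>s = 0\<close>. It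
  is applied to an immigrant above \<open>s\<close>, for which the levels up to \<open>s\<close>
  become negative after the shift.\<close>

lemma explore_low:
  assumes "0 \<le> h" and ls: "\<And>u. u \<in> set ls \<Longrightarrow> u < 0"
  shows "explore hs y h (\<lambda>w. \<phi> (w @ blank ls)) \<le> explore (hs @ ls) y h \<phi>"
proof -
  have "explore hs y h (\<lambda>w. \<phi> (w @ blank ls)) =
    explore (map (\<lambda>u. u - 0) hs) y (h - 0) (\<lambda>w. explore (hs @ ls) 0 0 (\<lambda>w'. \<phi> (app (w @ blank ls) w')))"
    by (simp, rule explore_cong) (simp add: explore_down_0 app_append app_blank app_blank_right)
  also have "\<dots> \<le> explore (hs @ ls) y h \<phi>"
    using assms ls by (intro explore_lower) (auto intro: less_imp_le less_le_trans)
  finally show ?thesis .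
qed

primrec blocks :: "real list \<Rightarrow> nat list \<Rightarrow> (nat list list \<Rightarrow> ennreal) \<Rightarrow> ennreal" where
  "blocks ls [] = (\<lambda>\<phi>. \<phi> (blank ls))"
| "blocks ls (n # ns) = (\<lambda>\<phi>. explore ls n 0 (\<lambda>w. blocks ls ns (\<lambda>w'. \<phi> (app w w'))))"

lemma dfun_blocks: "dfun (blocks ls ns)"
proof (induction ns)
  case (Cons n ns)
  show ?case
    unfolding blocks.simps by (rule dfun_bind[OF dfun_explore], rule dfun_comp[OF Cons.IH])
qed (simp add: dfun_point)

lemma blocks_mono_arg:
  assumes "\<And>w. length w = length ls \<Longrightarrow> \<phi> w \<le> \<psi> w"
  shows "blocks ls ns \<phi> \<le> blocks ls ns \<psi>"
  using assms
proof (induction ns arbitrary: \<phi> \<psi>)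
  case (Cons n ns)
  show ?case
    unfolding blocks.simps by (intro explore_mono_arg Cons.IH Cons.prems) simp
qed simp

text \<open>\<open>branch\<close> acts entry by entry, so for a concatenation the entries of the
  left part can be averaged first.\<close>

lemma lift_app_distrib:
  assumes "w \<noteq> []" "w' \<noteq> []"
  shows "lift r \<phi> (app w w') = branch r (hd w) (\<lambda>b. lift r (\<lambda>v. \<phi> (app (b # w) v)) w')"
  using assms by (cases w; cases w') (auto simp: lift_def branch_append)

text \<open>\<open>explore_branch\<close> for each block in turn. The entries of an explored block
  branch independently of the later blocks, so \<open>dfun_swap\<close> takes that average outside
  before the induction hypothesis is applied.\<close>

lemma blocks_branch:
  assumes s: "0 \<le> s" "s \<le> t" and us: "\<And>u. u \<in> set us \<Longrightarrow> u \<le> s"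
  shows "blocks (s # us) ns (lift (t - s) \<phi>) \<le> blocks (t # s # us) ns \<phi>"
proof (induction ns arbitrary: \<phi>)
  case (Cons n ns)
  let ?r = "t - s" and ?l = "s # us" and ?L = "t # s # us"
  have "blocks ?l (n # ns) (lift ?r \<phi>) \<le> explore ?l n 0 (lift ?r (\<lambda>v. blocks ?L ns (\<lambda>v'. \<phi> (app v v'))))"
    unfolding blocks.simps
  proof (intro explore_mono_arg)
    fix w :: "nat list list" assume w: "length w = length ?l"
    have "blocks ?l ns (\<lambda>w'. lift ?r \<phi> (app w w')) \<le> blocks ?l ns (\<lambda>w'. branch ?r (hd w) (\<lambda>b. lift ?r (\<lambda>v. \<phi> (app (b # w) v)) w'))"
      using w by (intro blocks_mono_arg eq_refl lift_app_distrib) auto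
    also have "\<dots> = branch ?r (hd w) (\<lambda>b. blocks ?l ns (lift ?r (\<lambda>v. \<phi> (app (b # w) v))))"
      by (rule dfun_swap[OF dfun_blocks dfun_branch])
    also have "\<dots> \<le> branch ?r (hd w) (\<lambda>b. blocks ?L ns (\<lambda>v. \<phi> (app (b # w) v)))"
      by (intro dfun_mono[OF dfun_branch] Cons.IH)
    finally show "blocks ?l ns (\<lambda>w'. lift ?r \<phi> (app w w')) \<le> lift ?r (\<lambda>v. blocks ?L ns (\<lambda>v'. \<phi> (app v v'))) w"
      by (simp only: lift_def)
  qed
  also have "\<dots> \<le> explore ?L n 0 (\<lambda>v. blocks ?L ns (\<lambda>v'. \<phi> (app v v')))"
    using s us by (intro explore_branch) auto
  finally show ?case by simp
qed (simp only: blocks.simps lift_blank[of _ _ _ _ t] order_refl)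

end

subsection \<open>Immigration\<close>

text \<open>\<open>mass\<close> is the conclusion of \<open>explore_mass\<close>: recurrence enters
  the rest of the argument in this form.\<close>

locale immigration = exploration +
  fixes \<theta> :: real and PM :: "nat pmf"
  assumes imm_nonneg: "0 \<le> \<theta>"
    and mass: "\<And>ls y h. 0 \<le> h \<Longrightarrow> explore ls y h (\<lambda>_. 1) = 1"
begin

definition block :: "real list \<Rightarrow> (nat list list \<Rightarrow> ennreal) \<Rightarrow> ennreal" where
  "block ls \<phi> = (\<integral>\<^sup>+n. explore ls n 0 \<phi> \<partial>PM)"

text \<open>Immigrants are generated in increasing order of their heights; later ones stand further to the left.
  No immigrant above \<open>T\<close> matters for levels up to \<open>T\<close>.\<close>

definition istep :: "(real \<Rightarrow> (nat list list \<Rightarrow> ennreal) \<Rightarrow> ennreal) \<Rightarrow> real \<Rightarrow> real list \<Rightarrow>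
    real \<Rightarrow> (nat list list \<Rightarrow> ennreal) \<Rightarrow> ennreal" where
  "istep F T ls h \<phi> = (\<integral>\<^sup>+x. (if \<theta> * (T - h) < x then \<phi> (blank ls)
     else F (h + x / \<theta>) (\<lambda>w. block (map (\<lambda>u. u - (h + x / \<theta>)) ls) (\<lambda>w'. \<phi> (app w w')))) \<partial>expo)"

primrec imm :: "nat \<Rightarrow> real \<Rightarrow> real list \<Rightarrow> real \<Rightarrow> (nat list list \<Rightarrow> ennreal) \<Rightarrow> ennreal" where
  "imm 0 = (\<lambda>T ls h \<phi>. 0)"
| "imm (Suc N) = (\<lambda>T ls. istep (imm N T ls) T ls)"

definition immigrate :: "real \<Rightarrow> real list \<Rightarrow> real \<Rightarrow> (nat list list \<Rightarrow> ennreal) \<Rightarrow> ennreal" where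
  "immigrate T ls h \<phi> = (SUP N. imm N T ls h \<phi>)"

lemma dfun_block: "dfun (block ls)"
  unfolding block_def[abs_def] by (intro dfun_integral dfun_explore) auto

lemma block_mono_arg:
  assumes "\<And>w. length w = length ls \<Longrightarrow> \<phi> w \<le> \<psi> w"
  shows "block ls \<phi> \<le> block ls \<psi>"
  unfolding block_def by (intro nn_integral_mono explore_mono_arg assms)

lemma block_mass: "block ls (\<lambda>_. 1) = 1"
  by (simp add: block_def mass)

lemma measurable_block_shift [measurable]:
  "(\<lambda>x. block (map (\<lambda>u. u - x) ls) \<phi>) \<in> borel_measurable borel"
  unfolding block_def by (intro measurable_nn_integral_pmf measurable_explore_shift)

definition iregular :: "(real \<Rightarrow> (nat list list \<Rightarrow> ennreal) \<Rightarrow> ennreal) \<Rightarrow> bool" where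
  "iregular F \<longleftrightarrow> (\<forall>h. dfun (F h)) \<and> (\<forall>\<phi>. (\<lambda>h. F h \<phi>) \<in> borel_measurable borel)"

lemma measurable_iregular:
  assumes F: "iregular F" and [measurable]: "f \<in> borel_measurable M"
  shows "(\<lambda>x. F (f x) (\<lambda>w. block (map (\<lambda>u. u - f x) ls) (\<lambda>w'. \<phi> (app w w')))) \<in> borel_measurable M"
proof (rule measurable_dfun[where F="\<lambda>x. F (f x)"])
  show "dfun (F (f x))" for x using F by (auto simp: iregular_def)
  show "(\<lambda>x. F (f x) (indicator {a})) \<in> borel_measurable M" for a
    using F by (intro measurable_compose[of f M borel "\<lambda>h. F h (indicator {a})"]) (auto simp: iregular_def)
  show "(\<lambda>x. block (map (\<lambda>u. u - f x) ls) (\<lambda>w'. \<phi> (app a w'))) \<in> borel_measurable M" for a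
    by (rule measurable_compose[OF _ measurable_block_shift]) simp
qed

lemma measurable_istep:
  assumes F: "iregular F" and [measurable]: "f \<in> borel_measurable M" "e \<in> borel_measurable M"
  shows "(\<lambda>x. if \<theta> * (T - f x) < e x then c else
    F (f x + e x / \<theta>) (\<lambda>w. block (map (\<lambda>u. u - (f x + e x / \<theta>)) ls) (\<lambda>w'. \<phi> (app w w')))) \<in> borel_measurable M"
  by (rule measurable_If) (auto intro!: measurable_iregular[OF F])

lemma iregular_istep:
  assumes F: "iregular F"
  shows "iregular (istep F T ls)"
  unfolding iregular_def
proof safe
  have dF: "dfun (F h)" for h using F by (auto simp: iregular_def)
  fix h
  have "dfun (\<lambda>\<phi>. if \<theta> * (T - h) < x then \<phi> (blank ls)
     else F (h + x / \<theta>) (\<lambda>w. block (map (\<lambda>u. u - (h + x / \<theta>)) ls) (\<lambda>w'. \<phi> (app w w'))))" for x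
  proof (cases "\<theta> * (T - h) < x")
    case False
    then show ?thesis
      by (simp only: if_False) (rule dfun_bind[OF dF], rule dfun_comp[OF dfun_block])
  qed (simp add: dfun_point)
  then show "dfun (istep F T ls h)"
    unfolding istep_def[abs_def]
    by (rule dfun_integral) (intro measurable_istep[OF F], auto)
next
  fix \<phi>
  have "(\<lambda>(h, x). if \<theta> * (T - h) < x then \<phi> (blank ls)
     else F (h + x / \<theta>) (\<lambda>w. block (map (\<lambda>u. u - (h + x / \<theta>)) ls) (\<lambda>w'. \<phi> (app w w'))))
    \<in> borel_measurable (borel \<Otimes>\<^sub>M expo)"
    unfolding case_prod_beta by (intro measurable_istep[OF F]) auto
  then show "(\<lambda>h. istep F T ls h \<phi>) \<in> borel_measurable borel"
    unfolding istep_def by (rule expo.borel_measurable_nn_integral)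
qed

lemma iregular_imm: "iregular (imm N T ls)"
proof (induction N)
  case 0
  then show ?case by (auto simp: iregular_def dfun_zero)
qed (simp add: iregular_istep)

lemma dfun_imm: "dfun (imm N T ls h)"
  using iregular_imm by (auto simp: iregular_def)

lemma imm_Suc_mono: "imm N T ls h \<phi> \<le> imm (Suc N) T ls h \<phi>"
proof (induction N arbitrary: h \<phi>)
  case (Suc N)
  have "istep (imm N T ls) T ls h \<phi> \<le> istep (imm (Suc N) T ls) T ls h \<phi>"
    unfolding istep_def using Suc by (intro nn_integral_mono) (auto simp del: imm.simps)
  then show ?case by simp
qed simp

lemma imm_le_immigrate: "imm N T ls h \<phi> \<le> immigrate T ls h \<phi>"
  unfolding immigrate_def by (rule SUP_upper) simp

lemma iregular_immigrate: "iregular (immigrate T ls)"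
  unfolding iregular_def
proof (intro conjI allI)
  show "dfun (immigrate T ls h)" for h
    unfolding immigrate_def[abs_def] by (intro dfun_SUP dfun_imm imm_Suc_mono)
  show "(\<lambda>h. immigrate T ls h \<phi>) \<in> borel_measurable borel" for \<phi>
    unfolding immigrate_def using iregular_imm by (intro borel_measurable_SUP) (auto simp: iregular_def)
qed

lemma dfun_immigrate: "dfun (immigrate T ls h)"
  using iregular_immigrate by (auto simp: iregular_def)

lemma immigrate_step: "immigrate T ls h \<phi> = istep (immigrate T ls) T ls h \<phi>"
proof -
  have "immigrate T ls h \<phi> = (SUP N. imm (Suc N) T ls h \<phi>)"
    unfolding immigrate_def
  proof (rule antisym)
    show "(SUP N. imm N T ls h \<phi>) \<le> (SUP N. imm (Suc N) T ls h \<phi>)"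
      by (intro SUP_mono' imm_Suc_mono)
    show "(SUP N. imm (Suc N) T ls h \<phi>) \<le> (SUP N. imm N T ls h \<phi>)"
      by (rule SUP_least) (rule imm_le_immigrate[unfolded immigrate_def])
  qed
  also have "\<dots> = (SUP N. \<integral>\<^sup>+x. (if \<theta> * (T - h) < x then \<phi> (blank ls)
     else imm N T ls (h + x / \<theta>) (\<lambda>w. block (map (\<lambda>u. u - (h + x / \<theta>)) ls) (\<lambda>w'. \<phi> (app w w')))) \<partial>expo)"
    by (simp add: istep_def)
  also have "\<dots> = (\<integral>\<^sup>+x. (SUP N. if \<theta> * (T - h) < x then \<phi> (blank ls)
     else imm N T ls (h + x / \<theta>) (\<lambda>w. block (map (\<lambda>u. u - (h + x / \<theta>)) ls) (\<lambda>w'. \<phi> (app w w')))) \<partial>expo)"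
  proof (rule nn_integral_monotone_convergence_SUP[symmetric])
    show "incseq (\<lambda>N x. if \<theta> * (T - h) < x then \<phi> (blank ls)
     else imm N T ls (h + x / \<theta>) (\<lambda>w. block (map (\<lambda>u. u - (h + x / \<theta>)) ls) (\<lambda>w'. \<phi> (app w w'))))"
      by (intro incseq_SucI le_funI) (auto simp del: imm.simps intro: imm_Suc_mono)
  qed (intro measurable_istep[OF iregular_imm], auto)
  also have "\<dots> = istep (immigrate T ls) T ls h \<phi>"
    unfolding istep_def immigrate_def by (auto intro!: nn_integral_cong)
  finally show ?thesis .
qed

lemma imm_mono_arg:
  assumes "\<And>w. length w = length ls \<Longrightarrow> \<phi> w \<le> \<psi> w"
  shows "imm N T ls h \<phi> \<le> imm N T ls h \<psi>"
  using assms
proof (induction N arbitrary: h \<phi> \<psi>)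
  case (Suc N)
  have "imm N T ls h' (\<lambda>w. block (map (\<lambda>u. u - h') ls) (\<lambda>w'. \<phi> (app w w'))) \<le>
      imm N T ls h' (\<lambda>w. block (map (\<lambda>u. u - h') ls) (\<lambda>w'. \<psi> (app w w')))" for h'
    by (intro Suc.IH block_mono_arg Suc.prems) simp
  moreover have "\<phi> (blank ls) \<le> \<psi> (blank ls)"
    by (intro Suc.prems) simp
  ultimately show ?case
    by (auto simp: istep_def intro!: nn_integral_mono)
qed simp

lemma immigrate_mono_arg:
  assumes "\<And>w. length w = length ls \<Longrightarrow> \<phi> w \<le> \<psi> w"
  shows "immigrate T ls h \<phi> \<le> immigrate T ls h \<psi>"
  unfolding immigrate_def by (intro SUP_mono' imm_mono_arg assms)

lemma istep_end: "istep F T ls T \<phi> = \<phi> (blank ls)"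
proof -
  have "istep F T ls T \<phi> = (\<integral>\<^sup>+x. \<phi> (blank ls) \<partial>expo)"
    unfolding istep_def by (rule nn_integral_cong_AE, use AE_expo_pos in eventually_elim) simp
  then show ?thesis using expo.emeasure_space_1 by simp
qed

text \<open>The analogue of \<open>restart_down\<close> for the immigration clock, which runs
  upwards and stops at the ceiling \<open>T\<close>.\<close>

lemma restart_istep:
  assumes F: "iregular F" and s: "h \<le> s" "s \<le> T"
  shows "istep F T ls h \<phi> =
    (\<integral>\<^sup>+x. indicator {..\<theta> * (s - h)} x *
      F (h + x / \<theta>) (\<lambda>w. block (map (\<lambda>u. u - (h + x / \<theta>)) ls) (\<lambda>w'. \<phi> (app w w'))) \<partial>expo) +
    ennreal (exp (- (\<theta> * (s - h)))) * istep F T ls s \<phi>"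
proof -
  let ?c = "\<theta> * (s - h)"
  let ?F = "\<lambda>h. F h (\<lambda>w. block (map (\<lambda>u. u - h) ls) (\<lambda>w'. \<phi> (app w w')))"
  let ?f = "\<lambda>x. if \<theta> * (T - h) < x then \<phi> (blank ls) else ?F (h + x / \<theta>)"
  have [measurable]: "?f \<in> borel_measurable borel"
    by (intro measurable_istep[OF F]) auto
  have c: "0 \<le> ?c" using s imm_nonneg by simp
  have c': "?c \<le> \<theta> * (T - h)" using s imm_nonneg by (simp add: mult_left_mono)
  have "(\<integral>\<^sup>+x. indicator {..?c} x * ?f x \<partial>expo) = (\<integral>\<^sup>+x. indicator {..?c} x * ?F (h + x / \<theta>) \<partial>expo)"
    using c' by (intro nn_integral_cong) (auto split: split_indicator)
  moreover have "(\<integral>\<^sup>+x. ?f (?c + x) \<partial>expo) = istep F T ls s \<phi>"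
    unfolding istep_def
  proof (rule nn_integral_cong_AE)
    show "AE x in expo. ?f (?c + x) = (if \<theta> * (T - s) < x then \<phi> (blank ls) else ?F (s + x / \<theta>))"
      using AE_expo_pos
    proof eventually_elim
      case (elim x)
      show ?case
      proof (cases "\<theta> = 0")
        case False
        then have "h + (?c + x) / \<theta> = s + x / \<theta>" by (simp add: field_simps)
        moreover have "\<theta> * (T - h) < ?c + x \<longleftrightarrow> \<theta> * (T - s) < x" by (simp add: algebra_simps)
        ultimately show ?thesis by (simp only:)
      qed (use elim in simp)
    qed
  qed
  ultimately show ?thesis
    using expo_split[of ?f ?c] c by (simp add: istep_def)
qed

text \<open>Each further immigrant below \<open>T\<close> needs a gap variable of at most
  \<open>\<theta> * T\<close>, so \<open>N\<close> steps leave at most mass \<open>k ^ N\<close>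
  unfinished.\<close>

lemma immigrate_mass:
  assumes "0 \<le> h" "h \<le> T"
  shows "immigrate T ls h (\<lambda>_. 1) = 1"
proof -
  define k where "k = 1 - exp (- (\<theta> * T))"
  have k: "0 \<le> k" "k < 1" using assms imm_nonneg by (auto simp: k_def)
  have bs: "1 = (\<integral>\<^sup>+x. indicator {..c} x \<partial>expo) + ennreal (exp (- c))" if "0 \<le> c" for c
    using expo_split[of "\<lambda>_. 1" c] that expo.emeasure_space_1 by simp
  have le: "imm N T ls h (\<lambda>_. 1) \<le> 1" for N h
  proof (induction N arbitrary: h)
    case (Suc N)
    have "imm (Suc N) T ls h (\<lambda>_. 1) \<le> (\<integral>\<^sup>+x. 1 \<partial>expo)"
      unfolding imm.simps istep_def block_mass by (intro nn_integral_mono) (simp add: Suc)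
    then show ?case using expo.emeasure_space_1 by simp
  qed simp
  have *: "1 \<le> imm N T ls h (\<lambda>_. 1) + ennreal (k ^ N)" if "0 \<le> h" "h \<le> T" for N h
    using that
  proof (induction N arbitrary: h)
    case (Suc N)
    let ?c = "\<theta> * (T - h)"
    let ?f = "\<lambda>x. if ?c < x then 1 else imm N T ls (h + x / \<theta>) (\<lambda>_. 1)"
    have [measurable]: "?f \<in> borel_measurable borel"
    proof -
      have "(\<lambda>x. if ?c < x then (1::ennreal) else
          imm N T ls (h + x / \<theta>) (\<lambda>w. block (map (\<lambda>u. u - (h + x / \<theta>)) ls) (\<lambda>w'. (\<lambda>_. 1) (app w w')))) \<in> borel_measurable borel"
        by (rule measurable_istep[OF iregular_imm]) auto
      then show ?thesis by (simp only: block_mass)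
    qed
    have c: "0 \<le> ?c" "?c \<le> \<theta> * T" using Suc.prems imm_nonneg by (auto intro: mult_left_mono)
    have "1 = (\<integral>\<^sup>+x. 1 \<partial>expo)" using expo.emeasure_space_1 by simp
    also have "\<dots> \<le> (\<integral>\<^sup>+x. ?f x + indicator {..?c} x * ennreal (k ^ N) \<partial>expo)"
    proof (rule nn_integral_mono_AE, use AE_expo_pos in eventually_elim)
      case (elim x)
      have "1 \<le> imm N T ls (h + x / \<theta>) (\<lambda>_. 1) + ennreal (k ^ N)" if "x \<le> ?c"
      proof -
        have "0 < \<theta>" using that elim imm_nonneg by (cases "\<theta> = 0") auto
        then show ?thesis
          using that elim Suc.prems by (intro Suc.IH) (auto simp: field_simps)
      qed
      then show ?case by (auto split: split_indicator)
    qed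
    also have "\<dots> = imm (Suc N) T ls h (\<lambda>_. 1) + (\<integral>\<^sup>+x. indicator {..?c} x \<partial>expo) * ennreal (k ^ N)"
      unfolding imm.simps istep_def block_mass by (subst nn_integral_add) (auto simp: nn_integral_multc)
    also have "(\<integral>\<^sup>+x. indicator {..?c} x \<partial>expo) = 1 - ennreal (exp (- ?c))"
      using bs[OF c(1)] by (metis ennreal_add_diff_cancel_right ennreal_neq_top)
    also have "1 - ennreal (exp (- ?c)) = ennreal (1 - exp (- ?c))"
      by (simp add: ennreal_minus flip: ennreal_1)
    also have "imm (Suc N) T ls h (\<lambda>_. 1) + ennreal (1 - exp (- ?c)) * ennreal (k ^ N) \<le>
        imm (Suc N) T ls h (\<lambda>_. 1) + ennreal k * ennreal (k ^ N)"
      using c by (intro add_left_mono mult_right_mono ennreal_leI) (auto simp: k_def)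
    finally show ?case using k by (simp add: ennreal_mult[symmetric] del: imm.simps)
  qed simp
  have "(\<lambda>N. immigrate T ls h (\<lambda>_. 1) + ennreal (k ^ N)) \<longlonglongrightarrow> immigrate T ls h (\<lambda>_. 1) + ennreal 0"
    using k by (intro tendsto_add tendsto_const tendsto_ennrealI LIMSEQ_power_zero) auto
  moreover have "1 \<le> immigrate T ls h (\<lambda>_. 1) + ennreal (k ^ N)" for N
    by (rule order_trans[OF *[OF assms] add_right_mono[OF imm_le_immigrate]])
  ultimately have "1 \<le> immigrate T ls h (\<lambda>_. 1) + ennreal 0"
    by (intro LIMSEQ_le_const) auto
  moreover have "immigrate T ls h (\<lambda>_. 1) \<le> 1"
    unfolding immigrate_def by (intro SUP_least le)
  ultimately show ?thesis by (intro antisym) auto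
qed

text \<open>The transition kernel of the full process over a height difference \<open>r\<close>:
  fresh immigrants stand to the left of the descendants of \<open>c\<close>.\<close>

definition ibranch :: "real \<Rightarrow> nat list \<Rightarrow> (nat list \<Rightarrow> ennreal) \<Rightarrow> ennreal" where
  "ibranch r c \<psi> = immigrate r [r] 0 (\<lambda>w. branch r c (\<lambda>b. \<psi> (hd w @ b)))"

lemma dfun_ibranch: "dfun (ibranch r c)"
  unfolding ibranch_def[abs_def] by (rule dfun_bind[OF dfun_immigrate], rule dfun_comp[OF dfun_branch])

lemma ibranch_append: "ibranch r (c @ d) \<psi> = ibranch r c (\<lambda>b. branch r d (\<lambda>b'. \<psi> (b @ b')))"
  by (simp add: ibranch_def branch_append)

lemma branch_mass: "branch r c (\<lambda>_. 1) = 1"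
  by (induction c) (simp_all add: mass)

lemma ibranch_mass: "0 \<le> r \<Longrightarrow> ibranch r c (\<lambda>_. 1) = 1"
  by (simp add: ibranch_def branch_mass immigrate_mass)

definition ilift :: "real \<Rightarrow> (nat list list \<Rightarrow> ennreal) \<Rightarrow> nat list list \<Rightarrow> ennreal" where
  "ilift r \<phi> a = ibranch r (hd a) (\<lambda>b. \<phi> (b # a))"

text \<open>Immigration above the current level enters once and on the far left, hence
  \<open>ibranch\<close> for the left part and plain \<open>lift\<close> for the right one.\<close>

lemma ilift_app:
  assumes "w \<noteq> []" "w' \<noteq> []"
  shows "ilift r \<phi> (app w w') = ibranch r (hd w) (\<lambda>b. lift r (\<lambda>v. \<phi> (app (b # w) v)) w')"
  using assms by (cases w; cases w') (auto simp: lift_def ilift_def ibranch_append)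

text \<open>Seen from \<open>s\<close>, immigration above \<open>s\<close> is a copy of immigration
  above \<open>0\<close>: the gaps agree, and by \<open>explore_low\<close> the blocks do not reach
  the levels in \<open>ls\<close>.\<close>

lemma imm_low:
  assumes us: "\<And>u. u \<in> set ls \<Longrightarrow> u \<le> s" and h: "s \<le> h"
  shows "imm N (t - s) [t - s] (h - s) (\<lambda>w. \<phi> (w @ blank ls)) \<le> imm N t (t # ls) h \<phi>"
  using h
proof (induction N arbitrary: h \<phi>)
  case (Suc N)
  let ?r = "t - s"
  have "imm (Suc N) ?r [?r] (h - s) (\<lambda>w. \<phi> (w @ blank ls)) =
    (\<integral>\<^sup>+x. (if \<theta> * (t - h) < x then \<phi> (blank (t # ls))
     else imm N ?r [?r] (h - s + x / \<theta>) (\<lambda>w. block [?r - (h - s + x / \<theta>)] (\<lambda>w'. \<phi> (app w w' @ blank ls)))) \<partial>expo)"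
    unfolding imm.simps istep_def by (intro nn_integral_cong) auto
  also have "\<dots> \<le> (\<integral>\<^sup>+x. (if \<theta> * (t - h) < x then \<phi> (blank (t # ls))
     else imm N t (t # ls) (h + x / \<theta>) (\<lambda>w. block (map (\<lambda>u. u - (h + x / \<theta>)) (t # ls)) (\<lambda>w'. \<phi> (app w w')))) \<partial>expo)"
  proof (rule nn_integral_mono_AE, use AE_expo_pos in eventually_elim)
    case (elim x)
    let ?h = "h + x / \<theta>"
    have "imm N ?r [?r] (h - s + x / \<theta>) (\<lambda>w. block [?r - (h - s + x / \<theta>)] (\<lambda>w'. \<phi> (app w w' @ blank ls)))
      \<le> imm N t (t # ls) ?h (\<lambda>w. block (map (\<lambda>u. u - ?h) (t # ls)) (\<lambda>w'. \<phi> (app w w')))"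
      if "\<not> \<theta> * (t - h) < x"
    proof -
      have "0 < \<theta>" using that elim imm_nonneg by (cases "\<theta> = 0") auto
      then have "0 < x / \<theta>" using elim by simp
      then have sh: "s < ?h" using Suc.prems by linarith
      have r: "h - s + x / \<theta> = ?h - s" "?r - (?h - s) = t - ?h" by auto
      let ?\<Psi> = "\<lambda>v. block (map (\<lambda>u. u - ?h) (t # ls)) (\<lambda>w'. \<phi> (app v w'))"
      have "imm N ?r [?r] (?h - s) (\<lambda>w. block [t - ?h] (\<lambda>w'. \<phi> (app w w' @ blank ls)))
        \<le> imm N ?r [?r] (?h - s) (\<lambda>w. ?\<Psi> (w @ blank ls))"
      proof (rule imm_mono_arg)
        fix w :: "nat list list" assume w: "length w = length [?r]"
        have bl: "blank (map (\<lambda>u. u - ?h) ls) = blank ls" by (simp add: blank_def comp_def)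
        have "block [t - ?h] (\<lambda>w'. \<phi> (app w w' @ blank ls)) \<le>
          block [t - ?h] (\<lambda>w'. \<phi> (app (w @ blank ls) (w' @ blank (map (\<lambda>u. u - ?h) ls))))"
          using w by (intro block_mono_arg) (simp add: app_append bl app_blank)
        also have "\<dots> \<le> block ([t - ?h] @ map (\<lambda>u. u - ?h) ls) (\<lambda>v. \<phi> (app (w @ blank ls) v))"
          unfolding block_def using us sh
          by (intro nn_integral_mono explore_low) force+
        finally show "block [t - ?h] (\<lambda>w'. \<phi> (app w w' @ blank ls)) \<le> ?\<Psi> (w @ blank ls)" by simp
      qed
      also have "\<dots> \<le> imm N t (t # ls) ?h ?\<Psi>"
        using sh by (intro Suc.IH) simp
      finally show ?thesis unfolding r .
    qed
    then show ?case by auto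
  qed
  also have "\<dots> = imm (Suc N) t (t # ls) h \<phi>"
    by (simp add: istep_def)
  finally show ?case .
qed simp

text \<open>Immigrants up to \<open>s\<close> are treated one by one with
  \<open>explore_branch\<close>, on levels shifted by the height of the immigrant; the clock that
  passes \<open>s\<close> restarts there, and \<open>imm_low\<close> supplies the immigrants
  above.\<close>

lemma imm_branch:
  assumes s: "0 \<le> s" "s \<le> t" and us: "\<And>u. u \<in> set us \<Longrightarrow> u \<le> s" and h: "0 \<le> h" "h \<le> s"
  shows "imm N s (s # us) h (ilift (t - s) \<phi>) \<le> immigrate t (t # s # us) h \<phi>"
  using h
proof (induction N arbitrary: h \<phi>)
  case (Suc N)
  let ?r = "t - s" and ?l = "s # us" and ?L = "t # s # us" and ?c = "\<theta> * (s - h)"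
  let ?\<Psi> = "\<lambda>h' v. block (map (\<lambda>u. u - h') ?L) (\<lambda>v'. \<phi> (app v v'))"
  have "imm (Suc N) s ?l h (ilift ?r \<phi>) =
    (\<integral>\<^sup>+x. indicator {..?c} x * imm N s ?l (h + x / \<theta>) (\<lambda>w. block (map (\<lambda>u. u - (h + x / \<theta>)) ?l) (\<lambda>w'. ilift ?r \<phi> (app w w'))) \<partial>expo) +
    ennreal (exp (- ?c)) * ilift ?r \<phi> (blank ?l)"
    unfolding imm.simps restart_istep[OF iregular_imm Suc.prems(2) order_refl] istep_end ..
  also have "\<dots> \<le> (\<integral>\<^sup>+x. indicator {..?c} x * immigrate t ?L (h + x / \<theta>) (?\<Psi> (h + x / \<theta>)) \<partial>expo) +
    ennreal (exp (- ?c)) * immigrate t ?L s \<phi>"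
  proof (intro add_mono mult_left_mono)
    have "ilift ?r \<phi> (blank ?l) = immigrate ?r [?r] 0 (\<lambda>w. \<phi> (hd w # blank ?l))"
      by (simp add: ilift_def ibranch_def)
    also have "\<dots> \<le> immigrate ?r [?r] 0 (\<lambda>w. \<phi> (w @ blank ?l))"
    proof (rule immigrate_mono_arg)
      fix w :: "nat list list" assume "length w = length [?r]"
      then show "\<phi> (hd w # blank ?l) \<le> \<phi> (w @ blank ?l)" by (cases w) auto
    qed
    also have "\<dots> \<le> immigrate t ?L s \<phi>"
      unfolding immigrate_def[of ?r]
    proof (rule SUP_least)
      fix N
      have "imm N ?r [?r] (s - s) (\<lambda>w. \<phi> (w @ blank ?l)) \<le> imm N t ?L s \<phi>"
        using us by (intro imm_low) auto
      also have "\<dots> \<le> immigrate t ?L s \<phi>" by (rule imm_le_immigrate)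
      finally show "imm N ?r [?r] 0 (\<lambda>w. \<phi> (w @ blank ?l)) \<le> immigrate t ?L s \<phi>" by simp
    qed
    finally show "ilift ?r \<phi> (blank ?l) \<le> immigrate t ?L s \<phi>" .
    show "(\<integral>\<^sup>+x. indicator {..?c} x * imm N s ?l (h + x / \<theta>) (\<lambda>w. block (map (\<lambda>u. u - (h + x / \<theta>)) ?l) (\<lambda>w'. ilift ?r \<phi> (app w w'))) \<partial>expo)
      \<le> (\<integral>\<^sup>+x. indicator {..?c} x * immigrate t ?L (h + x / \<theta>) (?\<Psi> (h + x / \<theta>)) \<partial>expo)"
    proof (rule nn_integral_mono_AE, use AE_expo_pos in eventually_elim)
      case (elim x)
      let ?h = "h + x / \<theta>"
      let ?m = "map (\<lambda>u. u - ?h)"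
      have "imm N s ?l ?h (\<lambda>w. block (?m ?l) (\<lambda>w'. ilift ?r \<phi> (app w w'))) \<le> immigrate t ?L ?h (?\<Psi> ?h)"
        if "x \<le> ?c"
      proof -
        have "0 < \<theta>" using that elim imm_nonneg by (cases "\<theta> = 0") auto
        then have h: "0 \<le> ?h" "?h \<le> s" using that elim Suc.prems by (auto simp: field_simps)
        have "imm N s ?l ?h (\<lambda>w. block (?m ?l) (\<lambda>w'. ilift ?r \<phi> (app w w'))) \<le> imm N s ?l ?h (ilift ?r (?\<Psi> ?h))"
        proof (rule imm_mono_arg)
          fix w :: "nat list list" assume w: "length w = length ?l"
          have "block (?m ?l) (\<lambda>w'. ilift ?r \<phi> (app w w')) \<le>
              block (?m ?l) (\<lambda>w'. ibranch ?r (hd w) (\<lambda>b. lift ?r (\<lambda>v. \<phi> (app (b # w) v)) w'))"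
            using w by (intro block_mono_arg eq_refl ilift_app) auto
          also have "\<dots> = ibranch ?r (hd w) (\<lambda>b. block (?m ?l) (lift ?r (\<lambda>v. \<phi> (app (b # w) v))))"
            by (rule dfun_swap[OF dfun_block dfun_ibranch])
          also have "\<dots> \<le> ibranch ?r (hd w) (\<lambda>b. block (?m ?L) (\<lambda>v. \<phi> (app (b # w) v)))"
          proof (rule dfun_mono[OF dfun_ibranch])
            fix b
            \<comment> \<open>The shift by \<open>?h\<close> cancels in the difference of the two
              levels, so the kernel still runs over \<open>t - s\<close>.\<close>
            have "explore ((s - ?h) # ?m us) n 0 (lift ((t - ?h) - (s - ?h)) \<psi>) \<le> explore ((t - ?h) # (s - ?h) # ?m us) n 0 \<psi>" for n \<psi>
              using h s us by (intro explore_branch) auto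
            then show "block (?m ?l) (lift ?r (\<lambda>v. \<phi> (app (b # w) v))) \<le> block (?m ?L) (\<lambda>v. \<phi> (app (b # w) v))"
              unfolding block_def by (intro nn_integral_mono) simp
          qed
          finally show "block (?m ?l) (\<lambda>w'. ilift ?r \<phi> (app w w')) \<le> ilift ?r (?\<Psi> ?h) w"
            by (simp only: ilift_def)
        qed
        also have "\<dots> \<le> immigrate t ?L ?h (?\<Psi> ?h)"
          by (rule Suc.IH[OF h])
        finally show ?thesis .
      qed
      then show ?case by (auto split: split_indicator)
    qed
  qed auto
  also have "\<dots> = istep (immigrate t ?L) t ?L h \<phi>"
    unfolding immigrate_step[of t ?L s \<phi>]
    by (rule restart_istep[OF iregular_immigrate Suc.prems(2) s(2), symmetric])
  also have "\<dots> = immigrate t ?L h \<phi>"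
    by (rule immigrate_step[symmetric])
  finally show ?case .
qed simp

definition total :: "real \<Rightarrow> real list \<Rightarrow> nat list \<Rightarrow> (nat list list \<Rightarrow> ennreal) \<Rightarrow> ennreal" where
  "total T ls ns \<phi> = immigrate T ls 0 (\<lambda>w. blocks ls ns (\<lambda>w'. \<phi> (app w w')))"

text \<open>Supplies the bound required by \<open>markov_processI\<close>. Immigrants and initial
  blocks are independent, so the average attached to the former is moved outside the latter; the
  ceiling rises from \<open>s\<close> to \<open>t\<close> in \<open>imm_branch\<close>.\<close>

lemma total_branch:
  assumes s: "0 \<le> s" "s \<le> t" and us: "\<And>u. u \<in> set us \<Longrightarrow> u \<le> s"
  shows "total s (s # us) ns (ilift (t - s) \<phi>) \<le> total t (t # s # us) ns \<phi>"
proof -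
  let ?r = "t - s" and ?l = "s # us" and ?L = "t # s # us"
  have "total s ?l ns (ilift ?r \<phi>) \<le> immigrate s ?l 0 (ilift ?r (\<lambda>v. blocks ?L ns (\<lambda>v'. \<phi> (app v v'))))"
    unfolding total_def
  proof (rule immigrate_mono_arg)
    fix w :: "nat list list" assume w: "length w = length ?l"
    have "blocks ?l ns (\<lambda>w'. ilift ?r \<phi> (app w w')) \<le> blocks ?l ns (\<lambda>w'. ibranch ?r (hd w) (\<lambda>b. lift ?r (\<lambda>v. \<phi> (app (b # w) v)) w'))"
      using w by (intro blocks_mono_arg eq_refl ilift_app) auto
    also have "\<dots> = ibranch ?r (hd w) (\<lambda>b. blocks ?l ns (lift ?r (\<lambda>v. \<phi> (app (b # w) v))))"
      by (rule dfun_swap[OF dfun_blocks dfun_ibranch])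
    also have "\<dots> \<le> ibranch ?r (hd w) (\<lambda>b. blocks ?L ns (\<lambda>v. \<phi> (app (b # w) v)))"
      by (rule dfun_mono[OF dfun_ibranch]) (rule blocks_branch[OF s us])
    finally show "blocks ?l ns (\<lambda>w'. ilift ?r \<phi> (app w w')) \<le> ilift ?r (\<lambda>v. blocks ?L ns (\<lambda>v'. \<phi> (app v v'))) w"
      by (simp only: ilift_def)
  qed
  also have "\<dots> \<le> immigrate t ?L 0 (\<lambda>v. blocks ?L ns (\<lambda>v'. \<phi> (app v v')))"
    unfolding immigrate_def[of s] using s us by (intro SUP_least imm_branch) auto
  finally show ?thesis by (simp only: total_def)
qed

end

subsection \<open>Product measures\<close>

text \<open>Redrawing one coordinate does not change a product law. This is how the variable
  consumed by the current step is integrated out.\<close>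

lemma nn_integral_PiM_resample:
  assumes M: "\<And>i. prob_space (M i)" and f: "f \<in> borel_measurable (PiM UNIV M)"
  shows "(\<integral>\<^sup>+v. f v \<partial>PiM UNIV M) = (\<integral>\<^sup>+x. (\<integral>\<^sup>+v. f (v(i := x)) \<partial>PiM UNIV M) \<partial>M i)"
proof -
  interpret P: prob_space "PiM UNIV M" using M by (intro prob_space_PiM) auto
  have e: "distr (M i \<Otimes>\<^sub>M PiM UNIV M) (PiM UNIV M) (\<lambda>(x, X). X(i := x)) = PiM UNIV M"
    using distr_pair_PiM_eq_PiM[of UNIV M i] M by simp
  have m: "(\<lambda>(x, X). X(i := x)) \<in> M i \<Otimes>\<^sub>M PiM UNIV M \<rightarrow>\<^sub>M PiM UNIV M"
    unfolding case_prod_beta by (rule measurable_fun_upd[where J=UNIV]) auto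
  have "(\<integral>\<^sup>+v. f v \<partial>PiM UNIV M) = (\<integral>\<^sup>+v. f v \<partial>distr (M i \<Otimes>\<^sub>M PiM UNIV M) (PiM UNIV M) (\<lambda>(x, X). X(i := x)))"
    by (simp add: e)
  also have "\<dots> = (\<integral>\<^sup>+p. f (case p of (x, X) \<Rightarrow> X(i := x)) \<partial>(M i \<Otimes>\<^sub>M PiM UNIV M))"
    by (rule nn_integral_distr[OF m]) (use f in simp)
  also have "\<dots> = (\<integral>\<^sup>+x. (\<integral>\<^sup>+v. f (v(i := x)) \<partial>PiM UNIV M) \<partial>M i)"
    by (subst P.nn_integral_fst[symmetric]) (use measurable_compose[OF m f] in simp_all)
  finally show ?thesis .
qed

text \<open>Two independent copies are glued along \<open>A\<close>. On finite cylinders the product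
  of the probabilities splits over \<open>K - A\<close> and \<open>K \<inter> A\<close>.\<close>

lemma distr_PiM_merge:
  fixes M :: "'i \<Rightarrow> 'a measure"
  assumes M: "\<And>i. prob_space (M i)"
  shows "distr (PiM UNIV M \<Otimes>\<^sub>M PiM UNIV M) (PiM UNIV M) (\<lambda>(v, v') i. if i \<in> A then v' i else v i) = PiM UNIV M"
proof -
  interpret product_prob_space M UNIV
    using M by (simp add: product_prob_space_def product_sigma_finite_def product_prob_space_axioms_def prob_space_imp_sigma_finite)
  let ?g = "\<lambda>(v, v') i. if i \<in> A then v' i else v i"
  have m: "?g \<in> PiM UNIV M \<Otimes>\<^sub>M PiM UNIV M \<rightarrow>\<^sub>M PiM UNIV M"
    unfolding case_prod_beta
    by (rule measurable_PiM_single') (auto simp: space_PiM space_pair_measure PiE_iff)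
  show ?thesis
  proof (rule PiM_eq)
    fix K F assume K: "finite K" "K \<subseteq> UNIV" "\<And>j. j \<in> K \<Longrightarrow> F j \<in> sets (M j)"
    let ?E = "\<lambda>K. prod_emb UNIV M K (\<Pi>\<^sub>E j\<in>K. F j)"
    have sE: "?E K' \<in> sets (PiM UNIV M)" if "K' \<subseteq> K" for K'
      using K that by (intro sets_PiM_I) (auto intro: finite_subset)
    have eq: "?g -` ?E K \<inter> space (PiM UNIV M \<Otimes>\<^sub>M PiM UNIV M) = ?E (K - A) \<times> ?E (K \<inter> A)"
      by (auto simp: prod_emb_def space_pair_measure space_PiM PiE_iff split: if_splits)
    have "emeasure (distr (PiM UNIV M \<Otimes>\<^sub>M PiM UNIV M) (PiM UNIV M) ?g) (?E K) = emeasure (PiM UNIV M) (?E (K - A)) * emeasure (PiM UNIV M) (?E (K \<inter> A))"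
      by (simp add: emeasure_distr[OF m] sE eq P.emeasure_pair_measure_Times)
    also have "\<dots> = (\<Prod>j\<in>K - A. emeasure (M j) (F j)) * (\<Prod>j\<in>K \<inter> A. emeasure (M j) (F j))"
      using K by (intro arg_cong2[where f="(*)"] emeasure_PiM_emb) auto
    also have "\<dots> = (\<Prod>j\<in>K. emeasure (M j) (F j))"
      using K by (subst prod.union_disjoint[symmetric]) (auto intro!: prod.cong)
    finally show "emeasure (distr (PiM UNIV M \<Otimes>\<^sub>M PiM UNIV M) (PiM UNIV M) ?g) (?E K) = (\<Prod>j\<in>K. emeasure (M j) (F j))" .
  qed simp
qed

text \<open>\<open>X\<close> reads the coordinates in \<open>A\<close> and \<open>Y\<close> the
  others, so \<open>X\<close> may be evaluated on an independent copy. Countable values make every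
  \<Phi> admissible.\<close>

lemma nn_integral_PiM_indep:
  fixes X :: "('i \<Rightarrow> 'a) \<Rightarrow> 'b::countable" and Y :: "('i \<Rightarrow> 'a) \<Rightarrow> 'c::countable"
  assumes M: "\<And>i. prob_space (M i)"
    and X: "X \<in> PiM UNIV M \<rightarrow>\<^sub>M count_space UNIV" and Y: "Y \<in> PiM UNIV M \<rightarrow>\<^sub>M count_space UNIV"
    and XA: "\<And>v v'. (\<And>i. i \<in> A \<Longrightarrow> v i = v' i) \<Longrightarrow> X v = X v'"
    and YA: "\<And>v v'. (\<And>i. i \<notin> A \<Longrightarrow> v i = v' i) \<Longrightarrow> Y v = Y v'"
  shows "(\<integral>\<^sup>+v. \<Phi> (X v) (Y v) \<partial>PiM UNIV M) = (\<integral>\<^sup>+v. (\<integral>\<^sup>+v'. \<Phi> (X v') (Y v) \<partial>PiM UNIV M) \<partial>PiM UNIV M)"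
proof -
  interpret PM: prob_space "PiM UNIV M" using M by (intro prob_space_PiM) auto
  let ?g = "\<lambda>(v, v') i. if i \<in> A then v' i else v i"
  have m: "?g \<in> PiM UNIV M \<Otimes>\<^sub>M PiM UNIV M \<rightarrow>\<^sub>M PiM UNIV M"
    unfolding case_prod_beta
    by (rule measurable_PiM_single') (auto simp: space_PiM space_pair_measure PiE_iff)
  have f: "(\<lambda>v. \<Phi> (X v) (Y v)) \<in> borel_measurable (PiM UNIV M)"
    by (rule measurable_compose_countable[OF _ X], rule measurable_compose_countable[OF _ Y]) simp
  have "(\<integral>\<^sup>+v. \<Phi> (X v) (Y v) \<partial>PiM UNIV M) =
      (\<integral>\<^sup>+v. \<Phi> (X v) (Y v) \<partial>distr (PiM UNIV M \<Otimes>\<^sub>M PiM UNIV M) (PiM UNIV M) ?g)"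
    by (simp only: distr_PiM_merge[OF M])
  also have "\<dots> = (\<integral>\<^sup>+p. \<Phi> (X (?g p)) (Y (?g p)) \<partial>(PiM UNIV M \<Otimes>\<^sub>M PiM UNIV M))"
    by (rule nn_integral_distr[OF m]) (use f in simp)
  also have "\<dots> = (\<integral>\<^sup>+v. (\<integral>\<^sup>+v'. \<Phi> (X (?g (v, v'))) (Y (?g (v, v'))) \<partial>PiM UNIV M) \<partial>PiM UNIV M)"
    by (subst PM.nn_integral_fst[symmetric]) (use measurable_compose[OF m f] in simp_all)
  also have "\<dots> = (\<integral>\<^sup>+v. (\<integral>\<^sup>+v'. \<Phi> (X v') (Y v) \<partial>PiM UNIV M) \<partial>PiM UNIV M)"
    by (intro nn_integral_cong arg_cong2[where f=\<Phi>] XA YA) auto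
  finally show ?thesis .
qed

subsection \<open>Measurability of the skewer\<close>

lemma measurable_concat_map:
  fixes g :: "'b \<Rightarrow> 'w \<Rightarrow> 'a::countable list"
  assumes "\<And>i. i \<in> set xs \<Longrightarrow> g i \<in> N \<rightarrow>\<^sub>M count_space UNIV"
  shows "(\<lambda>w. concat (map (\<lambda>i. g i w) xs)) \<in> N \<rightarrow>\<^sub>M count_space UNIV"
  using assms
proof (induction xs)
  case (Cons i xs)
  have 1: "g i \<in> N \<rightarrow>\<^sub>M count_space UNIV" using Cons.prems by simp
  have 2: "(\<lambda>w. concat (map (\<lambda>i. g i w) xs)) \<in> N \<rightarrow>\<^sub>M count_space UNIV" using Cons by simp
  have "(\<lambda>w. g i w @ concat (map (\<lambda>i. g i w) xs)) \<in> N \<rightarrow>\<^sub>M count_space UNIV"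
    by (rule measurable_compose_countable[OF measurable_compose[OF 2] 1]) simp
  then show ?case by simp
qed simp

lemma measurable_map:
  fixes g :: "'b \<Rightarrow> 'w \<Rightarrow> 'a::countable"
  assumes "\<And>i. i \<in> set xs \<Longrightarrow> g i \<in> N \<rightarrow>\<^sub>M count_space UNIV"
  shows "(\<lambda>w. map (\<lambda>i. g i w) xs) \<in> N \<rightarrow>\<^sub>M count_space UNIV"
proof -
  have "(\<lambda>w. concat (map (\<lambda>i. [g i w]) xs)) \<in> N \<rightarrow>\<^sub>M count_space UNIV"
    by (intro measurable_concat_map measurable_compose[OF assms]) auto
  moreover have "concat (map (\<lambda>i. [g i w]) xs) = map (\<lambda>i. g i w) xs" for w
    by (induction xs) auto
  ultimately show ?thesis by simp
qed

lemma map_filter_concat: "map f (filter p xs) = concat (map (\<lambda>x. if p x then [f x] else []) xs)"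
  by (induction xs) auto

lemma measurable_natv [measurable]: "natv \<in> borel \<rightarrow>\<^sub>M count_space UNIV"
  unfolding natv_def by measurable

text \<open>Stated for a measurable family over any space, so as to apply to the coordinates of a
  product, to pairs with a random height, and to the variables of the theorem.\<close>

context
  fixes N :: "'w measure" and V :: "'w \<Rightarrow> prim \<Rightarrow> real"
  assumes V [measurable]: "\<And>x. (\<lambda>w. V w x) \<in> borel_measurable N"
begin

lemma measurable_cst [measurable]: "(\<lambda>w. cst (V w) r i m) \<in> N \<rightarrow>\<^sub>M count_space UNIV"
proof (induction m)
  case (Suc m)
  show ?case
    unfolding cst.simps
    by (rule measurable_compose_countable[OF _ Suc]) measurable
qed simp

lemma measurable_hold [measurable]: "(\<lambda>w. hold Q (V w) r i m) \<in> borel_measurable N"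
  unfolding hold_def by (rule measurable_compose_countable[OF _ measurable_cst]) measurable

lemma measurable_nsteps [measurable]: "(\<lambda>w. nsteps (V w) r i) \<in> N \<rightarrow>\<^sub>M count_space UNIV"
  unfolding nsteps_def by measurable

lemma measurable_life [measurable]: "(\<lambda>w. life Q (V w) r i) \<in> borel_measurable N"
  unfolding life_def by (rule measurable_compose_countable[OF _ measurable_nsteps]) measurable

lemma measurable_mark:
  assumes [measurable]: "f \<in> borel_measurable N"
  shows "(\<lambda>w. mark Q (V w) r i (f w)) \<in> N \<rightarrow>\<^sub>M count_space UNIV"
proof -
  have "(\<lambda>w. LEAST m. f w < (\<Sum>l\<le>m. hold Q (V w) r i l)) \<in> N \<rightarrow>\<^sub>M count_space UNIV"
    by measurable
  then show ?thesis
    unfolding mark_def by (rule measurable_compose_countable[rotated]) (rule measurable_cst)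
qed

lemma measurable_jtime [measurable]: "(\<lambda>w. jtime \<alpha> (V w) r i) \<in> borel_measurable N"
  unfolding jtime_def by measurable

lemma measurable_njumps [measurable]: "(\<lambda>w. njumps Q \<alpha> (V w) r) \<in> N \<rightarrow>\<^sub>M count_space UNIV"
  unfolding njumps_def by measurable

lemma measurable_pre_h [measurable]: "(\<lambda>w. pre_h Q \<alpha> (V w) r i) \<in> borel_measurable N"
  unfolding pre_h_def by measurable

lemma measurable_skewer:
  assumes [measurable]: "f \<in> borel_measurable N"
  shows "(\<lambda>w. skewer Q \<alpha> (V w) r (f w)) \<in> N \<rightarrow>\<^sub>M count_space UNIV"
  unfolding skewer_def map_filter_concat
proof (rule measurable_compose_countable[OF _ measurable_njumps[of Q \<alpha> r]], intro measurable_concat_map)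
  fix i
  have [measurable]: "(\<lambda>w. mark Q (V w) r i (f w - pre_h Q \<alpha> (V w) r i)) \<in> N \<rightarrow>\<^sub>M count_space UNIV"
    by (intro measurable_mark) measurable
  have [measurable]: "(\<lambda>w. [mark Q (V w) r i (f w - pre_h Q \<alpha> (V w) r i)]) \<in> N \<rightarrow>\<^sub>M count_space UNIV"
    by (rule measurable_compose[of _ N "count_space UNIV"]) auto
  show "(\<lambda>w. if pre_h Q \<alpha> (V w) r i \<le> f w \<and> f w < pre_h Q \<alpha> (V w) r i + life Q (V w) r i
      then [mark Q (V w) r i (f w - pre_h Q \<alpha> (V w) r i)] else []) \<in> N \<rightarrow>\<^sub>M count_space UNIV"
    by measurable
qed

lemma measurable_negpt [measurable]: "(\<lambda>w. negpt \<theta> (V w) j) \<in> borel_measurable N"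
  unfolding negpt_def by measurable

lemma measurable_neg_count: "(\<lambda>w. neg_count \<theta> (V w) u) \<in> N \<rightarrow>\<^sub>M count_space UNIV"
  unfolding neg_count_def by measurable

lemma measurable_neg_skewer: "(\<lambda>w. neg_skewer Q \<alpha> \<theta> (V w) u) \<in> N \<rightarrow>\<^sub>M count_space UNIV"
  unfolding neg_skewer_def
  by (rule measurable_compose_countable[OF _ measurable_neg_count[of \<theta> u]], intro measurable_concat_map measurable_skewer)
     measurable

lemma measurable_pos_skewer: "(\<lambda>w. pos_skewer Q \<alpha> ns (V w) u) \<in> N \<rightarrow>\<^sub>M count_space UNIV"
  unfolding pos_skewer_def by (intro measurable_concat_map measurable_skewer) simp

lemma measurable_full_skewer: "(\<lambda>w. full_skewer Q \<alpha> \<theta> ns (V w) u) \<in> N \<rightarrow>\<^sub>M count_space UNIV"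
  unfolding full_skewer_def
  by (rule measurable_compose_countable[OF measurable_compose[OF measurable_pos_skewer] measurable_neg_skewer]) simp

end

subsection \<open>Dependence on the primitive variables\<close>

fun src_of :: "prim \<Rightarrow> src option" where
  "src_of (PInit r i) = Some r"
| "src_of (PStep r i m y) = Some r"
| "src_of (PHold r i m y) = Some r"
| "src_of (PGap r l) = Some r"
| "src_of (PTh l) = None"

lemma skewer_cong:
  assumes "\<And>x. src_of x = Some r \<Longrightarrow> v x = v' x"
  shows "skewer Q \<alpha> v r u = skewer Q \<alpha> v' r u"
proof -
  have c: "cst v r i m = cst v' r i m" for i m
    by (induction m) (simp_all add: assms)
  then have h: "hold Q v r i m = hold Q v' r i m" for i m
    by (simp add: hold_def assms)
  have l: "life Q v r i = life Q v' r i" for i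
    by (simp add: life_def nsteps_def c h)
  have k: "mark Q v r i s = mark Q v' r i s" for i s
    by (simp add: mark_def c h)
  have j: "jtime \<alpha> v r i = jtime \<alpha> v' r i" for i
    by (simp add: jtime_def assms)
  show ?thesis
    by (simp add: skewer_def njumps_def pre_h_def l k j)
qed

subsection \<open>The exploration of one block\<close>

text \<open>The canonical space has independent coordinates with laws \<open>D x\<close>. Discrete
  variables are real-valued and enter through \<open>natv\<close>, so their laws are prescribed
  after that map.\<close>

locale skewer_model = immigration J P "rate Q" \<alpha> \<theta> PM
  for J P Q \<alpha> \<theta> PM +
  fixes ns :: "nat list" and D :: "prim \<Rightarrow> real measure" and I :: "src \<Rightarrow> nat pmf"
  assumes prob_D: "\<And>x. prob_space (D x)" and sets_D: "\<And>x. sets (D x) = sets borel"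
    and init_0: "\<And>r. distr (D (PInit r 0)) (count_space UNIV) natv = measure_pmf (I r)"
    and init_Suc: "\<And>r i. distr (D (PInit r (Suc i))) (count_space UNIV) natv = measure_pmf P"
    and step_law: "\<And>r i m y. distr (D (PStep r i m y)) (count_space UNIV) natv = measure_pmf (J y)"
    and hold_law: "\<And>r i m y. D (PHold r i m y) = expo"
    and gap_law: "\<And>r i. D (PGap r i) = expo"
    and th_law: "\<And>l. D (PTh l) = expo"
    and I_Pos: "\<And>c. I (Pos c) = return_pmf (ns ! c)"
    and I_Neg: "\<And>j. I (Neg j) = PM"
begin

abbreviation mu :: "(prim \<Rightarrow> real) measure" where "mu \<equiv> PiM UNIV D"

lemma measurable_coord [measurable]: "(\<lambda>v. v x) \<in> borel_measurable mu"
proof -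
  have "(\<lambda>v. v x) \<in> mu \<rightarrow>\<^sub>M D x" by (rule measurable_component_singleton) simp
  then show ?thesis by (simp only: measurable_cong_sets[OF refl sets_D])
qed

lemma nn_integral_natv:
  assumes "distr (D x) (count_space UNIV) natv = measure_pmf p"
  shows "(\<integral>\<^sup>+u. f (natv u) \<partial>D x) = (\<integral>\<^sup>+z. f z \<partial>p)"
proof -
  have "natv \<in> D x \<rightarrow>\<^sub>M count_space UNIV"
    using measurable_natv measurable_cong_sets[OF sets_D refl] by blast
  then show ?thesis
    unfolding assms[symmetric] by (subst nn_integral_distr) auto
qed

text \<open>The exploration of block \<open>r\<close> read off the primitive variables: step \<open>m\<close> of chain \<open>i\<close>, in state \<open>y\<close>,
  at height \<open>h\<close>; \<open>None\<close> if it has not ended after \<open>N\<close> steps.\<close>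

primrec brun :: "real list \<Rightarrow> src \<Rightarrow> (prim \<Rightarrow> real) \<Rightarrow> nat \<Rightarrow> nat \<Rightarrow> nat \<Rightarrow> nat \<Rightarrow> real \<Rightarrow> nat list list option" where
  "brun ls r v 0 = (\<lambda>i m y h. None)"
| "brun ls r v (Suc N) = (\<lambda>i m y h.
     if y = 0
     then if \<alpha> * h < v (PGap r i) then Some (blank ls)
          else brun ls r v N (Suc i) 0 (natv (v (PInit r (Suc i)))) (h - v (PGap r i) / \<alpha>)
     else map_option (app (piece ls h (h + v (PHold r i m y) / rate Q y) y))
            (brun ls r v N i (Suc m) (natv (v (PStep r i m y))) (h + v (PHold r i m y) / rate Q y)))"

text \<open>An unfinished run weighs nothing, in accordance with \<open>expl 0\<close>.\<close>

definition wt :: "(nat list list \<Rightarrow> ennreal) \<Rightarrow> nat list list option \<Rightarrow> ennreal" where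
  "wt \<phi> a = (case a of None \<Rightarrow> 0 | Some w \<Rightarrow> \<phi> w)"

lemma wt_simps [simp]: "wt \<phi> None = 0" "wt \<phi> (Some w) = \<phi> w"
  "wt \<phi> (map_option f a) = wt (\<lambda>w. \<phi> (f w)) a"
  by (auto simp: wt_def split: option.split)

text \<open>Every variable is read at most once, and in a fixed order. One already consumed can
  therefore be redrawn without affecting the rest of the run.\<close>

lemma brun_cong:
  assumes "\<And>i'. i \<le> i' \<Longrightarrow> v (PGap r i') = v' (PGap r i')"
    and "\<And>i'. i < i' \<Longrightarrow> v (PInit r i') = v' (PInit r i')"
    and "\<And>i' m' y'. i < i' \<or> i' = i \<and> m \<le> m' \<Longrightarrow> v (PStep r i' m' y') = v' (PStep r i' m' y')"
    and "\<And>i' m' y'. i < i' \<or> i' = i \<and> m \<le> m' \<Longrightarrow> v (PHold r i' m' y') = v' (PHold r i' m' y')"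
  shows "brun ls r v N i m y h = brun ls r v' N i m y h"
  using assms
proof (induction N arbitrary: i m y h)
  case (Suc N)
  have 1: "brun ls r v N (Suc i) 0 z h' = brun ls r v' N (Suc i) 0 z h'" for z h'
    by (intro Suc.IH Suc.prems) auto
  have 2: "brun ls r v N i (Suc m) z h' = brun ls r v' N i (Suc m) z h'" for z h'
    by (intro Suc.IH Suc.prems) auto
  have 3: "v (PGap r i) = v' (PGap r i)" "v (PInit r (Suc i)) = v' (PInit r (Suc i))"
    "v (PStep r i m y) = v' (PStep r i m y)" "v (PHold r i m y) = v' (PHold r i m y)"
    by (auto intro: Suc.prems)
  show ?case by (simp add: 1 2 3)
qed simp

lemma measurable_brun_pair:
  "(\<lambda>p. brun ls r (snd p) N i m y (fst p)) \<in> borel \<Otimes>\<^sub>M mu \<rightarrow>\<^sub>M count_space UNIV"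
proof (induction N arbitrary: i m y)
  case (Suc N)
  have c [measurable]: "(\<lambda>p. snd p x) \<in> borel_measurable (borel \<Otimes>\<^sub>M mu)" for x
    by (rule measurable_compose[OF measurable_snd measurable_coord])
  have IH: "(\<lambda>p. brun ls r (snd p) N i m (k p) (f p)) \<in> borel \<Otimes>\<^sub>M mu \<rightarrow>\<^sub>M count_space UNIV"
    if [measurable]: "f \<in> borel_measurable (borel \<Otimes>\<^sub>M mu)" and k: "k \<in> borel \<Otimes>\<^sub>M mu \<rightarrow>\<^sub>M count_space UNIV" for i m k f
  proof (rule measurable_compose_countable[OF _ k])
    fix z
    show "(\<lambda>p. brun ls r (snd p) N i m z (f p)) \<in> borel \<Otimes>\<^sub>M mu \<rightarrow>\<^sub>M count_space UNIV"
      using measurable_compose[OF _ Suc.IH, of "\<lambda>p. (f p, snd p)" "borel \<Otimes>\<^sub>M mu" i m z] by simp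
  qed
  have n: "(\<lambda>p. natv (snd p x)) \<in> borel \<Otimes>\<^sub>M mu \<rightarrow>\<^sub>M count_space UNIV" for x
    by measurable
  have [measurable]: "(\<lambda>p. brun ls r (snd p) N (Suc i) 0 (natv (snd p (PInit r (Suc i)))) (fst p - snd p (PGap r i) / \<alpha>)) \<in> borel \<Otimes>\<^sub>M mu \<rightarrow>\<^sub>M count_space UNIV"
    by (intro IH n) measurable
  have 1: "(\<lambda>p. if \<alpha> * fst p < snd p (PGap r i) then Some (blank ls)
          else brun ls r (snd p) N (Suc i) 0 (natv (snd p (PInit r (Suc i)))) (fst p - snd p (PGap r i) / \<alpha>)) \<in> borel \<Otimes>\<^sub>M mu \<rightarrow>\<^sub>M count_space UNIV"
    by measurable
  have 2: "(\<lambda>p. brun ls r (snd p) N i (Suc m) (natv (snd p (PStep r i m y))) (fst p + snd p (PHold r i m y) / rate Q y)) \<in> borel \<Otimes>\<^sub>M mu \<rightarrow>\<^sub>M count_space UNIV"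
    by (intro IH n) measurable
  have 3: "(\<lambda>p. piece ls (fst p) (fst p + snd p (PHold r i m y) / rate Q y) y) \<in> borel \<Otimes>\<^sub>M mu \<rightarrow>\<^sub>M count_space UNIV"
    by (intro measurable_piece) measurable
  have "(\<lambda>p. map_option (app (piece ls (fst p) (fst p + snd p (PHold r i m y) / rate Q y) y))
            (brun ls r (snd p) N i (Suc m) (natv (snd p (PStep r i m y))) (fst p + snd p (PHold r i m y) / rate Q y)))
     \<in> borel \<Otimes>\<^sub>M mu \<rightarrow>\<^sub>M count_space UNIV"
    by (rule measurable_compose_countable[OF measurable_compose[OF 2] 3]) simp
  with 1 show ?case by (cases "y = 0") simp_all
qed simp

lemma measurable_brun:
  assumes "k \<in> mu \<rightarrow>\<^sub>M count_space UNIV"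
  shows "(\<lambda>v. brun ls r v N i m (k v) h) \<in> mu \<rightarrow>\<^sub>M count_space UNIV"
  by (rule measurable_compose_countable[OF _ assms])
     (use measurable_compose[OF _ measurable_brun_pair, of "\<lambda>v. (h, v)" mu] in simp)

lemma measurable_wt_brun:
  assumes "k \<in> mu \<rightarrow>\<^sub>M count_space UNIV"
  shows "(\<lambda>v. wt \<phi> (brun ls r v N i m (k v) h)) \<in> borel_measurable mu"
  by (rule measurable_compose[OF measurable_brun[OF assms]]) simp

text \<open>A step consumes one exponential variable and, if the run goes on, one discrete variable,
  both fresh by \<open>brun_cong\<close>; integrating them out in this order reproduces
  \<open>step\<close>.\<close>

lemma nn_integral_brun: "(\<integral>\<^sup>+v. wt \<phi> (brun ls r v N i m y h) \<partial>mu) = expl N ls y h \<phi>"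
proof (induction N arbitrary: i m y h \<phi>)
  case (Suc N)
  show ?case
  proof (cases "y = 0")
    case True
    let ?g = "PGap r i" and ?i = "PInit r (Suc i)"
    have "(\<integral>\<^sup>+v. wt \<phi> (brun ls r v (Suc N) i m y h) \<partial>mu) =
      (\<integral>\<^sup>+x. (\<integral>\<^sup>+v. wt \<phi> (brun ls r (v(?g := x)) (Suc N) i m y h) \<partial>mu) \<partial>expo)"
      unfolding gap_law[of r i, symmetric]
      by (rule nn_integral_PiM_resample[OF prob_D]) (rule measurable_wt_brun, simp)
    also have "\<dots> = (\<integral>\<^sup>+x. (if \<alpha> * h < x then \<phi> (blank ls) else \<integral>\<^sup>+z. expl N ls z (h - x / \<alpha>) \<phi> \<partial>P) \<partial>expo)"
    proof (rule nn_integral_cong)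
      fix x
      interpret mu: prob_space mu by (intro prob_space_PiM prob_D)
      have "(\<integral>\<^sup>+v. wt \<phi> (brun ls r v N (Suc i) 0 (natv (v ?i)) h') \<partial>mu) = (\<integral>\<^sup>+z. expl N ls z h' \<phi> \<partial>P)" for h'
      proof -
        have "(\<integral>\<^sup>+v. wt \<phi> (brun ls r v N (Suc i) 0 (natv (v ?i)) h') \<partial>mu) =
          (\<integral>\<^sup>+x. (\<integral>\<^sup>+v. wt \<phi> (brun ls r (v(?i := x)) N (Suc i) 0 (natv x) h') \<partial>mu) \<partial>D ?i)"
          by (subst nn_integral_PiM_resample[OF prob_D, where i="?i"], rule measurable_wt_brun) simp_all
        also have "\<dots> = (\<integral>\<^sup>+x. (\<integral>\<^sup>+v. wt \<phi> (brun ls r v N (Suc i) 0 (natv x) h') \<partial>mu) \<partial>D ?i)"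
          by (intro nn_integral_cong arg_cong[where f="wt \<phi>"] brun_cong) auto
        also have "\<dots> = (\<integral>\<^sup>+x. expl N ls (natv x) h' \<phi> \<partial>D ?i)"
          by (simp add: Suc.IH)
        also have "\<dots> = (\<integral>\<^sup>+z. expl N ls z h' \<phi> \<partial>P)"
          by (rule nn_integral_natv[OF init_Suc])
        finally show ?thesis .
      qed
      moreover have "brun ls r (v(?g := x)) N (Suc i) 0 z h' = brun ls r v N (Suc i) 0 z h'" for v z h'
        by (rule brun_cong) auto
      ultimately show "(\<integral>\<^sup>+v. wt \<phi> (brun ls r (v(?g := x)) (Suc N) i m y h) \<partial>mu) =
         (if \<alpha> * h < x then \<phi> (blank ls) else \<integral>\<^sup>+z. expl N ls z (h - x / \<alpha>) \<phi> \<partial>P)"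
        using True mu.emeasure_space_1 by simp
    qed
    also have "\<dots> = expl (Suc N) ls y h \<phi>"
      using True by (simp add: step_def)
    finally show ?thesis .
  next
    case False
    let ?g = "PHold r i m y" and ?i = "PStep r i m y"
    have "(\<integral>\<^sup>+v. wt \<phi> (brun ls r v (Suc N) i m y h) \<partial>mu) =
      (\<integral>\<^sup>+x. (\<integral>\<^sup>+v. wt \<phi> (brun ls r (v(?g := x)) (Suc N) i m y h) \<partial>mu) \<partial>expo)"
      unfolding hold_law[of r i m y, symmetric]
      by (rule nn_integral_PiM_resample[OF prob_D]) (rule measurable_wt_brun, simp)
    also have "\<dots> = (\<integral>\<^sup>+x. (\<integral>\<^sup>+z. expl N ls z (h + x / rate Q y) (\<lambda>w. \<phi> (app (piece ls h (h + x / rate Q y) y) w)) \<partial>J y) \<partial>expo)"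
    proof (rule nn_integral_cong)
      fix x
      have "(\<integral>\<^sup>+v. wt \<psi> (brun ls r v N i (Suc m) (natv (v ?i)) h') \<partial>mu) = (\<integral>\<^sup>+z. expl N ls z h' \<psi> \<partial>J y)" for h' \<psi>
      proof -
        have "(\<integral>\<^sup>+v. wt \<psi> (brun ls r v N i (Suc m) (natv (v ?i)) h') \<partial>mu) =
          (\<integral>\<^sup>+x. (\<integral>\<^sup>+v. wt \<psi> (brun ls r (v(?i := x)) N i (Suc m) (natv x) h') \<partial>mu) \<partial>D ?i)"
          by (subst nn_integral_PiM_resample[OF prob_D, where i="?i"], rule measurable_wt_brun) simp_all
        also have "\<dots> = (\<integral>\<^sup>+x. (\<integral>\<^sup>+v. wt \<psi> (brun ls r v N i (Suc m) (natv x) h') \<partial>mu) \<partial>D ?i)"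
          by (intro nn_integral_cong arg_cong[where f="wt \<psi>"] brun_cong) auto
        also have "\<dots> = (\<integral>\<^sup>+x. expl N ls (natv x) h' \<psi> \<partial>D ?i)"
          by (simp add: Suc.IH)
        also have "\<dots> = (\<integral>\<^sup>+z. expl N ls z h' \<psi> \<partial>J y)"
          by (rule nn_integral_natv[OF step_law])
        finally show ?thesis .
      qed
      moreover have "brun ls r (v(?g := x)) N i (Suc m) z h' = brun ls r v N i (Suc m) z h'" for v z h'
        by (rule brun_cong) auto
      ultimately show "(\<integral>\<^sup>+v. wt \<phi> (brun ls r (v(?g := x)) (Suc N) i m y h) \<partial>mu) =
         (\<integral>\<^sup>+z. expl N ls z (h + x / rate Q y) (\<lambda>w. \<phi> (app (piece ls h (h + x / rate Q y) y) w)) \<partial>J y)"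
        using False by simp
    qed
    also have "\<dots> = expl (Suc N) ls y h \<phi>"
      using False by (simp add: step_def)
    finally show ?thesis .
  qed
qed simp

lemma nn_integral_brun_init:
  "(\<integral>\<^sup>+v. wt \<phi> (brun ls r v N 0 0 (natv (v (PInit r 0))) 0) \<partial>mu) = (\<integral>\<^sup>+n. expl N ls n 0 \<phi> \<partial>I r)"
proof -
  let ?i = "PInit r 0"
  have "(\<integral>\<^sup>+v. wt \<phi> (brun ls r v N 0 0 (natv (v ?i)) 0) \<partial>mu) =
    (\<integral>\<^sup>+x. (\<integral>\<^sup>+v. wt \<phi> (brun ls r (v(?i := x)) N 0 0 (natv x) 0) \<partial>mu) \<partial>D ?i)"
    by (subst nn_integral_PiM_resample[OF prob_D, where i="?i"], rule measurable_wt_brun) simp_all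
  also have "\<dots> = (\<integral>\<^sup>+x. (\<integral>\<^sup>+v. wt \<phi> (brun ls r v N 0 0 (natv x) 0) \<partial>mu) \<partial>D ?i)"
    by (intro nn_integral_cong arg_cong[where f="wt \<phi>"] brun_cong) auto
  also have "\<dots> = (\<integral>\<^sup>+x. expl N ls (natv x) 0 \<phi> \<partial>D ?i)"
    by (simp add: nn_integral_brun)
  also have "\<dots> = (\<integral>\<^sup>+n. expl N ls n 0 \<phi> \<partial>I r)"
    by (rule nn_integral_natv[OF init_0])
  finally show ?thesis .
qed

end

section \<open>Finished runs record the skewer\<close>

lemma app_map: "app (map f ls) (map g ls) = map (\<lambda>u. f u @ g u) ls"
  by (induction ls) auto

text \<open>By minimality of \<open>njumps\<close> the contour has not ended before its last jump,
  so every pre-jump height is nonnegative. Hence an immigrant above a level leaves no trace on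
  it.\<close>

lemma skewer_below_0:
  assumes "0 \<le> \<alpha>" "u < 0"
  shows "skewer Q \<alpha> v r u = []"
proof -
  have pre: "0 \<le> pre_h Q \<alpha> v r i" if "i \<le> njumps Q \<alpha> v r" for i
  proof (cases i)
    case (Suc k)
    then have "k < njumps Q \<alpha> v r" using that by simp
    then have "\<not> (\<alpha> = 0 \<or> (\<Sum>l\<le>k. life Q v r l) < jtime \<alpha> v r (Suc k))"
      unfolding njumps_def by (rule not_less_Least)
    then show ?thesis by (simp add: Suc pre_h_def lessThan_Suc_atMost)
  qed (simp add: pre_h_def jtime_def)
  have "\<not> pre_h Q \<alpha> v r i \<le> u" if "i \<in> set [0..<Suc (njumps Q \<alpha> v r)]" for i
    using that assms(2) pre[of i] by auto
  then show ?thesis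
    by (simp add: skewer_def filter_empty_conv del: upt_Suc set_upt)
qed

context skewer_model
begin

lemma AE_coord:
  assumes "AE u in D x. R u"
  shows "AE v in mu. R (v x)"
  by (rule AE_PiM_component[where P=R]) (use prob_D assms in auto)

text \<open>What chain \<open>i\<close> contributes at level \<open>u\<close> from its
  \<open>m\<close>-th holding interval on; for \<open>m = 0\<close> this is its whole contribution.
  It states the invariant of a run in the middle of a chain.\<close>

definition rest :: "(prim \<Rightarrow> real) \<Rightarrow> src \<Rightarrow> nat \<Rightarrow> nat \<Rightarrow> real \<Rightarrow> nat list" where
  "rest v r i m u = (if pre_h Q \<alpha> v r i + (\<Sum>l<m. hold Q v r i l) \<le> u \<and> u < pre_h Q \<alpha> v r i + life Q v r i
     then [mark Q v r i (u - pre_h Q \<alpha> v r i)] else [])"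

lemma skewer_rest: "skewer Q \<alpha> v r u = concat (map (\<lambda>i. rest v r i 0 u) [0..<Suc (njumps Q \<alpha> v r)])"
  unfolding skewer_def map_filter_concat rest_def by simp

text \<open>Positive holding times make the partial sums strictly increasing before absorption, so
  the \<open>LEAST\<close> in \<open>mark\<close> equals \<open>m\<close> on the \<open>m\<close>-th
  interval.\<close>

lemma rest_step:
  assumes good: "\<And>i m y. 0 < v (PHold r i m y)"
    and nz: "\<And>m'. m' \<le> m \<Longrightarrow> cst v r i m' \<noteq> 0" and z: "cst v r i k = 0"
  defines "h \<equiv> pre_h Q \<alpha> v r i + (\<Sum>l<m. hold Q v r i l)"
  shows "(if h \<le> u \<and> u < h + hold Q v r i m then [cst v r i m] else []) @ rest v r i (Suc m) u = rest v r i m u"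
proof -
  let ?b = "pre_h Q \<alpha> v r i" and ?H = "hold Q v r i"
  have pos: "0 < ?H l" if "cst v r i l \<noteq> 0" for l
    unfolding hold_def using good rate_pos[OF that] by simp
  have pos': "0 \<le> ?H l" if "cst v r i l \<noteq> 0" for l
    using pos[OF that] by simp
  \<comment> \<open>Absorption at some \<open>k\<close> makes \<open>nsteps\<close> a true hitting
    index, which places the \<open>m\<close>-th interval within the lifetime.\<close>
  have n: "cst v r i (nsteps v r i) = 0" unfolding nsteps_def by (rule LeastI[where P="\<lambda>m. cst v r i m = 0", OF z])
  then have mn: "m < nsteps v r i" using nz by (metis not_le_imp_less)
  have nn: "cst v r i l \<noteq> 0" if "l < nsteps v r i" for l
    using that not_less_Least unfolding nsteps_def by blast
  have life: "(\<Sum>l<Suc m. ?H l) \<le> life Q v r i"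
    unfolding life_def using mn by (intro sum_mono2 pos' nn) auto
  have Hm: "0 < ?H m" using pos nz by simp
  consider "u < h" | "h \<le> u" "u < h + ?H m" | "h + ?H m \<le> u" by linarith
  then show ?thesis
  proof cases
    case 1
    then show ?thesis using Hm by (simp add: rest_def h_def)
  next
    case 2
    have "(LEAST m'. u - ?b < (\<Sum>l\<le>m'. ?H l)) = m"
    proof (rule Least_equality)
      show "u - ?b < (\<Sum>l\<le>m. ?H l)" using 2 by (simp add: h_def lessThan_Suc_atMost[symmetric])
      fix k assume k: "u - ?b < (\<Sum>l\<le>k. ?H l)"
      show "m \<le> k"
      proof (rule ccontr)
        assume "\<not> m \<le> k"
        then have "(\<Sum>l\<le>k. ?H l) \<le> (\<Sum>l<m. ?H l)"
          by (intro sum_mono2 pos' nz) auto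
        then show False using k 2 by (simp add: h_def)
      qed
    qed
    then have "mark Q v r i (u - ?b) = cst v r i m" by (simp add: mark_def)
    then show ?thesis using 2 life by (simp add: rest_def h_def)
  next
    case 3
    then show ?thesis using Hm by (simp add: rest_def h_def)
  qed
qed

text \<open>The hypotheses locate the run: chain \<open>i\<close>, step \<open>m\<close>, height
  \<open>h\<close>, no earlier end. That the chain is absorbed and that \<open>i\<close> does not
  exceed \<open>njumps\<close> becomes known once the run has ended, so both facts belong to the
  conclusion and travel back through the recursion.\<close>

lemma brun_sound:
  assumes good: "\<And>i m y. 0 < v (PHold r i m y)" "\<And>i. 0 < v (PGap r i)"
    and "brun ls r v N i m y h = Some w"
    and "y = cst v r i m" "\<And>m'. m' < m \<Longrightarrow> cst v r i m' \<noteq> 0"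
    and "h = pre_h Q \<alpha> v r i + (\<Sum>l<m. hold Q v r i l)"
    and "\<And>i'. i' < i \<Longrightarrow> \<not> (\<alpha> = 0 \<or> (\<Sum>l\<le>i'. life Q v r l) < jtime \<alpha> v r (Suc i'))"
  shows "(\<exists>k. cst v r i k = 0) \<and> i \<le> njumps Q \<alpha> v r \<and>
    w = map (\<lambda>u. rest v r i m u @ concat (map (\<lambda>i'. rest v r i' 0 u) [Suc i..<Suc (njumps Q \<alpha> v r)])) ls"
  using assms(3-)
proof (induction N arbitrary: i m y h w)
  case (Suc N)
  let ?b = "pre_h Q \<alpha> v r" and ?H = "hold Q v r i"
  let ?cnd = "\<lambda>i. \<alpha> = 0 \<or> (\<Sum>l\<le>i. life Q v r l) < jtime \<alpha> v r (Suc i)"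
  show ?case
  proof (cases "y = 0")
    case True
    let ?x = "v (PGap r i)"
    have z: "cst v r i m = 0" using True Suc.prems(2) by simp
    have "nsteps v r i = m"
      unfolding nsteps_def
    proof (rule Least_equality)
      show "cst v r i m = 0" by (rule z)
      show "m \<le> k" if "cst v r i k = 0" for k
        using that Suc.prems(3)[of k] by (metis not_le_imp_less)
    qed
    then have life: "life Q v r i = (\<Sum>l<m. ?H l)" by (simp add: life_def)
    have r0: "rest v r i m u = []" for u by (simp add: rest_def life)
    have j: "jtime \<alpha> v r (Suc i) = jtime \<alpha> v r i + ?x / \<alpha>"
      by (simp add: jtime_def add_divide_distrib)
    have h: "h = (\<Sum>l\<le>i. life Q v r l) - jtime \<alpha> v r i"
      using Suc.prems(4) life by (simp add: pre_h_def lessThan_Suc_atMost[symmetric])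
    \<comment> \<open>The test made by the run is the one whose least solution is
      \<open>njumps\<close>; for \<alpha> = 0 both hold, the first because the gap is
      positive.\<close>
    have cnd: "\<alpha> * h < ?x \<longleftrightarrow> ?cnd i"
    proof (cases "\<alpha> = 0")
      case False
      then have "0 < \<alpha>" using birth_nonneg by simp
      then have "\<alpha> * h < ?x \<longleftrightarrow> h < ?x / \<alpha>" by (simp add: field_simps)
      then show ?thesis using False unfolding h j by auto
    qed (use good in simp)
    show ?thesis
    proof (cases "\<alpha> * h < ?x")
      case lt: True
      then have w: "w = blank ls" using Suc.prems(1) True by simp
      have nj: "njumps Q \<alpha> v r = i"
        unfolding njumps_def using lt cnd Suc.prems(5) by (intro Least_equality) (auto intro: leI)
      show ?thesis
        using z by (auto simp: w nj r0 blank_def)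
    next
      case ge: False
      then have nc: "\<not> ?cnd i" using cnd by simp
      have "(\<exists>k. cst v r (Suc i) k = 0) \<and> Suc i \<le> njumps Q \<alpha> v r \<and>
        w = map (\<lambda>u. rest v r (Suc i) 0 u @ concat (map (\<lambda>i'. rest v r i' 0 u) [Suc (Suc i)..<Suc (njumps Q \<alpha> v r)])) ls"
      proof (rule Suc.IH)
        show "brun ls r v N (Suc i) 0 (cst v r (Suc i) 0) (h - ?x / \<alpha>) = Some w"
          using Suc.prems(1) True ge by simp
        show "h - ?x / \<alpha> = ?b (Suc i) + (\<Sum>l<0. hold Q v r (Suc i) l)"
          by (simp add: pre_h_def h j lessThan_Suc_atMost)
        show "\<not> ?cnd i'" if "i' < Suc i" for i'
          using that nc Suc.prems(5) by (cases "i' = i") auto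
      qed auto
      then show ?thesis
        using z by (auto simp: r0 upt_conv_Cons simp del: upt_Suc)
    qed
  next
    case False
    let ?x = "v (PHold r i m y) / rate Q y"
    have Hm: "?H m = ?x" using Suc.prems(2) by (simp add: hold_def)
    from Suc.prems(1) False obtain w' where
      w': "brun ls r v N i (Suc m) (natv (v (PStep r i m y))) (h + ?x) = Some w'" and
      w: "w = app (piece ls h (h + ?x) y) w'"
      by auto
    have nz: "cst v r i m' \<noteq> 0" if "m' \<le> m" for m'
      using that False Suc.prems(2,3) by (cases "m' = m") auto
    have IH: "(\<exists>k. cst v r i k = 0) \<and> i \<le> njumps Q \<alpha> v r \<and>
       w' = map (\<lambda>u. rest v r i (Suc m) u @ concat (map (\<lambda>i'. rest v r i' 0 u) [Suc i..<Suc (njumps Q \<alpha> v r)])) ls"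
    proof (rule Suc.IH[OF w'])
      show "natv (v (PStep r i m y)) = cst v r i (Suc m)" using Suc.prems(2) by simp
      show "h + ?x = ?b i + (\<Sum>l<Suc m. ?H l)" using Suc.prems(4) Hm by simp
      show "cst v r i m' \<noteq> 0" if "m' < Suc m" for m' using nz that by simp
    qed (rule Suc.prems(5))
    \<comment> \<open>Absorption of the current chain is learned from the later part of the
      run.\<close>
    then obtain k where k: "cst v r i k = 0" by blast
    have "w = map (\<lambda>u. (if h \<le> u \<and> u < h + ?x then [y] else []) @ rest v r i (Suc m) u @ concat (map (\<lambda>i'. rest v r i' 0 u) [Suc i..<Suc (njumps Q \<alpha> v r)])) ls"
      unfolding w piece_def using IH by (simp add: app_map)
    also have "\<dots> = map (\<lambda>u. rest v r i m u @ concat (map (\<lambda>i'. rest v r i' 0 u) [Suc i..<Suc (njumps Q \<alpha> v r)])) ls"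
    proof (intro map_cong refl)
      fix u
      have "(if h \<le> u \<and> u < h + ?x then [y] else []) @ rest v r i (Suc m) u = rest v r i m u"
        using rest_step[where v=v and r=r and i=i and m=m and u=u, OF good(1) nz k]
        unfolding Hm Suc.prems(2)[symmetric] Suc.prems(4)[symmetric] .
      then show "(if h \<le> u \<and> u < h + ?x then [y] else []) @ rest v r i (Suc m) u @ concat (map (\<lambda>i'. rest v r i' 0 u) [Suc i..<Suc (njumps Q \<alpha> v r)]) =
        rest v r i m u @ concat (map (\<lambda>i'. rest v r i' 0 u) [Suc i..<Suc (njumps Q \<alpha> v r)])"
        by (metis append_assoc)
    qed
    finally show ?thesis using IH by blast
  qed
qed simp

lemma block_sound:
  assumes "\<And>i m y. 0 < v (PHold r i m y)" "\<And>i. 0 < v (PGap r i)"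
    and "brun ls r v N 0 0 (natv (v (PInit r 0))) 0 = Some w"
  shows "w = map (skewer Q \<alpha> v r) ls"
proof -
  have "w = map (\<lambda>u. rest v r 0 0 u @ concat (map (\<lambda>i'. rest v r i' 0 u) [Suc 0..<Suc (njumps Q \<alpha> v r)])) ls"
    using brun_sound[OF assms, THEN conjunct2, THEN conjunct2] by (simp add: pre_h_def jtime_def)
  then show ?thesis
    by (simp add: skewer_rest upt_conv_Cons[of 0] del: upt_Suc)
qed

lemma AE_good: "AE v in mu. (\<forall>i m y. 0 < v (PHold r i m y)) \<and> (\<forall>i. 0 < v (PGap r i))"
proof -
  have "AE v in mu. 0 < v (PHold r i m y)" for i m y
    by (rule AE_coord[where R="\<lambda>u. 0 < u"]) (unfold hold_law, rule AE_expo_pos)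
  moreover have "AE v in mu. 0 < v (PGap r i)" for i
    by (rule AE_coord[where R="\<lambda>u. 0 < u"]) (unfold gap_law, rule AE_expo_pos)
  ultimately show ?thesis by (simp add: AE_all_countable)
qed

section \<open>Laws of the lists recorded by blocks and immigrants\<close>

lemma measurable_map_skewer:
  "(\<lambda>v. map (skewer Q \<alpha> v r) ls) \<in> mu \<rightarrow>\<^sub>M count_space UNIV"
  by (rule measurable_map) (rule measurable_skewer, auto)

lemma dfun_law:
  fixes X :: "(prim \<Rightarrow> real) \<Rightarrow> 'b::countable"
  assumes "X \<in> mu \<rightarrow>\<^sub>M count_space UNIV"
  shows "dfun (\<lambda>\<phi>. \<integral>\<^sup>+v. \<phi> (X v) \<partial>mu)"
proof (rule dfun_integral)
  show "(\<lambda>v. indicator {a} (X v)) \<in> borel_measurable mu" for a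
    by (rule measurable_compose[OF assms]) simp
qed (rule dfun_point)

text \<open>A finished run records the skewer, so for each \<open>N\<close> the truncated law stays
  below the law of the skewer. The limit has mass one by \<open>mass\<close>, hence the two laws
  agree and unfinished runs are negligible.\<close>

lemma block_law: "(\<integral>\<^sup>+v. \<phi> (map (skewer Q \<alpha> v r) ls) \<partial>mu) = (\<integral>\<^sup>+n. explore ls n 0 \<phi> \<partial>I r)"
proof -
  interpret mu: prob_space mu by (intro prob_space_PiM prob_D)
  let ?X = "\<lambda>v. map (skewer Q \<alpha> v r) ls"
  have "(\<lambda>\<phi>. \<integral>\<^sup>+n. explore ls n 0 \<phi> \<partial>I r) = (\<lambda>\<phi>. \<integral>\<^sup>+v. \<phi> (?X v) \<partial>mu)"
  proof (rule dfun_eqI)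
    show "dfun (\<lambda>\<phi>. \<integral>\<^sup>+n. explore ls n 0 \<phi> \<partial>I r)"
      by (intro dfun_integral dfun_explore) auto
    show "dfun (\<lambda>\<phi>. \<integral>\<^sup>+v. \<phi> (?X v) \<partial>mu)"
      by (rule dfun_law[OF measurable_map_skewer])
    fix a
    have "(\<integral>\<^sup>+n. explore ls n 0 (indicator {a}) \<partial>I r) = (SUP N. \<integral>\<^sup>+n. expl N ls n 0 (indicator {a}) \<partial>I r)"
      unfolding explore_def
      by (intro nn_integral_monotone_convergence_SUP) (auto intro!: incseq_SucI le_funI expl_Suc_mono simp del: expl.simps)
    also have "\<dots> \<le> (\<integral>\<^sup>+v. indicator {a} (?X v) \<partial>mu)"
    proof (rule SUP_least)
      fix N
      have "(\<integral>\<^sup>+v. wt (indicator {a}) (brun ls r v N 0 0 (natv (v (PInit r 0))) 0) \<partial>mu) \<le> (\<integral>\<^sup>+v. indicator {a} (?X v) \<partial>mu)"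
      proof (rule nn_integral_mono_AE, use AE_good[of r] in eventually_elim)
        case (elim v)
        show ?case
        proof (cases "brun ls r v N 0 0 (natv (v (PInit r 0))) 0")
          case (Some w)
          then have "w = ?X v" using elim by (intro block_sound) auto
          then show ?thesis by (simp add: Some)
        qed simp
      qed
      then show "(\<integral>\<^sup>+n. expl N ls n 0 (indicator {a}) \<partial>I r) \<le> (\<integral>\<^sup>+v. indicator {a} (?X v) \<partial>mu)"
        by (simp only: nn_integral_brun_init)
    qed
    finally show "(\<integral>\<^sup>+n. explore ls n 0 (indicator {a}) \<partial>I r) \<le> (\<integral>\<^sup>+v. indicator {a} (?X v) \<partial>mu)" .
  qed (simp_all add: mass mu.emeasure_space_1)
  then show ?thesis by (rule fun_cong[THEN sym])
qed

text \<open>Blocks read disjoint sets of variables and are split off one at a time from the left, so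
  the induction runs downwards from \<open>length ns\<close>.\<close>

lemma pos_law_drop:
  assumes "k \<le> length ns"
  shows "(\<integral>\<^sup>+v. \<phi> (map (\<lambda>u. concat (map (\<lambda>c. skewer Q \<alpha> v (Pos c) u) [k..<length ns])) ls) \<partial>mu) = blocks ls (drop k ns) \<phi>"
  using assms
proof (induction arbitrary: \<phi> rule: inc_induct)
  case base
  interpret mu: prob_space mu by (intro prob_space_PiM prob_D)
  show ?case by (simp add: mu.emeasure_space_1 blank_def)
next
  case (step k)
  let ?X = "\<lambda>v. map (skewer Q \<alpha> v (Pos k)) ls"
  let ?Y = "\<lambda>v. map (\<lambda>u. concat (map (\<lambda>c. skewer Q \<alpha> v (Pos c) u) [Suc k..<length ns])) ls"
  have Y: "?Y \<in> mu \<rightarrow>\<^sub>M count_space UNIV"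
    by (intro measurable_map measurable_concat_map) (rule measurable_skewer, auto)
  have "(\<integral>\<^sup>+v. \<phi> (map (\<lambda>u. concat (map (\<lambda>c. skewer Q \<alpha> v (Pos c) u) [k..<length ns])) ls) \<partial>mu) = (\<integral>\<^sup>+v. \<phi> (app (?X v) (?Y v)) \<partial>mu)"
    using step.hyps by (simp add: app_map upt_conv_Cons)
  also have "\<dots> = (\<integral>\<^sup>+v. (\<integral>\<^sup>+v'. \<phi> (app (?X v') (?Y v)) \<partial>mu) \<partial>mu)"
  proof (rule nn_integral_PiM_indep[OF prob_D measurable_map_skewer Y, where A="{x. src_of x = Some (Pos k)}"])
    fix v v' :: "prim \<Rightarrow> real"
    show "?X v = ?X v'" if "\<And>i. i \<in> {x. src_of x = Some (Pos k)} \<Longrightarrow> v i = v' i"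
      using that by (intro map_cong skewer_cong) auto
    show "?Y v = ?Y v'" if "\<And>i. i \<notin> {x. src_of x = Some (Pos k)} \<Longrightarrow> v i = v' i"
      using that by (intro map_cong arg_cong[where f=concat] skewer_cong) auto
  qed
  also have "\<dots> = (\<integral>\<^sup>+v. explore ls (ns ! k) 0 (\<lambda>w. \<phi> (app w (?Y v))) \<partial>mu)"
    by (intro nn_integral_cong) (subst block_law, simp add: I_Pos)
  also have "\<dots> = blocks ls (drop (Suc k) ns) (\<lambda>w'. explore ls (ns ! k) 0 (\<lambda>w. \<phi> (app w w')))"
    by (rule step.IH)
  also have "\<dots> = explore ls (ns ! k) 0 (\<lambda>w. blocks ls (drop (Suc k) ns) (\<lambda>w'. \<phi> (app w w')))"
    by (rule dfun_swap[OF dfun_blocks dfun_explore])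
  also have "\<dots> = blocks ls (drop k ns) \<phi>"
    using step.hyps by (simp add: Cons_nth_drop_Suc[symmetric])
  finally show ?case .
qed

lemma pos_law: "(\<integral>\<^sup>+v. \<phi> (map (pos_skewer Q \<alpha> ns v) ls) \<partial>mu) = blocks ls ns \<phi>"
  using pos_law_drop[of 0 \<phi> ls] by (simp add: pos_skewer_def[abs_def])

text \<open>Gap \<open>l\<close> determines immigrant \<open>Suc l\<close>, since
  \<open>negpt\<close> at \<open>j\<close> sums the gaps below \<open>j\<close>. Later immigrants
  stand further left, so the later part of the run comes first in \<open>app\<close>. Each block is
  read at once through \<open>skewer\<close>.\<close>

primrec nrun :: "real \<Rightarrow> real list \<Rightarrow> (prim \<Rightarrow> real) \<Rightarrow> nat \<Rightarrow> nat \<Rightarrow> real \<Rightarrow> nat list list option" where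
  "nrun T ls v 0 = (\<lambda>l h. None)"
| "nrun T ls v (Suc N) = (\<lambda>l h.
     if \<theta> * (T - h) < v (PTh l) then Some (blank ls)
     else map_option (\<lambda>w. app w (map (\<lambda>u. skewer Q \<alpha> v (Neg (Suc l)) (u - (h + v (PTh l) / \<theta>))) ls))
            (nrun T ls v N (Suc l) (h + v (PTh l) / \<theta>)))"

lemma nrun_cong:
  assumes "\<And>l'. l \<le> l' \<Longrightarrow> v (PTh l') = v' (PTh l')"
    and "\<And>x j. src_of x = Some (Neg j) \<Longrightarrow> l < j \<Longrightarrow> v x = v' x"
  shows "nrun T ls v N l h = nrun T ls v' N l h"
  using assms
proof (induction N arbitrary: l h)
  case (Suc N)
  have 1: "nrun T ls v N (Suc l) h' = nrun T ls v' N (Suc l) h'" for h'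
    by (intro Suc.IH) (auto intro: Suc.prems)
  have 2: "skewer Q \<alpha> v (Neg (Suc l)) u = skewer Q \<alpha> v' (Neg (Suc l)) u" for u
    by (intro skewer_cong) (auto intro: Suc.prems)
  have 3: "v (PTh l) = v' (PTh l)" by (auto intro: Suc.prems)
  show ?case by (simp add: 1 2 3)
qed simp

lemma measurable_nrun_pair:
  "(\<lambda>p. nrun T ls (snd p) N l (fst p)) \<in> borel \<Otimes>\<^sub>M mu \<rightarrow>\<^sub>M count_space UNIV"
proof (induction N arbitrary: l)
  case (Suc N)
  have c [measurable]: "(\<lambda>p. snd p x) \<in> borel_measurable (borel \<Otimes>\<^sub>M mu)" for x
    by (rule measurable_compose[OF measurable_snd measurable_coord])
  have 1: "(\<lambda>p. nrun T ls (snd p) N (Suc l) (fst p + snd p (PTh l) / \<theta>)) \<in> borel \<Otimes>\<^sub>M mu \<rightarrow>\<^sub>M count_space UNIV"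
    using measurable_compose[OF _ Suc.IH, of "\<lambda>p. (fst p + snd p (PTh l) / \<theta>, snd p)" "borel \<Otimes>\<^sub>M mu"] by simp
  have 2: "(\<lambda>p. map (\<lambda>u. skewer Q \<alpha> (snd p) (Neg (Suc l)) (u - (fst p + snd p (PTh l) / \<theta>))) ls) \<in> borel \<Otimes>\<^sub>M mu \<rightarrow>\<^sub>M count_space UNIV"
    by (intro measurable_map measurable_skewer) measurable
  have [measurable]: "(\<lambda>p. map_option (\<lambda>w. app w (map (\<lambda>u. skewer Q \<alpha> (snd p) (Neg (Suc l)) (u - (fst p + snd p (PTh l) / \<theta>))) ls))
      (nrun T ls (snd p) N (Suc l) (fst p + snd p (PTh l) / \<theta>))) \<in> borel \<Otimes>\<^sub>M mu \<rightarrow>\<^sub>M count_space UNIV"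
    by (rule measurable_compose_countable[OF measurable_compose[OF 1] 2]) simp
  show ?case unfolding nrun.simps by measurable
qed simp

lemma measurable_nrun: "(\<lambda>v. nrun T ls v N l h) \<in> mu \<rightarrow>\<^sub>M count_space UNIV"
  using measurable_compose[OF _ measurable_nrun_pair, of "\<lambda>v. (h, v)" mu] by simp

text \<open>The block of immigrant \<open>Suc l\<close> reads none of the variables of the later
  run, so it can be averaged separately, at levels shifted by its height.\<close>

lemma nn_integral_nrun: "(\<integral>\<^sup>+v. wt \<phi> (nrun T ls v N l h) \<partial>mu) = imm N T ls h \<phi>"
proof (induction N arbitrary: l h \<phi>)
  case (Suc N)
  interpret mu: prob_space mu by (intro prob_space_PiM prob_D)
  let ?g = "PTh l"
  have "(\<integral>\<^sup>+v. wt \<phi> (nrun T ls v (Suc N) l h) \<partial>mu) =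
    (\<integral>\<^sup>+x. (\<integral>\<^sup>+v. wt \<phi> (nrun T ls (v(?g := x)) (Suc N) l h) \<partial>mu) \<partial>expo)"
    unfolding th_law[of l, symmetric]
    by (rule nn_integral_PiM_resample[OF prob_D]) (rule measurable_compose[OF measurable_nrun], simp)
  also have "\<dots> = (\<integral>\<^sup>+x. (if \<theta> * (T - h) < x then \<phi> (blank ls) else
      imm N T ls (h + x / \<theta>) (\<lambda>w. block (map (\<lambda>u. u - (h + x / \<theta>)) ls) (\<lambda>w'. \<phi> (app w w')))) \<partial>expo)"
  proof (rule nn_integral_cong)
    fix x
    let ?h = "h + x / \<theta>"
    let ?m = "map (\<lambda>u. u - ?h) ls"
    let ?X = "\<lambda>v. map (skewer Q \<alpha> v (Neg (Suc l))) ?m"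
    let ?Y = "\<lambda>v. nrun T ls v N (Suc l) ?h"
    have c: "nrun T ls (v(?g := x)) N (Suc l) h' = nrun T ls v N (Suc l) h'" for v h'
      by (rule nrun_cong) auto
    have s: "skewer Q \<alpha> (v(?g := x)) r u = skewer Q \<alpha> v r u" for v r u
      by (rule skewer_cong) auto
    have "(\<integral>\<^sup>+v. wt (\<lambda>w. \<phi> (app w (?X v))) (?Y v) \<partial>mu) = (\<integral>\<^sup>+v. (\<integral>\<^sup>+v'. wt (\<lambda>w. \<phi> (app w (?X v'))) (?Y v) \<partial>mu) \<partial>mu)"
    proof (rule nn_integral_PiM_indep[OF prob_D measurable_map_skewer measurable_nrun, where A="{x. src_of x = Some (Neg (Suc l))}"])
      fix v v' :: "prim \<Rightarrow> real"
      show "?X v = ?X v'" if "\<And>i. i \<in> {x. src_of x = Some (Neg (Suc l))} \<Longrightarrow> v i = v' i"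
        using that by (intro map_cong skewer_cong) auto
      show "?Y v = ?Y v'" if "\<And>i. i \<notin> {x. src_of x = Some (Neg (Suc l))} \<Longrightarrow> v i = v' i"
        using that by (intro nrun_cong) auto
    qed
    also have "\<dots> = (\<integral>\<^sup>+v. wt (\<lambda>w. block ?m (\<lambda>w'. \<phi> (app w w'))) (?Y v) \<partial>mu)"
    proof (rule nn_integral_cong)
      fix v
      show "(\<integral>\<^sup>+v'. wt (\<lambda>w. \<phi> (app w (?X v'))) (?Y v) \<partial>mu) = wt (\<lambda>w. block ?m (\<lambda>w'. \<phi> (app w w'))) (?Y v)"
      proof (cases "?Y v")
        case (Some w)
        show ?thesis
          unfolding Some wt_simps block_def block_law[where \<phi>="\<lambda>w'. \<phi> (app w w')"] I_Neg ..
      qed simp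
    qed
    also have "\<dots> = imm N T ls ?h (\<lambda>w. block ?m (\<lambda>w'. \<phi> (app w w')))"
      by (rule Suc.IH)
    finally show "(\<integral>\<^sup>+v. wt \<phi> (nrun T ls (v(?g := x)) (Suc N) l h) \<partial>mu) =
      (if \<theta> * (T - h) < x then \<phi> (blank ls) else imm N T ls ?h (\<lambda>w. block ?m (\<lambda>w'. \<phi> (app w w'))))"
      by (simp add: c s comp_def mu.emeasure_space_1)
  qed
  also have "\<dots> = imm (Suc N) T ls h \<phi>"
    by (simp add: istep_def)
  finally show ?case .
qed simp

text \<open>The run is already past immigrant \<open>l\<close>, while fewer than \<open>l\<close>
  immigrants may lie below a given \<open>u\<close>; \<open>max\<close> then makes the list of
  remaining ones empty. Finiteness is carried along because \<open>neg_count\<close> is a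
  cardinality, which is \<open>0\<close> on an infinite set.\<close>

lemma nrun_sound:
  assumes good: "\<And>l. 0 < v (PTh l)" and T: "\<And>u. u \<in> set ls \<Longrightarrow> u \<le> T"
    and "nrun T ls v N l (negpt \<theta> v l) = Some w"
  shows "(\<theta> \<noteq> 0 \<longrightarrow> finite {j. 1 \<le> j \<and> negpt \<theta> v j \<le> T}) \<and>
    w = map (\<lambda>u. concat (map (\<lambda>j. skewer Q \<alpha> v (Neg j) (u - negpt \<theta> v j)) (rev [Suc l..<Suc (max l (neg_count \<theta> v u))]))) ls"
  using assms(3)
proof (induction N arbitrary: l w)
  case (Suc N)
  let ?p = "negpt \<theta> v" and ?x = "v (PTh l)"
  have p: "?p (Suc l) = ?p l + ?x / \<theta>" by (simp add: negpt_def add_divide_distrib)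
  have mono: "?p j \<le> ?p k" if "j \<le> k" for j k
    unfolding negpt_def using that good imm_nonneg
    by (intro divide_right_mono sum_mono2) (auto intro: less_imp_le)
  have sub: "{j. 1 \<le> j \<and> ?p j \<le> u} \<subseteq> {1..l}" if "u < ?p (Suc l)" for u
  proof safe
    fix j assume j: "1 \<le> j" "?p j \<le> u"
    then have "\<not> Suc l \<le> j" using mono[of "Suc l" j] that by auto
    then show "j \<in> {1..l}" using j by simp
  qed
  have small: "max l (neg_count \<theta> v u) = l" if "\<theta> \<noteq> 0 \<Longrightarrow> u < ?p (Suc l)" for u
  proof (cases "\<theta> = 0")
    case False
    then have "card {j. 1 \<le> j \<and> ?p j \<le> u} \<le> card {1..l}" using sub that by (intro card_mono) auto
    then show ?thesis using False by (simp add: neg_count_def)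
  qed (simp add: neg_count_def)
  show ?case
  proof (cases "\<theta> * (T - ?p l) < ?x")
    case True
    then have w: "w = blank ls" using Suc.prems by simp
    have Tp: "T < ?p (Suc l)" if "\<theta> \<noteq> 0"
    proof -
      have "0 < \<theta>" using that imm_nonneg by simp
      then show ?thesis using True unfolding p by (simp add: field_simps)
    qed
    have "max l (neg_count \<theta> v u) = l" if "u \<in> set ls" for u
      using Tp T[OF that] by (intro small) auto
    moreover have "finite {j. 1 \<le> j \<and> ?p j \<le> T}" if "\<theta> \<noteq> 0"
      using sub[OF Tp[OF that]] by (rule finite_subset) simp
    ultimately show ?thesis by (simp add: w blank_def)
  next
    case False
    then have t0: "\<theta> \<noteq> 0" using good[of l] by auto
    from Suc.prems False obtain w' where
      w': "nrun T ls v N (Suc l) (?p (Suc l)) = Some w'" and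
      w: "w = app w' (map (\<lambda>u. skewer Q \<alpha> v (Neg (Suc l)) (u - ?p (Suc l))) ls)"
      unfolding p by auto
    note IH = Suc.IH[OF w']
    then have fin: "finite {j. 1 \<le> j \<and> ?p j \<le> T}" using t0 by simp
    have "w = map (\<lambda>u. concat (map (\<lambda>j. skewer Q \<alpha> v (Neg j) (u - ?p j)) (rev [Suc (Suc l)..<Suc (max (Suc l) (neg_count \<theta> v u))])) @
        skewer Q \<alpha> v (Neg (Suc l)) (u - ?p (Suc l))) ls"
      unfolding w by (simp only: IH[THEN conjunct2] app_map)
    also have "\<dots> = map (\<lambda>u. concat (map (\<lambda>j. skewer Q \<alpha> v (Neg j) (u - ?p j)) (rev [Suc l..<Suc (max l (neg_count \<theta> v u))]))) ls"
    proof (intro map_cong refl)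
      fix u assume u: "u \<in> set ls"
      show "concat (map (\<lambda>j. skewer Q \<alpha> v (Neg j) (u - ?p j)) (rev [Suc (Suc l)..<Suc (max (Suc l) (neg_count \<theta> v u))])) @
        skewer Q \<alpha> v (Neg (Suc l)) (u - ?p (Suc l)) =
        concat (map (\<lambda>j. skewer Q \<alpha> v (Neg j) (u - ?p j)) (rev [Suc l..<Suc (max l (neg_count \<theta> v u))]))"
      \<comment> \<open>An immigrant above \<open>u\<close> is not counted by
        \<open>neg_count\<close>, and its block contributes the empty list at
        \<open>u\<close>.\<close>
      proof (cases "?p (Suc l) \<le> u")
        case True
        have "card {1..Suc l} \<le> card {j. 1 \<le> j \<and> ?p j \<le> u}"
        proof (rule card_mono)
          show "finite {j. 1 \<le> j \<and> ?p j \<le> u}"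
            by (rule finite_subset[OF _ fin]) (use T[OF u] in auto)
          show "{1..Suc l} \<subseteq> {j. 1 \<le> j \<and> ?p j \<le> u}"
            using True by (auto intro: order_trans[OF mono])
        qed
        then have "Suc l \<le> neg_count \<theta> v u" using t0 by (simp add: neg_count_def)
        then have "max (Suc l) (neg_count \<theta> v u) = neg_count \<theta> v u" "max l (neg_count \<theta> v u) = neg_count \<theta> v u"
          "[Suc l..<Suc (neg_count \<theta> v u)] = Suc l # [Suc (Suc l)..<Suc (neg_count \<theta> v u)]"
          by (auto simp: upt_conv_Cons simp del: upt_Suc)
        then show ?thesis by (simp del: upt_Suc)
      next
        case False
        then have "max l (neg_count \<theta> v u) = l" by (intro small) simp
        then have "max l (neg_count \<theta> v u) = l" "max (Suc l) (neg_count \<theta> v u) = Suc l" by auto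
        moreover have "skewer Q \<alpha> v (Neg (Suc l)) (u - ?p (Suc l)) = []"
          using False birth_nonneg by (intro skewer_below_0) auto
        ultimately show ?thesis by simp
      qed
    qed
    finally show ?thesis using fin by simp
  qed
qed simp

text \<open>The argument of \<open>block_law\<close> again, with \<open>immigrate_mass\<close>
  providing the mass.\<close>

lemma neg_law:
  assumes T: "0 \<le> T" "\<And>u. u \<in> set ls \<Longrightarrow> u \<le> T"
  shows "(\<integral>\<^sup>+v. \<phi> (map (neg_skewer Q \<alpha> \<theta> v) ls) \<partial>mu) = immigrate T ls 0 \<phi>"
proof -
  interpret mu: prob_space mu by (intro prob_space_PiM prob_D)
  let ?X = "\<lambda>v. map (neg_skewer Q \<alpha> \<theta> v) ls"
  have good: "AE v in mu. \<forall>l. 0 < v (PTh l)"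
    unfolding AE_all_countable by (intro allI AE_coord[where R="\<lambda>u. 0 < u"]) (unfold th_law, rule AE_expo_pos)
  have "immigrate T ls 0 = (\<lambda>\<phi>. \<integral>\<^sup>+v. \<phi> (?X v) \<partial>mu)"
  proof (rule dfun_eqI)
    show "dfun (\<lambda>\<phi>. \<integral>\<^sup>+v. \<phi> (?X v) \<partial>mu)"
      by (intro dfun_law measurable_map) (rule measurable_neg_skewer, simp)
    fix a
    show "immigrate T ls 0 (indicator {a}) \<le> (\<integral>\<^sup>+v. indicator {a} (?X v) \<partial>mu)"
      unfolding immigrate_def
    proof (rule SUP_least)
      fix N
      have "(\<integral>\<^sup>+v. wt (indicator {a}) (nrun T ls v N 0 0) \<partial>mu) \<le> (\<integral>\<^sup>+v. indicator {a} (?X v) \<partial>mu)"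
      proof (rule nn_integral_mono_AE, use good in eventually_elim)
        case (elim v)
        show ?case
        proof (cases "nrun T ls v N 0 0")
          case (Some w)
          have "w = ?X v"
            using nrun_sound[of v ls T N 0 w] elim T Some by (simp add: negpt_def neg_skewer_def)
          then show ?thesis by (simp add: Some)
        qed simp
      qed
      then show "imm N T ls 0 (indicator {a}) \<le> (\<integral>\<^sup>+v. indicator {a} (?X v) \<partial>mu)"
        by (simp only: nn_integral_nrun)
    qed
  qed (simp_all add: dfun_immigrate immigrate_mass T mu.emeasure_space_1)
  then show ?thesis by (rule fun_cong[THEN sym])
qed

lemma full_law:
  assumes T: "0 \<le> T" "\<And>u. u \<in> set ls \<Longrightarrow> u \<le> T"
  shows "(\<integral>\<^sup>+v. \<phi> (map (full_skewer Q \<alpha> \<theta> ns v) ls) \<partial>mu) = total T ls ns \<phi>"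
proof -
  let ?X = "\<lambda>v. map (pos_skewer Q \<alpha> ns v) ls" and ?Y = "\<lambda>v. map (neg_skewer Q \<alpha> \<theta> v) ls"
  let ?A = "{x. \<exists>c. src_of x = Some (Pos c)}"
  have X: "?X \<in> mu \<rightarrow>\<^sub>M count_space UNIV"
    by (intro measurable_map) (rule measurable_pos_skewer, simp)
  have Y: "?Y \<in> mu \<rightarrow>\<^sub>M count_space UNIV"
    by (intro measurable_map) (rule measurable_neg_skewer, simp)
  have "(\<integral>\<^sup>+v. \<phi> (map (full_skewer Q \<alpha> \<theta> ns v) ls) \<partial>mu) = (\<integral>\<^sup>+v. \<phi> (app (?Y v) (?X v)) \<partial>mu)"
    by (simp add: app_map full_skewer_def[abs_def])
  also have "\<dots> = (\<integral>\<^sup>+v. (\<integral>\<^sup>+v'. \<phi> (app (?Y v) (?X v')) \<partial>mu) \<partial>mu)"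
  proof (rule nn_integral_PiM_indep[OF prob_D X Y, where A="?A" and \<Phi>="\<lambda>a b. \<phi> (app b a)"])
    fix v v' :: "prim \<Rightarrow> real"
    show "?X v = ?X v'" if "\<And>i. i \<in> ?A \<Longrightarrow> v i = v' i"
      unfolding pos_skewer_def using that by (intro map_cong arg_cong[where f=concat] skewer_cong refl) auto
    show "?Y v = ?Y v'" if a: "\<And>i. i \<notin> ?A \<Longrightarrow> v i = v' i"
    proof -
      have "negpt \<theta> v j = negpt \<theta> v' j" for j using a by (simp add: negpt_def)
      moreover have "skewer Q \<alpha> v (Neg j) u = skewer Q \<alpha> v' (Neg j) u" for j u
        using a by (intro skewer_cong) auto
      ultimately show ?thesis by (simp add: neg_skewer_def neg_count_def)
    qed
  qed
  also have "\<dots> = (\<integral>\<^sup>+v. blocks ls ns (\<lambda>w'. \<phi> (app (?Y v) w')) \<partial>mu)"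
    by (simp only: pos_law[where \<phi>="\<lambda>w'. \<phi> (app _ w')"])
  also have "\<dots> = total T ls ns \<phi>"
    unfolding total_def by (rule neg_law[OF T])
  finally show ?thesis .
qed

end

subsection \<open>Path sums and discrete laws\<close>

lemma infsum_ennreal_count_space:
  fixes f :: "'a::countable \<Rightarrow> ennreal"
  shows "infsum f A = (\<integral>\<^sup>+x. f x \<partial>count_space A)"
proof (rule antisym)
  show "infsum f A \<le> (\<integral>\<^sup>+x. f x \<partial>count_space A)"
    unfolding nonneg_infsum_complete[OF zero_le]
  proof (rule SUP_least)
    fix F assume F: "F \<in> {F. finite F \<and> F \<subseteq> A}"
    then have "sum f F = (\<integral>\<^sup>+x. f x * indicator F x \<partial>count_space A)"
      by (subst nn_integral_count_space'[where A=F]) (auto intro!: sum.cong)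
    also have "\<dots> \<le> (\<integral>\<^sup>+x. f x \<partial>count_space A)"
      by (intro nn_integral_mono) (auto split: split_indicator)
    finally show "sum f F \<le> (\<integral>\<^sup>+x. f x \<partial>count_space A)" .
  qed
  let ?F = "\<lambda>n. {x \<in> A. to_nat x < n}"
  have fin: "finite (?F n)" for n
    by (rule inj_on_finite[of to_nat _ "{..<n}"]) auto
  have "(\<integral>\<^sup>+x. f x \<partial>count_space A) = (\<integral>\<^sup>+x. (SUP n. f x * indicator (?F n) x) \<partial>count_space A)"
  proof (intro nn_integral_cong antisym)
    fix x assume "x \<in> space (count_space A)"
    then show "f x \<le> (SUP n. f x * indicator (?F n) x)"
      by (intro SUP_upper2[of "Suc (to_nat x)"]) auto
    show "(SUP n. f x * indicator (?F n) x) \<le> f x"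
      by (rule SUP_least) (auto split: split_indicator)
  qed
  also have "\<dots> = (SUP n. \<integral>\<^sup>+x. f x * indicator (?F n) x \<partial>count_space A)"
    by (rule nn_integral_monotone_convergence_SUP)
       (auto simp: incseq_def le_fun_def intro!: mult_left_mono split: split_indicator)
  also have "\<dots> = (SUP n. sum f (?F n))"
  proof (intro SUP_cong refl)
    fix n
    show "(\<integral>\<^sup>+x. f x * indicator (?F n) x \<partial>count_space A) = sum f (?F n)"
      by (subst nn_integral_count_space'[where A="?F n"]) (auto intro!: sum.cong fin)
  qed
  also have "\<dots> \<le> infsum f A"
    unfolding nonneg_infsum_complete[OF zero_le] by (intro SUP_least SUP_upper) (auto simp: fin)
  finally show "(\<integral>\<^sup>+x. f x \<partial>count_space A) \<le> infsum f A" .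
qed

lemma pmf_embed_sums:
  assumes "\<And>n::nat. 0 \<le> f n" "f sums 1"
  shows "pmf (embed_pmf f) n = f n"
proof (rule pmf_embed_pmf)
  show "(\<integral>\<^sup>+x. ennreal (f x) \<partial>count_space UNIV) = 1"
    using assms sums_unique[OF assms(2)] by (simp add: nn_integral_count_space_nat suminf_ennreal_eq)
qed (rule assms)

text \<open>As \<open>q\<close> is a probability law, the values at the naturals already carry mass
  one, so the domination criterion identifies the whole law.\<close>

lemma (in prob_space) distr_natv:
  assumes X [measurable]: "X \<in> borel_measurable M"
    and q: "\<And>n::nat. measure M {w \<in> space M. X w = real n} = pmf q n"
  shows "distr (distr M borel X) (count_space UNIV) natv = measure_pmf q"
proof -
  have natv: "natv (real n) = n" for n by (simp add: natv_def)
  have Xn: "(\<lambda>w. natv (X w)) \<in> M \<rightarrow>\<^sub>M count_space UNIV" by measurable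
  have eq: "(\<lambda>\<phi>. \<integral>\<^sup>+z. \<phi> z \<partial>q) = (\<lambda>\<phi>. \<integral>\<^sup>+w. \<phi> (natv (X w)) \<partial>M)"
  proof (rule dfun_eqI)
    show "dfun (\<lambda>\<phi>. \<integral>\<^sup>+z. \<phi> z \<partial>q)" by (rule dfun_integral) (auto intro: dfun_point)
    show "dfun (\<lambda>\<phi>. \<integral>\<^sup>+w. \<phi> (natv (X w)) \<partial>M)"
      by (rule dfun_integral[OF dfun_point]) (rule measurable_compose[OF Xn], simp)
    fix n
    have "(\<integral>\<^sup>+z. indicator {n} z \<partial>q) = (\<integral>\<^sup>+w. indicator {w \<in> space M. X w = real n} w \<partial>M)"
      using q[of n] by (simp add: emeasure_pmf_single emeasure_eq_measure)
    also have "\<dots> \<le> (\<integral>\<^sup>+w. indicator {n} (natv (X w)) \<partial>M)"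
      by (intro nn_integral_mono) (auto simp: natv split: split_indicator)
    finally show "(\<integral>\<^sup>+z. indicator {n} z \<partial>q) \<le> (\<integral>\<^sup>+w. indicator {n} (natv (X w)) \<partial>M)" .
  qed (simp_all add: emeasure_space_1)
  show ?thesis
  proof (rule measure_eqI)
    fix A :: "nat set"
    have "emeasure (distr (distr M borel X) (count_space UNIV) natv) A = (\<integral>\<^sup>+z. indicator A z \<partial>distr (distr M borel X) (count_space UNIV) natv)"
      by simp
    also have "\<dots> = (\<integral>\<^sup>+w. indicator A (natv (X w)) \<partial>M)"
      by (subst nn_integral_distr) (auto simp: nn_integral_distr)
    also have "\<dots> = (\<integral>\<^sup>+z. indicator A z \<partial>q)"
      using fun_cong[OF eq, of "indicator A"] by simp
    finally show "emeasure (distr (distr M borel X) (count_space UNIV) natv) A = emeasure (measure_pmf q) A"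
      by simp
  qed simp
qed

lemma qmatrix_rate_nonneg:
  assumes "qmatrix Q"
  shows "0 \<le> rate Q y"
proof -
  have s: "(\<lambda>j. if j = y then 0 else Q y j) sums rate Q y"
    using assms by (simp add: qmatrix_def rate_def)
  have n: "0 \<le> (if j = y then 0 else Q y j)" for j
    using assms by (auto simp: qmatrix_def)
  show ?thesis
    by (rule sums_le[OF n sums_zero s])
qed

lemma jump_prob_law:
  assumes "qmatrix Q"
  shows "0 \<le> jump_prob Q y z" "jump_prob Q y sums 1"
proof -
  have s: "(\<lambda>j. if j = y then 0 else Q y j) sums rate Q y"
    using assms by (simp add: qmatrix_def rate_def)
  show "0 \<le> jump_prob Q y z"
    using assms qmatrix_rate_nonneg[OF assms, of y] by (auto simp: jump_prob_def qmatrix_def)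
  show "jump_prob Q y sums 1"
  proof (cases "rate Q y = 0")
    case True
    then have "jump_prob Q y = (\<lambda>z. if z = y then 1 else 0)" by (auto simp: jump_prob_def)
    then show ?thesis using sums_single[of y "\<lambda>_. 1::real"] by simp
  next
    case False
    then have "jump_prob Q y = (\<lambda>z. (if z = y then 0 else Q y z) / rate Q y)" by (auto simp: jump_prob_def)
    then show ?thesis using sums_divide[OF s, of "rate Q y"] False by simp
  qed
qed

lemma path_weight_Cons:
  "path_weight Q [y] = jump_prob Q y 0"
  "path_weight Q (y # z # zs) = jump_prob Q y z * path_weight Q (z # zs)"
proof -
  have "path_weight Q (y # z # zs) =
      (\<Prod>i<Suc (length (z # zs)). jump_prob Q ((y # z # zs) ! i) ((y # z # zs @ [0]) ! Suc i))"
    by (simp add: path_weight_def)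
  also have "\<dots> = jump_prob Q y z * path_weight Q (z # zs)"
    unfolding prod.lessThan_Suc_shift path_weight_def by simp
  finally show "path_weight Q (y # z # zs) = jump_prob Q y z * path_weight Q (z # zs)" .
qed (simp add: path_weight_def)

lemma infsum_hit_paths:
  assumes "n \<noteq> 0"
  shows "(\<Sum>\<^sub>\<infinity>ys\<in>hit_paths n. f ys) = (\<integral>\<^sup>+zs. indicator {zs. 0 \<notin> set zs} zs * (f (n # zs) :: ennreal) \<partial>count_space UNIV)"
proof -
  have bij: "bij_betw ((#) n) {zs. 0 \<notin> set zs} (hit_paths n)"
  proof (rule bij_betw_imageI)
    show "(#) n ` {zs. 0 \<notin> set zs} = hit_paths n"
    proof (intro equalityI subsetI)
      fix ys assume "ys \<in> hit_paths n"
      then have "ys = n # tl ys" "tl ys \<in> {zs. 0 \<notin> set zs}"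
        by (cases ys; auto simp: hit_paths_def)+
      then show "ys \<in> (#) n ` {zs. 0 \<notin> set zs}" by (rule image_eqI)
    qed (use assms in \<open>auto simp: hit_paths_def intro!: gr0I\<close>)
  qed (simp add: inj_on_def)
  show ?thesis
    unfolding infsum_ennreal_count_space nn_integral_bij_count_space[OF bij, symmetric]
    by (simp add: nn_integral_count_space_indicator mult.commute)
qed

text \<open>At rate \<open>0\<close> the jump chain never leaves \<open>n\<close>, so every path to
  \<open>0\<close> has weight zero.\<close>

lemma rate_pos_of_hit:
  assumes Q: "qmatrix Q" and hit: "hit_prob Q n = 1" and n: "n \<noteq> 0"
  shows "0 < rate Q n"
proof (rule ccontr)
  assume "\<not> 0 < rate Q n"
  then have "rate Q n = 0" using qmatrix_rate_nonneg[OF Q, of n] by simp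
  then have j: "jump_prob Q n z = (if z = n then 1 else 0)" for z by (simp add: jump_prob_def)
  have "path_weight Q (n # zs) = 0" if "0 \<notin> set zs" for zs
    using that
  proof (induction zs)
    case (Cons z zs)
    then show ?case by (cases "z = n") (auto simp: path_weight_Cons j)
  qed (use n in \<open>simp add: path_weight_Cons j\<close>)
  then have "hit_prob Q n = (\<integral>\<^sup>+zs. (0::ennreal) \<partial>count_space (UNIV :: nat list set))"
    unfolding hit_prob_def infsum_hit_paths[OF n]
    by (intro nn_integral_cong) (auto split: split_indicator)
  then show False using hit by simp
qed

lemma (in exploration) path_weight_pathw:
  assumes "\<And>y z. pmf (J y) z = jump_prob Q y z"
  shows "path_weight Q (y # zs) = pathw y zs"
  by (induction zs arbitrary: y) (simp_all add: path_weight_Cons assms)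

subsection \<open>A criterion for the Markov property\<close>

text \<open>A one-sided bound suffices: for \<open>A\<close> and its complement together it is an equality.\<close>

lemma (in prob_space) markov_processI:
  fixes S :: "real \<Rightarrow> 'a \<Rightarrow> 'b::countable" and k :: "real \<Rightarrow> real \<Rightarrow> 'b set \<Rightarrow> 'b \<Rightarrow> ennreal"
  assumes S: "\<And>t. 0 \<le> t \<Longrightarrow> S t \<in> M \<rightarrow>\<^sub>M count_space UNIV"
    and k1: "\<And>s t A c. 0 \<le> s \<Longrightarrow> s \<le> t \<Longrightarrow> k s t A c + k s t (- A) c = 1"
    and k: "\<And>s t A us a. 0 \<le> s \<Longrightarrow> s \<le> t \<Longrightarrow> (\<And>u. u \<in> set us \<Longrightarrow> 0 \<le> u \<and> u \<le> s) \<Longrightarrow>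
      (\<integral>\<^sup>+w. k s t A (S s w) * indicator {a} (map (\<lambda>u. S u w) (s # us)) \<partial>M) \<le>
      (\<integral>\<^sup>+w. indicator A (S t w) * indicator {a} (map (\<lambda>u. S u w) (s # us)) \<partial>M)"
  shows "markov_process M S"
  unfolding markov_process_def
proof (intro conjI allI impI)
  show "S t \<in> M \<rightarrow>\<^sub>M count_space UNIV" if "0 \<le> t" for t by (rule S[OF that])
  fix s t :: real and A assume s: "0 \<le> s" "s \<le> t"
  have m: "(\<lambda>w. map (\<lambda>u. S u w) us) \<in> M \<rightarrow>\<^sub>M count_space UNIV" if "\<And>u. u \<in> set us \<Longrightarrow> 0 \<le> u \<and> u \<le> s" for us
    using that by (intro measurable_map S) auto
  have [measurable]: "S s \<in> M \<rightarrow>\<^sub>M count_space UNIV" "S t \<in> M \<rightarrow>\<^sub>M count_space UNIV"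
    using s by (auto intro: S)
  have k_le: "k s t B c \<le> 1" for B c
    using k1[OF s, of B c] by (metis le_iff_add)
  have mc: "(\<lambda>w. f (S x w)) \<in> borel_measurable M" if "x = s \<or> x = t" for f :: "'b \<Rightarrow> ennreal" and x
    using that by (auto intro!: measurable_compose[of "S s" M "count_space UNIV" f] measurable_compose[of "S t" M "count_space UNIV" f])
  have atom: "(\<integral>\<^sup>+w. k s t A (S s w) * indicator {a} (map (\<lambda>u. S u w) (s # us)) \<partial>M) =
      (\<integral>\<^sup>+w. indicator A (S t w) * indicator {a} (map (\<lambda>u. S u w) (s # us)) \<partial>M)" (is "?l A = ?r A")
    if us: "\<And>u. u \<in> set us \<Longrightarrow> 0 \<le> u \<and> u \<le> s" for us a
  proof -
    let ?l = "\<lambda>A. \<integral>\<^sup>+w. k s t A (S s w) * indicator {a} (map (\<lambda>u. S u w) (s # us)) \<partial>M"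
    let ?r = "\<lambda>A. \<integral>\<^sup>+w. indicator A (S t w) * indicator {a} (map (\<lambda>u. S u w) (s # us)) \<partial>M"
    have [measurable]: "(\<lambda>w. indicator {a} (map (\<lambda>u. S u w) (s # us)) :: ennreal) \<in> borel_measurable M"
      by (rule measurable_compose[OF m]) (use us s in auto)
    have [measurable]: "(\<lambda>w. k s t B (S s w)) \<in> borel_measurable M" "(\<lambda>w. indicator B (S t w) :: ennreal) \<in> borel_measurable M" for B
      by (auto intro!: mc)
    have "?l A + ?l (- A) = (\<integral>\<^sup>+w. indicator {a} (map (\<lambda>u. S u w) (s # us)) \<partial>M)"
      by (subst nn_integral_add[symmetric]) (auto simp: distrib_right[symmetric] k1[OF s] simp del: list.map)
    also have "\<dots> = ?r A + ?r (- A)"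
      by (subst nn_integral_add[symmetric]) (auto intro!: nn_integral_cong simp del: list.map split: split_indicator)
    finally have e: "?l A + ?l (- A) = ?r A + ?r (- A)" .
    have le: "?l B \<le> ?r B" for B by (rule k[OF s us])
    have r1: "?r B \<le> 1" for B
    proof -
      have "?r B \<le> (\<integral>\<^sup>+w. 1 \<partial>M)"
        by (intro nn_integral_mono) (simp add: indicator_def)
      then show ?thesis by (simp add: emeasure_space_1)
    qed
    have fin: "?r B < \<top>" for B by (rule le_less_trans[OF r1 ennreal_one_less_top])
    show ?thesis
    proof (rule antisym[OF le], rule ccontr)
      assume "\<not> ?r A \<le> ?l A"
      then have "?l A < ?r A" by simp
      then have "?l A + ?l (- A) < ?r A + ?r (- A)"
        using le[of "- A"] fin[of "- A"]
        by (intro le_less_trans[OF add_left_mono[OF le]])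
           (simp add: add.commute[of _ "?r (- A)"] ennreal_add_left_cancel_less del: list.map)
      then show False using e by simp
    qed
  qed
  \<comment> \<open>Conditional expectations are compared through two measures, whose densities are
    the indicator at \<open>t\<close> and the kernel at \<open>s\<close>; they have to agree on the
    past.\<close>
  define N1 where "N1 = density M (\<lambda>w. indicator A (S t w))"
  define N2 where "N2 = density M (\<lambda>w. k s t A (S s w))"
  have N1: "emeasure N1 B = (\<integral>\<^sup>+w. indicator A (S t w) * indicator B w \<partial>M)" if "B \<in> sets M" for B
    unfolding N1_def using that by (subst emeasure_density) (auto intro!: mc)
  have N2: "emeasure N2 B = (\<integral>\<^sup>+w. k s t A (S s w) * indicator B w \<partial>M)" if "B \<in> sets M" for B
    unfolding N2_def using that by (subst emeasure_density) (auto intro!: mc)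
  \<comment> \<open>Cylinders over arbitrary finite lists of times form a generating system; the
    empty list yields the whole space.\<close>
  define \<G> where "\<G> = {{w \<in> space M. map (\<lambda>u. S u w) us = a} | us a. \<forall>u\<in>set us. 0 \<le> u \<and> u \<le> s}"
  have GM: "\<G> \<subseteq> sets M"
  proof
    fix B assume "B \<in> \<G>"
    then obtain us a where us: "\<forall>u\<in>set us. 0 \<le> u \<and> u \<le> s" and B: "B = {w \<in> space M. map (\<lambda>u. S u w) us = a}"
      unfolding \<G>_def by blast
    have "(\<lambda>w. map (\<lambda>u. S u w) us) -` {a} \<inter> space M \<in> sets M"
      using m[of us] us by (intro measurable_sets[of _ M "count_space UNIV"]) auto
    then show "B \<in> sets M" unfolding B by (simp add: vimage_def Int_def conj_commute)
  qed
  have "Int_stable \<G>"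
  proof (rule Int_stableI)
    fix B C assume "B \<in> \<G>" "C \<in> \<G>"
    then obtain us a us' a' where us: "\<forall>u\<in>set us. 0 \<le> u \<and> u \<le> s" "\<forall>u\<in>set us'. 0 \<le> u \<and> u \<le> s"
      and B: "B = {w \<in> space M. map (\<lambda>u. S u w) us = a}" and C: "C = {w \<in> space M. map (\<lambda>u. S u w) us' = a'}"
      unfolding \<G>_def by blast
    show "B \<inter> C \<in> \<G>"
    \<comment> \<open>Joining two conditions into one needs a list of matching length; otherwise the
      first event is empty.\<close>
    proof (cases "length us = length a")
      case True
      then have "B \<inter> C = {w \<in> space M. map (\<lambda>u. S u w) (us @ us') = a @ a'}"
        unfolding B C by auto
      moreover have "\<forall>u\<in>set (us @ us'). 0 \<le> u \<and> u \<le> s" using us by auto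
      ultimately show ?thesis unfolding \<G>_def by blast
    next
      case False
      then have "B = {}" unfolding B by (metis (mono_tags, lifting) Collect_empty_eq length_map)
      then show ?thesis using \<open>B \<in> \<G>\<close> by simp
    qed
  qed
  have Gp: "\<G> \<subseteq> Pow (space M)" unfolding \<G>_def by auto
  have atoms: "emeasure N1 B = emeasure N2 B" if "B \<in> \<G>" for B
  proof -
    from that obtain us a where us: "\<And>u. u \<in> set us \<Longrightarrow> 0 \<le> u \<and> u \<le> s" and B: "B = {w \<in> space M. map (\<lambda>u. S u w) us = a}"
      unfolding \<G>_def by blast
    have [measurable]: "B \<in> sets M" using that GM by auto
    \<comment> \<open>The bound on atoms has \<open>s\<close> in front of the levels, so the value
      at \<open>s\<close> is added to the event and summed over.\<close>
    have split: "(\<integral>\<^sup>+w. f w * indicator B w \<partial>M) = (\<integral>\<^sup>+c. (\<integral>\<^sup>+w. f w * indicator {c # a} (map (\<lambda>u. S u w) (s # us)) \<partial>M) \<partial>count_space UNIV)"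
      if [measurable]: "f \<in> borel_measurable M" for f
    proof -
      have "(\<integral>\<^sup>+w. f w * indicator B w \<partial>M) = (\<integral>\<^sup>+w. (\<integral>\<^sup>+c. f w * indicator {c # a} (map (\<lambda>u. S u w) (s # us)) \<partial>count_space UNIV) \<partial>M)"
      proof (intro nn_integral_cong)
        fix w assume w: "w \<in> space M"
        have "(\<integral>\<^sup>+c. f w * indicator {c # a} (map (\<lambda>u. S u w) (s # us)) \<partial>count_space UNIV) =
          (\<integral>\<^sup>+c. (f w * indicator B w) * indicator {S s w} c \<partial>count_space UNIV)"
          using w by (intro nn_integral_cong) (auto simp: B split: split_indicator)
        also have "\<dots> = f w * indicator B w"
          by (subst nn_integral_count_space'[where A="{S s w}"]) auto
        finally show "f w * indicator B w = (\<integral>\<^sup>+c. f w * indicator {c # a} (map (\<lambda>u. S u w) (s # us)) \<partial>count_space UNIV)" ..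
      qed
      also have "\<dots> = (\<integral>\<^sup>+c. (\<integral>\<^sup>+w. f w * indicator {c # a} (map (\<lambda>u. S u w) (s # us)) \<partial>M) \<partial>count_space UNIV)"
      proof (rule nn_integral_count_space_swap)
        fix c
        have [measurable]: "(\<lambda>w. indicator {c # a} (map (\<lambda>u. S u w) (s # us)) :: ennreal) \<in> borel_measurable M"
          by (rule measurable_compose[OF m]) (use us s in auto)
        show "(\<lambda>w. f w * indicator {c # a} (map (\<lambda>u. S u w) (s # us))) \<in> borel_measurable M" by measurable
      qed
      finally show ?thesis .
    qed
    show ?thesis
      by (simp only: N1 N2 \<open>B \<in> sets M\<close> split mc simp_thms atom[OF us])
  qed
  have past: "emeasure N1 B = emeasure N2 B" if "B \<in> sigma_sets (space M) \<G>" for B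
    using \<open>Int_stable \<G>\<close> Gp that
  proof (induct rule: sigma_sets_induct_disjoint)
    case (basic B)
    then show ?case by (rule atoms)
  next
    case empty
    show ?case by simp
  next
    case (compl B)
    have B: "B \<in> sets M" using compl(1) GM sets.sigma_sets_subset by blast
    have f: "emeasure N1 B \<noteq> \<infinity>"
    proof -
      have "emeasure N1 B \<le> (\<integral>\<^sup>+w. 1 \<partial>M)" unfolding N1[OF B] by (intro nn_integral_mono) (auto split: split_indicator)
      then show ?thesis by (auto simp: emeasure_space_1 top_unique)
    qed
    have "{w \<in> space M. map (\<lambda>u. S u w) [] = []} \<in> \<G>" unfolding \<G>_def by fastforce
    then have "emeasure N1 (space M) = emeasure N2 (space M)"
      using atoms[of "space M"] by simp
    then show ?case
      using compl f B emeasure_compl[of B N1] emeasure_compl[of B N2]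
      by (simp add: N1_def N2_def space_density)
  next
    case (union B)
    have B: "range B \<subseteq> sets M" using union(2) GM sets.sigma_sets_subset by blast
    have "emeasure N1 (\<Union>i. B i) = (\<Sum>i. emeasure N1 (B i))"
      using B union(1) by (intro suminf_emeasure[symmetric]) (auto simp: N1_def)
    also have "\<dots> = (\<Sum>i. emeasure N2 (B i))" using union(3) by simp
    also have "\<dots> = emeasure N2 (\<Union>i. B i)"
      using B union(1) by (intro suminf_emeasure) (auto simp: N2_def)
    finally show ?case .
  qed
  have gen: "S u -` C \<inter> space M \<in> sigma_sets (space M) \<G>" if u: "0 \<le> u" "u \<le> s" for u C
  proof -
    have "S u -` C \<inter> space M = (\<Union>x\<in>C. {w \<in> space M. map (\<lambda>u. S u w) [u] = [x]})" by auto
    also have "\<dots> \<in> sigma_sets (space M) \<G>"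
    proof (rule sigma_sets_UNION)
      show "countable ((\<lambda>x. {w \<in> space M. map (\<lambda>u. S u w) [u] = [x]}) ` C)" by simp
      fix B assume "B \<in> (\<lambda>x. {w \<in> space M. map (\<lambda>u. S u w) [u] = [x]}) ` C"
      then obtain x where "B = {w \<in> space M. map (\<lambda>u. S u w) [u] = [x]}" by blast
      moreover have "\<forall>u'\<in>set [u]. 0 \<le> u' \<and> u' \<le> s" using u by simp
      ultimately have "B \<in> \<G>" unfolding \<G>_def by blast
      then show "B \<in> sigma_sets (space M) \<G>" by (rule sigma_sets.Basic)
    qed
    finally show ?thesis .
  qed
  let ?ind = "indicator {w \<in> space M. S t w \<in> A} :: 'a \<Rightarrow> real"
  let ?g = "\<lambda>w. enn2real (k s t A (S s w))"
  \<comment> \<open>One argument for past and present: every sigma-algebra generated by times in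
    \<open>[0, s]\<close> that include \<open>s\<close> yields the same conditional
    expectation.\<close>
  have cond: "AE w in M. real_cond_exp M F ?ind w = ?g w"
    if F: "space F = space M" "sets F = sigma_sets (space M) {S u -` C \<inter> space M | u C. u \<in> U}"
      and U: "s \<in> U" "U \<subseteq> {0..s}" for F :: "'a measure" and U
  proof -
    have EG: "sets F \<subseteq> sigma_sets (space M) \<G>"
      unfolding F(2)
    proof (rule sigma_sets_mono, rule subsetI)
      fix B assume "B \<in> {S u -` C \<inter> space M | u C. u \<in> U}"
      then obtain u C where "u \<in> U" "B = S u -` C \<inter> space M" by blast
      moreover from this U have "0 \<le> u" "u \<le> s" by auto
      ultimately show "B \<in> sigma_sets (space M) \<G>" using gen by simp
    qed
    have subM: "sets F \<subseteq> sets M"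
      using EG GM sets.sigma_sets_subset by blast
    interpret sub: finite_measure_subalgebra M F
      by standard (simp add: subalgebra_def F(1) subM)
    have gF: "?g \<in> borel_measurable F"
    proof -
      have "S s \<in> F \<rightarrow>\<^sub>M count_space UNIV"
      proof (rule measurableI)
        fix C :: "'b set"
        have "S s -` C \<inter> space M \<in> sigma_sets (space M) {S u -` C \<inter> space M | u C. u \<in> U}"
          using U by (intro sigma_sets.Basic) blast
        then show "S s -` C \<inter> space F \<in> sets F" by (simp only: F)
      qed simp
      then show ?thesis by (rule measurable_compose) simp
    qed
    have g1: "0 \<le> ?g w" "?g w \<le> 1" for w using k_le by (auto intro: enn2real_leI)
    have gk: "ennreal (?g w) = k s t A (S s w)" for w
      by (rule ennreal_enn2real) (rule le_less_trans[OF k_le ennreal_one_less_top])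
    have gM: "?g \<in> borel_measurable M"
      by (rule measurable_compose[of "S s" M "count_space UNIV"]) auto
    show ?thesis
    proof (rule sub.real_cond_exp_charact)
      show "integrable M ?ind" by (rule integrable_real_indicator) (auto simp: emeasure_eq_measure)
      show "integrable M ?g" using g1 gM by (intro integrable_const_bound[of _ 1]) auto
      show "?g \<in> borel_measurable F" by (rule gF)
      fix B assume BF: "B \<in> sets F"
      then have [measurable]: "B \<in> sets M" using subM by auto
      have "(\<integral>w\<in>B. ?ind w \<partial>M) = enn2real (\<integral>\<^sup>+w. ennreal (indicator B w *\<^sub>R ?ind w) \<partial>M)"
        unfolding set_lebesgue_integral_def by (rule integral_eq_nn_integral) auto
      also have "(\<integral>\<^sup>+w. ennreal (indicator B w *\<^sub>R ?ind w) \<partial>M) = emeasure N1 B"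
        unfolding N1[OF \<open>B \<in> sets M\<close>] by (intro nn_integral_cong) (auto split: split_indicator)
      also have "\<dots> = emeasure N2 B"
        using BF EG by (intro past) auto
      also have "\<dots> = (\<integral>\<^sup>+w. ennreal (indicator B w *\<^sub>R ?g w) \<partial>M)"
        unfolding N2[OF \<open>B \<in> sets M\<close>] by (intro nn_integral_cong) (auto simp: gk split: split_indicator)
      also have "enn2real \<dots> = (\<integral>w\<in>B. ?g w \<partial>M)"
        unfolding set_lebesgue_integral_def
        by (rule integral_eq_nn_integral[symmetric]) (use g1 gM in auto)
      finally show "(\<integral>w\<in>B. ?ind w \<partial>M) = (\<integral>w\<in>B. ?g w \<partial>M)" .
    qed
  qed
  have "AE w in M. real_cond_exp M (past_alg M S s) ?ind w = ?g w"
  proof (rule cond[of _ "{0..s}"])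
    show "sets (past_alg M S s) = sigma_sets (space M) {S u -` C \<inter> space M | u C. u \<in> {0..s}}"
      unfolding past_alg_def atLeastAtMost_iff by (rule sets_measure_of) blast
  qed (use s in \<open>auto simp: past_alg_def space_measure_of_conv\<close>)
  moreover have "AE w in M. real_cond_exp M (present_alg M S s) ?ind w = ?g w"
  proof (rule cond[of _ "{s}"])
    have "{S s -` C \<inter> space M | C. True} = {S u -` C \<inter> space M | u C. u \<in> {s}}" by blast
    then show "sets (present_alg M S s) = sigma_sets (space M) {S u -` C \<inter> space M | u C. u \<in> {s}}"
      unfolding present_alg_def by (subst sets_measure_of) auto
  qed (use s in \<open>auto simp: present_alg_def space_measure_of_conv\<close>)
  ultimately show "AE w in M. real_cond_exp M (past_alg M S s) ?ind w = real_cond_exp M (present_alg M S s) ?ind w"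
    by eventually_elim simp
qed

section \<open>The Markov property of the concatenated skewer process\<close>

theorem theorem2p6:
  fixes M :: "'w measure" and V :: "prim \<Rightarrow> 'w \<Rightarrow> real"
    and Q :: "nat \<Rightarrow> nat \<Rightarrow> real" and \<alpha> \<theta> :: real
    and p pm :: "nat \<Rightarrow> real" and ns :: "nat list"
  assumes "0 \<le> \<alpha>" and "\<alpha> \<le> 1" and "0 \<le> \<theta>"
    and "\<forall>n\<in>set ns. 1 \<le> n"
    and "qmatrix Q" and "prob_dist p" and "prob_dist pm"
    and "Q 0 0 = 0"
    and "\<forall>n\<ge>1. hit_prob Q n = 1"
    and "ennreal \<alpha> * (\<Sum>\<^sub>\<infinity> n\<in>{1..}. ennreal (p n) * exp_hit Q n) \<le> 1"
    and "prob_space M"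
    and "prob_space.indep_vars M (\<lambda>_. borel) V UNIV"
    and "\<forall>r i m. measure M {w \<in> space M. V (PInit r i) w = real m} =
           (if i = 0 then (case r of Pos c \<Rightarrow> (if m = ns ! c then 1 else 0) | Neg j \<Rightarrow> pm m)
            else p m)"
    and "\<forall>r i m y z. measure M {w \<in> space M. V (PStep r i m y) w = real z} = jump_prob Q y z"
    and "\<forall>r i m y. distributed M lborel (V (PHold r i m y)) (exponential_density 1)"
    and "\<forall>r l. distributed M lborel (V (PGap r l)) (exponential_density 1)"
    and "\<forall>l. distributed M lborel (V (PTh l)) (exponential_density 1)"
  shows "markov_process M (\<lambda>y w. full_skewer Q \<alpha> \<theta> ns (\<lambda>x. V x w) y)"
proof -
  note \<alpha> = assms(1) and \<theta> = assms(3) and Q = assms(5) and p = assms(6) and pm = assms(7)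
    and hit = assms(9) and mean = assms(10) and indep = assms(12)
  interpret M: prob_space M by fact
  define J where "J y = embed_pmf (jump_prob Q y)" for y
  define P where "P = embed_pmf p"
  define PM where "PM = embed_pmf pm"
  define D where "D x = distr M borel (V x)" for x
  define I where "I r = (case r of Pos c \<Rightarrow> return_pmf (ns ! c) | Neg j \<Rightarrow> PM)" for r
  have pmf_J: "pmf (J y) z = jump_prob Q y z" for y z
    unfolding J_def by (rule pmf_embed_sums) (rule jump_prob_law[OF Q])+
  have pmf_P: "pmf P z = p z" for z
    unfolding P_def using p by (intro pmf_embed_sums) (auto simp: prob_dist_def)
  have pmf_PM: "pmf PM z = pm z" for z
    unfolding PM_def using pm by (intro pmf_embed_sums) (auto simp: prob_dist_def)
  have V [measurable]: "V x \<in> borel_measurable M" for x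
    using indep unfolding M.indep_vars_def by simp
  interpret ex: exploration J P "rate Q" \<alpha>
  proof
    show "0 < rate Q y" if "y \<noteq> 0" for y
      using hit that by (intro rate_pos_of_hit[OF Q]) auto
  qed (rule \<alpha>)
  note pw = ex.path_weight_pathw[OF pmf_J]
  have hit': "(\<integral>\<^sup>+zs. indicator ex.nz zs * ennreal (ex.pathw y zs) \<partial>count_space UNIV) = 1" if "y \<noteq> 0" for y
    using hit that by (simp add: hit_prob_def infsum_hit_paths pw ex.nz_def)
  have P0: "pmf P 0 = 0"
    using p by (simp add: pmf_P prob_dist_def)
  \<comment> \<open>The mean absorption time as a path sum. It is matched with
    \<open>exp_hit\<close> for \<open>z \<noteq> 0\<close>, and \<open>P\<close> gives
    \<open>0\<close> no mass.\<close>
  define H where "H z = (\<integral>\<^sup>+zs. indicator ex.nz zs * ennreal (ex.pathw z zs) *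
      ennreal (\<Sum>y\<leftarrow>z # zs. 1 / rate Q y) \<partial>count_space UNIV)" for z
  have "exp_hit Q z = H z" if "z \<noteq> 0" for z
  proof -
    have e: "(\<Sum>i<length ys. 1 / rate Q (ys ! i)) = (\<Sum>y\<leftarrow>ys. 1 / rate Q y)" for ys
      by (simp add: sum_list_sum_nth atLeast0LessThan)
    show ?thesis
      unfolding exp_hit_def H_def e infsum_hit_paths[OF that] pw ex.nz_def
      using hit that by (simp add: mult.assoc del: list.map sum_list.Cons)
  qed
  then have "(\<Sum>\<^sub>\<infinity>n\<in>{1..}. ennreal (p n) * exp_hit Q n) = (\<integral>\<^sup>+z. ennreal (p z) * H z \<partial>count_space {1..})"
    unfolding infsum_ennreal_count_space by (intro nn_integral_cong) auto
  also have "\<dots> = (\<integral>\<^sup>+z. H z \<partial>P)"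
    unfolding nn_integral_measure_pmf pmf_P using P0
    by (subst nn_integral_count_space_indicator) (auto intro!: nn_integral_cong simp: pmf_P not_le split: split_indicator)
  finally have mean': "ennreal \<alpha> * (\<integral>\<^sup>+z. H z \<partial>P) \<le> 1"
    using mean by simp
  interpret im: immigration J P "rate Q" \<alpha> \<theta> PM
    by unfold_locales (rule \<theta>, rule ex.explore_mass[OF hit' P0 mean'[unfolded H_def]])
  have expo: "distr M borel (V x) = expo" if "distributed M lborel (V x) (exponential_density 1)" for x
  proof -
    have "distr M borel (V x) = distr M lborel (V x)" by (rule distr_cong) auto
    then show ?thesis unfolding expo_def using distributed_distr_eq_density[OF that] by simp
  qed
  interpret sm: skewer_model J P Q \<alpha> \<theta> PM ns D I
  proof (rule skewer_model.intro[OF im.immigration_axioms skewer_model_axioms.intro])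
    show "prob_space (D x)" for x unfolding D_def by (rule M.prob_space_distr) simp
    show "sets (D x) = sets borel" for x by (simp add: D_def)
    show "distr (D (PInit r 0)) (count_space UNIV) natv = measure_pmf (I r)" for r
      unfolding D_def using assms(13)
      by (intro M.distr_natv) (auto simp: I_def pmf_PM indicator_def split: src.splits)
    show "distr (D (PInit r (Suc i))) (count_space UNIV) natv = measure_pmf P" for r i
      unfolding D_def using assms(13) by (intro M.distr_natv) (auto simp: pmf_P)
    show "distr (D (PStep r i m y)) (count_space UNIV) natv = measure_pmf (J y)" for r i m y
      unfolding D_def using assms(14) by (intro M.distr_natv) (auto simp: pmf_J)
    show "D (PHold r i m y) = expo" "D (PGap r i) = expo" "D (PTh l) = expo" for r i m y l
      unfolding D_def using assms(15-17) by (auto intro: expo)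
  qed (simp_all add: I_def)
  let ?S = "\<lambda>u w. full_skewer Q \<alpha> \<theta> ns (\<lambda>x. V x w) u"
  \<comment> \<open>Independence means that the joint law of the variables is the product of their
    laws, so the formula obtained on the canonical space applies.\<close>
  have law: "(\<integral>\<^sup>+w. \<phi> (map (\<lambda>u. ?S u w) ls) \<partial>M) = im.total T ls ns \<phi>"
    if T: "0 \<le> T" "\<And>u. u \<in> set ls \<Longrightarrow> u \<le> T" for T ls \<phi>
  proof -
    let ?B = "PiM UNIV (\<lambda>_::prim. borel :: real measure)"
    have "(\<lambda>v. map (full_skewer Q \<alpha> \<theta> ns v) ls) \<in> ?B \<rightarrow>\<^sub>M count_space UNIV"
      by (intro measurable_map) (rule measurable_full_skewer, simp)
    then have f: "(\<lambda>v. \<phi> (map (full_skewer Q \<alpha> \<theta> ns v) ls)) \<in> borel_measurable ?B"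
      by (rule measurable_compose) simp
    have g: "(\<lambda>w x. V x w) \<in> M \<rightarrow>\<^sub>M ?B"
      by (rule measurable_PiM_single') auto
    have "distr M ?B (\<lambda>w x. V x w) = PiM UNIV D"
      using indep M.indep_vars_iff_distr_eq_PiM[where I=UNIV and M'="\<lambda>_. borel" and X=V] by (simp add: D_def[abs_def] restrict_def)
    then have "im.total T ls ns \<phi> = (\<integral>\<^sup>+v. \<phi> (map (full_skewer Q \<alpha> \<theta> ns v) ls) \<partial>distr M ?B (\<lambda>w x. V x w))"
      using sm.full_law[OF T] by simp
    also have "\<dots> = (\<integral>\<^sup>+w. \<phi> (map (\<lambda>u. ?S u w) ls) \<partial>M)"
      by (subst nn_integral_distr[OF g]) (use f in simp_all)
    finally show ?thesis ..
  qed
  show ?thesis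
  proof (rule M.markov_processI[where k="\<lambda>s t A c. im.ibranch (t - s) c (indicator A)"])
    show "?S t \<in> M \<rightarrow>\<^sub>M count_space UNIV" for t
      by (rule measurable_full_skewer) simp
    fix s t :: real and A :: "nat list set" assume st: "0 \<le> s" "s \<le> t"
    fix c
    have "im.ibranch (t - s) c (indicator A) + im.ibranch (t - s) c (indicator (- A)) =
        im.ibranch (t - s) c (\<lambda>b. indicator A b + indicator (- A) b)"
      by (rule dfun_add[OF im.dfun_ibranch, symmetric])
    also have "(\<lambda>b. indicator A b + indicator (- A) b) = (\<lambda>_. 1 :: ennreal)"
      by (auto simp: fun_eq_iff split: split_indicator)
    finally show "im.ibranch (t - s) c (indicator A) + im.ibranch (t - s) c (indicator (- A)) = 1"
      using st by (simp add: im.ibranch_mass)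
  next
    fix s t :: real and A :: "nat list set" and us a
    assume st: "0 \<le> s" "s \<le> t" and us: "\<And>u. u \<in> set us \<Longrightarrow> 0 \<le> u \<and> u \<le> s"
    \<comment> \<open>The test function reads the list at \<open>t\<close> from the head of the
      record and those at \<open>s # us\<close> from its tail.\<close>
    define \<phi> :: "nat list list \<Rightarrow> ennreal" where "\<phi> v = indicator A (hd v) * indicator {a} (tl v)" for v
    have lift: "im.ilift (t - s) \<phi> v = im.ibranch (t - s) (hd v) (indicator A) * indicator {a} v" for v
      unfolding im.ilift_def \<phi>_def using dfun_cmult[OF im.dfun_ibranch, of _ _ "indicator {a} v" "indicator A"]
      by (simp add: mult.commute)
    have "(\<integral>\<^sup>+w. im.ibranch (t - s) (?S s w) (indicator A) * indicator {a} (map (\<lambda>u. ?S u w) (s # us)) \<partial>M) =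
        (\<integral>\<^sup>+w. im.ilift (t - s) \<phi> (map (\<lambda>u. ?S u w) (s # us)) \<partial>M)"
      by (simp add: lift)
    also have "\<dots> = im.total s (s # us) ns (im.ilift (t - s) \<phi>)"
      using st us by (intro law) auto
    also have "\<dots> \<le> im.total t (t # s # us) ns \<phi>"
      using st us by (intro im.total_branch) auto
    also have "\<dots> = (\<integral>\<^sup>+w. \<phi> (map (\<lambda>u. ?S u w) (t # s # us)) \<partial>M)"
      using st us by (intro law[symmetric]) force+
    also have "\<dots> = (\<integral>\<^sup>+w. indicator A (?S t w) * indicator {a} (map (\<lambda>u. ?S u w) (s # us)) \<partial>M)"
      by (simp add: \<phi>_def)
    finally show "(\<integral>\<^sup>+w. im.ibranch (t - s) (?S s w) (indicator A) * indicator {a} (map (\<lambda>u. ?S u w) (s # us)) \<partial>M) \<le>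
      (\<integral>\<^sup>+w. indicator A (?S t w) * indicator {a} (map (\<lambda>u. ?S u w) (s # us)) \<partial>M)" .
  qed
qed

end
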